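(* Let $T,K,r,\sigma>0$. There exists a constant $C$, independent of $\lambda$ and of $n$, such that for every $\lambda>0$, every initial guess $u^0\in C_b(\mathbb R)$ (regarded as a function of $(x,t)$ that does not depend on $t$), and every $n=1,2,\dots$, $$\|u^{n+1}-u^{\lambda}\|_{\infty}\ \le\ C^n\,\frac{T^n}{n!}\,\exp\Big(n\Big(\frac{M}{\lambda}+rT\Big)\Big)\,(M+K+\lambda T),\qquad M:=\|(h-u^1)^+\|_\infty,$$ where $\{u^n\}_{n\ge1}$ is the sequence of value functions generated from $u^0$ by the policy iteration described in the context, $u^\lambda$ is the optimal value function described in the context, and $h(x)=(K-e^x)^+$.
   Context: $C_b(\mathbb R)$ is the set of bounded continuous functions on $\mathbb R$ and $\|\cdot\|_\infty$ is the supremum norm (over $\mathbb R\times[0,T]$ for functions of $(x,t)$). By the paper's convention, constants $C$ may depend on the model coefficients $r,\sigma,K$. Put $g(S)=(K-S)^+$, $h(x)=g(e^x)$, $\mathcal L_x=\frac12\sigma^2\partial_{xx}+(r-\frac12\sigma^2)\partial_x-r$, $R(\pi)=\pi-\pi\log\pi$, and define the Hamiltonian $H(x,\pi,u)=(h(x)-u)\pi+\lambda R(\pi)$. Optimal value function: $u^\lambda$ is the classical solution on $\mathbb R\times[0,T]$, satisfying $0\le u^\lambda(x,t)\le K+\lambda(T-t)$, of $$\partial_tu^\lambda+\mathcal L_xu^\lambda+\lambda\exp\Big(-\frac{u^\lambda-h}{\lambda}\Big)=0,\qquad u^\lambda(x,T)=h(x).$$ Policy iteration: for $n\ge0$, given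 $u^n$, define the feedback strategy $$\pi^{n+1}(x,t)=\operatorname*{argmax}_{\pi\in(0,\infty)}H(x,\pi,u^n(x,t))=\exp\Big(-\frac{u^n(x,t)-h(x)}{\lambda}\Big),$$ and let $u^{n+1}$ be the value function of the strategy $\pi^{n+1}$, which satisfies the linear problem $$\partial_tu^{n+1}+\mathcal L_xu^{n+1}+H(x,\pi^{n+1}(x,t),u^{n+1})=0,\qquad u^{n+1}(x,T)=h(x).$$ Here the value function $u^\pi$ of a feedback strategy $\pi(x,t)$ is defined by $$p\,u^{\pi}(\log S,t)=\mathbb E\Big[\int_t^T e^{-r(s-t)}\big(g(S_s)\pi_s+\lambda R(\pi_s)\big)p_s\,ds+e^{-r(T-t)}g(S_T)p_T\Big],$$ where $dS_s=S_s(r\,ds+\sigma\,dW_s)$, $S_t=S>0$, $W$ is a standard Brownian motion, $\pi_s=\pi(\log S_s,s)$, and $dp_s=-\pi_sp_s\,ds$, $p_t=p$. *)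

theory Defs
  imports "HOL-Probability.Probability"
begin

text \<open>
  Time is real; only times \<open>t \<ge> 0\<close> matter. All paths (not just almost all) are continuous, so that
  path integrals such as the one in \<open>reward\<close> below are measurable also when \<open>M\<close> is not complete.
\<close>

locale brownian_motion = prob_space M + filtration "space M" F
  for M :: "'a measure" and F :: "real \<Rightarrow> 'a measure" +
  fixes W :: "real \<Rightarrow> 'a \<Rightarrow> real"
  assumes sets_F_le: "sets (F t) \<subseteq> sets M"
    and adapted: "0 \<le> t \<Longrightarrow> W t \<in> borel_measurable (F t)"
    and start: "AE \<omega> in M. W 0 \<omega> = 0"
    and continuous_paths: "\<omega> \<in> space M \<Longrightarrow> continuous_on {0..} (\<lambda>t. W t \<omega>)"
    and normal_increments: "0 \<le> s \<Longrightarrow> s < t \<Longrightarrow>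
      distributed M lborel (\<lambda>\<omega>. W t \<omega> - W s \<omega>) (normal_density 0 (sqrt (t - s)))"
    and indep_increments: "0 \<le> s \<Longrightarrow> s < t \<Longrightarrow>
      indep_set (sets (F s)) (sets (vimage_algebra (space M) (\<lambda>\<omega>. W t \<omega> - W s \<omega>) borel))"

definition is_partition :: "real \<Rightarrow> real \<Rightarrow> nat \<Rightarrow> (nat \<Rightarrow> real) \<Rightarrow> bool" where
  "is_partition a b k \<tau> \<longleftrightarrow> \<tau> 0 = a \<and> \<tau> k = b \<and> (\<forall>i<k. \<tau> i < \<tau> (Suc i))"

text \<open>
  \<open>has_ito_integral M W X I a b\<close>: for an adapted integrand \<open>X\<close> with continuous paths, \<open>I\<close> is
  (a version of) the Ito integral of \<open>X\<close> against \<open>W\<close> over \<open>[a,b]\<close>, i.e. the limit in probability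
  of the left-endpoint sums as the mesh of the partition tends to 0. It is only used for such \<open>X\<close>.
\<close>

definition has_ito_integral ::
  "'a measure \<Rightarrow> (real \<Rightarrow> 'a \<Rightarrow> real) \<Rightarrow> (real \<Rightarrow> 'a \<Rightarrow> real) \<Rightarrow> ('a \<Rightarrow> real) \<Rightarrow> real \<Rightarrow> real \<Rightarrow> bool"
where
  "has_ito_integral M W X I a b \<longleftrightarrow>
     I \<in> borel_measurable M \<and>
     (\<forall>\<epsilon>>0. \<forall>\<eta>>0. \<exists>\<delta>>0. \<forall>k \<tau>.
        is_partition a b k \<tau> \<and> (\<forall>i<k. \<tau> (Suc i) - \<tau> i < \<delta>) \<longrightarrow>
        measure M {\<omega> \<in> space M.
          \<bar>(\<Sum>i<k. X (\<tau> i) \<omega> * (W (\<tau> (Suc i)) \<omega> - W (\<tau> i) \<omega>)) - I \<omega>\<bar> > \<epsilon>} < \<eta>)"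

text \<open>
  \<open>dS = S (r ds + \<sigma> dW)\<close> on \<open>[t,T]\<close>, \<open>S\<^sub>t = S0\<close>, for an adapted continuous process with values in
  \<open>(0,\<infinity>)\<close>, written in integrated form.
\<close>

definition stock_price ::
  "'a measure \<Rightarrow> (real \<Rightarrow> 'a measure) \<Rightarrow> (real \<Rightarrow> 'a \<Rightarrow> real) \<Rightarrow> real \<Rightarrow> real \<Rightarrow> real \<Rightarrow> real \<Rightarrow> real
     \<Rightarrow> (real \<Rightarrow> 'a \<Rightarrow> real) \<Rightarrow> bool"
where
  "stock_price M F W r \<sigma> t T S0 S \<longleftrightarrow>
     (\<forall>s\<in>{t..T}. S s \<in> borel_measurable (F s)) \<and>
     (\<forall>\<omega>\<in>space M. S t \<omega> = S0 \<and> continuous_on {t..T} (\<lambda>s. S s \<omega>) \<and> (\<forall>s\<in>{t..T}. 0 < S s \<omega>)) \<and>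
     (\<forall>s\<in>{t..T}. has_ito_integral M W (\<lambda>q \<omega>. \<sigma> * S q \<omega>)
        (\<lambda>\<omega>. S s \<omega> - S0 - (LBINT q:{t..s}. r * S q \<omega>)) t s)"

text \<open>\<open>dp = - \<pi>(log S\<^sub>s, s) p ds\<close> on \<open>[t,T]\<close>, \<open>p\<^sub>t = p0\<close>, path by path.\<close>

definition stopping_weight ::
  "'a measure \<Rightarrow> (real \<Rightarrow> real \<Rightarrow> real) \<Rightarrow> (real \<Rightarrow> 'a \<Rightarrow> real) \<Rightarrow> real \<Rightarrow> real \<Rightarrow> real
     \<Rightarrow> (real \<Rightarrow> 'a \<Rightarrow> real) \<Rightarrow> bool"
where
  "stopping_weight M \<pi> S t T p0 p \<longleftrightarrow>
     (\<forall>\<omega>\<in>space M. p t \<omega> = p0 \<and>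
        (\<forall>s\<in>{t..T}. ((\<lambda>s. p s \<omega>) has_real_derivative - \<pi> (ln (S s \<omega>)) s * p s \<omega>)
           (at s within {t..T})))"

definition put_payoff :: "real \<Rightarrow> real \<Rightarrow> real" where
  "put_payoff K S = max (K - S) 0"

definition log_payoff :: "real \<Rightarrow> real \<Rightarrow> real" where
  "log_payoff K x = put_payoff K (exp x)"

definition entropy_reg :: "real \<Rightarrow> real" where
  "entropy_reg q = q - q * ln q"

definition hamiltonian :: "real \<Rightarrow> real \<Rightarrow> real \<Rightarrow> real \<Rightarrow> real \<Rightarrow> real" where
  "hamiltonian K lam x q v = (log_payoff K x - v) * q + lam * entropy_reg q"

definition reward ::
  "real \<Rightarrow> real \<Rightarrow> real \<Rightarrow> real \<Rightarrow> real \<Rightarrow> (real \<Rightarrow> real \<Rightarrow> real)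
     \<Rightarrow> (real \<Rightarrow> 'a \<Rightarrow> real) \<Rightarrow> (real \<Rightarrow> 'a \<Rightarrow> real) \<Rightarrow> 'a \<Rightarrow> real"
where
  "reward r K lam t T \<pi> S p \<omega> =
     (LBINT s:{t..T}. exp (- r * (s - t)) *
        (put_payoff K (S s \<omega>) * \<pi> (ln (S s \<omega>)) s + lam * entropy_reg (\<pi> (ln (S s \<omega>)) s)) * p s \<omega>)
     + exp (- r * (T - t)) * put_payoff K (S T \<omega>) * p T \<omega>"

text \<open>
  The pair \<open>(S, p)\<close> is determined up to a null set by its initial data (for a continuous feedback
  \<open>\<pi>\<close>), so quantifying over all such pairs does not depend on a choice of solution.
\<close>

definition is_value_function ::
  "'a measure \<Rightarrow> (real \<Rightarrow> 'a measure) \<Rightarrow> (real \<Rightarrow> 'a \<Rightarrow> real) \<Rightarrow> real \<Rightarrow> real \<Rightarrow> real \<Rightarrow> real \<Rightarrow> real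
     \<Rightarrow> (real \<Rightarrow> real \<Rightarrow> real) \<Rightarrow> (real \<Rightarrow> real \<Rightarrow> real) \<Rightarrow> bool"
where
  "is_value_function M F W r \<sigma> K lam T \<pi> v \<longleftrightarrow>
     (\<forall>S0>0. \<forall>t\<in>{0..T}. \<forall>p0>0. \<forall>S p.
        stock_price M F W r \<sigma> t T S0 S \<longrightarrow> stopping_weight M \<pi> S t T p0 p \<longrightarrow>
        p0 * v (ln S0) t = (LINT \<omega>|M. reward r K lam t T \<pi> S p \<omega>))"

text \<open>
  \<open>u n\<close> is the \<open>n\<close>-th iterate and \<open>\<pi> n\<close> (for \<open>n \<ge> 1\<close>) the \<open>n\<close>-th feedback strategy, both as
  functions of \<open>(x,t)\<close>; only their values for \<open>t \<in> [0,T]\<close> are meaningful.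
\<close>

definition policy_iteration ::
  "'a measure \<Rightarrow> (real \<Rightarrow> 'a measure) \<Rightarrow> (real \<Rightarrow> 'a \<Rightarrow> real) \<Rightarrow> real \<Rightarrow> real \<Rightarrow> real \<Rightarrow> real \<Rightarrow> real
     \<Rightarrow> (real \<Rightarrow> real) \<Rightarrow> (nat \<Rightarrow> real \<Rightarrow> real \<Rightarrow> real) \<Rightarrow> (nat \<Rightarrow> real \<Rightarrow> real \<Rightarrow> real) \<Rightarrow> bool"
where
  "policy_iteration M F W r \<sigma> K lam T u0 \<pi> u \<longleftrightarrow>
     (\<forall>x. \<forall>t\<in>{0..T}. u 0 x t = u0 x) \<and>
     (\<forall>n. (\<forall>x. \<forall>t\<in>{0..T}.
             is_arg_max (\<lambda>q. hamiltonian K lam x q (u n x t)) (\<lambda>q. 0 < q) (\<pi> (Suc n) x t)) \<and>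
          is_value_function M F W r \<sigma> K lam T (\<pi> (Suc n)) (u (Suc n)))"

text \<open>
  Classical solution: continuous on \<open>\<real> \<times> [0,T]\<close>, with continuous \<open>v\<^sub>t, v\<^sub>x, v\<^sub>x\<^sub>x\<close> and the equation in
  \<open>\<real> \<times> (0,T)\<close>. (The terminal datum has a kink, so the derivatives cannot extend up to \<open>T\<close>.)
\<close>

definition is_optimal_value ::
  "real \<Rightarrow> real \<Rightarrow> real \<Rightarrow> real \<Rightarrow> real \<Rightarrow> (real \<Rightarrow> real \<Rightarrow> real) \<Rightarrow> bool"
where
  "is_optimal_value r \<sigma> K lam T v \<longleftrightarrow>
     continuous_on (UNIV \<times> {0..T}) (\<lambda>(x, t). v x t) \<and>
     (\<exists>vt vx vxx.
        continuous_on (UNIV \<times> {0<..<T}) (\<lambda>(x, t). vt x t) \<and>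
        continuous_on (UNIV \<times> {0<..<T}) (\<lambda>(x, t). vx x t) \<and>
        continuous_on (UNIV \<times> {0<..<T}) (\<lambda>(x, t). vxx x t) \<and>
        (\<forall>x. \<forall>t\<in>{0<..<T}.
           ((\<lambda>s. v x s) has_real_derivative vt x t) (at t) \<and>
           ((\<lambda>y. v y t) has_real_derivative vx x t) (at x) \<and>
           ((\<lambda>y. vx y t) has_real_derivative vxx x t) (at x) \<and>
           vt x t + (1/2 * \<sigma>\<^sup>2 * vxx x t + (r - 1/2 * \<sigma>\<^sup>2) * vx x t - r * v x t)
             + lam * exp (- (v x t - log_payoff K x) / lam) = 0)) \<and>
     (\<forall>x. v x T = log_payoff K x) \<and>
     (\<forall>x. \<forall>t\<in>{0..T}. 0 \<le> v x t \<and> v x t \<le> K + lam * (T - t))"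

definition bounded_on_strip :: "real \<Rightarrow> (real \<Rightarrow> real \<Rightarrow> real) \<Rightarrow> bool" where
  "bounded_on_strip T f \<longleftrightarrow> bounded ((\<lambda>(x, t). f x t) ` (UNIV \<times> {0..T}))"

text \<open>A supremum of reals, hence meaningful only together with \<open>bounded_on_strip T f\<close>.\<close>

definition sup_norm :: "real \<Rightarrow> (real \<Rightarrow> real \<Rightarrow> real) \<Rightarrow> real" where
  "sup_norm T f = (SUP (x, t)\<in>UNIV \<times> {0..T}. \<bar>f x t\<bar>)"

end

theory Submission
  imports Defs
begin

text \<open>
  Write \<open>X\<close> for the log-price, \<open>h\<close> for the payoff as a function of the log-price, and call \<open>v\<close> a
  mild solution with source \<open>f\<close> if
  \<open>v(x,t) = E [e\<^bsup>-r(T-t)\<^esup> h(X\<^sub>T) + \<integral>\<^sub>t\<^sup>T e\<^bsup>-r(s-t)\<^esup> f(X\<^sub>s,s) ds]\<close> with \<open>X\<^sub>t = x\<close>. Everything is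
  reduced to mild solutions, so that no regularity of the iterates beyond continuity is needed.
  
  The central tool is the lemma \<open>killed_representation\<close>: for a mild solution and any bounded
  continuous intensity \<open>k \<ge> 0\<close> with \<open>p\<^sub>s = exp (- \<integral>\<^sub>t\<^sup>s k(X\<^sub>q,q) dq)\<close>,
  \<open>v(x,t) = E [e\<^bsup>-r(T-t)\<^esup> p\<^sub>T h(X\<^sub>T) + \<integral>\<^sub>t\<^sup>T e\<^bsup>-r(s-t)\<^esup> p\<^sub>s (f + k v)(X\<^sub>s,s) ds]\<close>.
  It follows from \<open>p\<^sub>T = 1 - \<integral> k p ds\<close>, Fubini, and the independence of a single Brownian increment
  of the past. Two mild solutions can therefore be compared along a common intensity
  (\<open>killed_comparison\<close>).
  
  Both objects of the theorem are mild solutions. Given a strategy \<open>k\<close> with running reward \<open>c\<close>, a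
  contraction argument produces a bounded continuous mild solution with source \<open>c - k v\<close>; by the
  killed representation it equals the expected reward, that is, the value function
  (\<open>value_function_mild\<close>). Here the definition of a value function is only informative because
  geometric Brownian motion does satisfy the stochastic differential equation
  (\<open>stock_price_stock\<close>), which is checked by splitting the error of the left-endpoint sums into a
  martingale, small in \<open>L\<^sup>2\<close>, and a drift, small in \<open>L\<^sup>1\<close>. For the optimal value, a bounded classical
  solution is tested against the Gaussian density of the log-price times a cutoff
  (\<open>optimal_value_mild\<close>).
  
  With \<open>k\<^sub>n = exp (-(u\<^sup>n - h)/\<lambda>)\<close>, the strategy computed from \<open>u\<^sup>n\<close>, comparison gives three facts for
  \<open>n \<ge> 1\<close>: policy improvement \<open>u\<^sup>n \<le> u\<^bsup>n+1\<^esup>\<close>; \<open>u\<^sup>n \<le> u\<^sup>\<lambda>\<close>; and, since the linearisation error of the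
  Hamiltonian is \<open>\<lambda> k\<^sub>n (e\<^bsup>-z\<^esup> - 1 + z)\<close> with \<open>z = (u\<^sup>\<lambda> - u\<^sup>n)/\<lambda> \<ge> 0\<close> and lies between \<open>0\<close> and
  \<open>k\<^sub>n (u\<^sup>\<lambda> - u\<^sup>n)\<close>,
  \<open>0 \<le> u\<^sup>\<lambda> - u\<^bsup>n+1\<^esup> \<le> \<integral>\<^sub>t\<^sup>T sup\<^sub>x (k\<^sub>n (u\<^sup>\<lambda> - u\<^sup>n)) ds\<close>. Let \<open>M = sup (h - u\<^sup>1)\<^sup>+\<close>. By policy improvement
  \<open>k\<^sub>n \<le> e\<^bsup>M/\<lambda>\<^esup>\<close>, and iterating from \<open>u\<^sup>\<lambda> - u\<^sup>1 \<le> M + K + \<lambda>T\<close> bounds \<open>u\<^sup>\<lambda> - u\<^bsup>n+1\<^esup>\<close> by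
  \<open>(e\<^bsup>M/\<lambda>\<^esup> T)\<^sup>n / n! (M + K + \<lambda>T)\<close>. Thus \<open>C = 1\<close> works.
\<close>

section \<open>Integrals over time and over the probability space\<close>

text \<open>
  A process with measurable marginals and continuous paths is jointly measurable: it is the
  pointwise limit of its values at the grid points \<open>i/(n+1)\<close> to the left.
\<close>

lemma borel_measurable_pair_continuous_paths:
  fixes V :: "real \<Rightarrow> 'b \<Rightarrow> real"
  assumes meas: "\<And>q. V q \<in> borel_measurable N"
    and cont: "\<And>\<omega>. \<omega> \<in> space N \<Longrightarrow> continuous_on UNIV (\<lambda>q. V q \<omega>)"
  shows "(\<lambda>(q, \<omega>). V q \<omega>) \<in> borel_measurable (borel \<Otimes>\<^sub>M N)"
proof -
  define u where "u n z = V (of_int \<lfloor>fst z * real (Suc n)\<rfloor> / real (Suc n)) (snd z)"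
    for n :: nat and z :: "real \<times> 'b"
  have "u n \<in> borel_measurable (borel \<Otimes>\<^sub>M N)" for n
    unfolding u_def
  proof (rule measurable_compose_countable
      [where f="\<lambda>(i::int) z. V (of_int i / real (Suc n)) (snd z)"])
    fix i :: int
    show "(\<lambda>z. V (of_int i / real (Suc n)) (snd z)) \<in> borel_measurable (borel \<Otimes>\<^sub>M N)"
      using meas by measurable
  next
    show "(\<lambda>z. \<lfloor>fst z * real (Suc n)\<rfloor>) \<in> borel \<Otimes>\<^sub>M N \<rightarrow>\<^sub>M count_space UNIV"
      by measurable
  qed
  moreover have "(\<lambda>n. u n z) \<longlonglongrightarrow> (case z of (q, \<omega>) \<Rightarrow> V q \<omega>)"
    if "z \<in> space (borel \<Otimes>\<^sub>M N)" for z
  proof -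
  from that obtain q \<omega> where z: "z = (q, \<omega>)" "\<omega> \<in> space N" by (auto simp: space_pair_measure)
  have "(\<lambda>n. of_int \<lfloor>q * real (Suc n)\<rfloor> / real (Suc n)) \<longlonglongrightarrow> q"
  proof (rule LIMSEQ_I)
    fix e :: real assume "0 < e"
    then obtain n0 where n0: "inverse (real (Suc n0)) < e" using reals_Archimedean by blast
    show "\<exists>no. \<forall>n\<ge>no. norm (of_int \<lfloor>q * real (Suc n)\<rfloor> / real (Suc n) - q) < e"
    proof (intro exI allI impI)
      fix n assume "n0 \<le> n"
      have "\<bar>of_int \<lfloor>q * real (Suc n)\<rfloor> - q * real (Suc n)\<bar> \<le> 1" by linarith
      then have "\<bar>of_int \<lfloor>q * real (Suc n)\<rfloor> - q * real (Suc n)\<bar> / real (Suc n) \<le> 1 / real (Suc n)"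
        by (intro divide_right_mono) auto
      moreover have "of_int \<lfloor>q * real (Suc n)\<rfloor> / real (Suc n) - q
          = (of_int \<lfloor>q * real (Suc n)\<rfloor> - q * real (Suc n)) / real (Suc n)"
        by (simp add: field_simps)
      moreover have "1 / real (Suc n) \<le> 1 / real (Suc n0)" using \<open>n0 \<le> n\<close> by (simp add: field_simps)
      ultimately show "norm (of_int \<lfloor>q * real (Suc n)\<rfloor> / real (Suc n) - q) < e"
        using n0 by (simp add: abs_divide inverse_eq_divide)
    qed
  qed
  then show ?thesis
    unfolding u_def using continuous_on_tendsto_compose[OF cont[OF z(2)]] z(1) by auto
  qed
  ultimately show ?thesis by (rule borel_measurable_LIMSEQ_real[rotated])
qed

lemma borel_measurable_set_integral_time:
  fixes f :: "real \<Rightarrow> 'b \<Rightarrow> real"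
  assumes [measurable]: "(\<lambda>(s, \<omega>). f s \<omega>) \<in> borel_measurable (borel \<Otimes>\<^sub>M N)"
  shows "(\<lambda>\<omega>. LBINT s:{a..b}. f s \<omega>) \<in> borel_measurable N"
proof -
  have "(\<lambda>(s, \<omega>). f s \<omega>) \<in> borel_measurable (lborel \<Otimes>\<^sub>M N)"
    using assms by (simp cong: measurable_cong_sets sets_pair_measure_cong)
  then have [measurable]: "(\<lambda>(\<omega>, s). f s \<omega>) \<in> borel_measurable (N \<Otimes>\<^sub>M lborel)"
    using measurable_pair_swap by (force simp: case_prod_beta')
  show ?thesis unfolding set_lebesgue_integral_def by measurable
qed

lemma set_integral_bounded_time:
  fixes f :: "real \<Rightarrow> real"
  assumes [measurable]: "f \<in> borel_measurable borel"
    and bnd: "\<And>s. s \<in> {a..b} \<Longrightarrow> \<bar>f s\<bar> \<le> B" and "a \<le> b" and B: "0 \<le> B"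
  shows "set_integrable lborel {a..b} f" and "\<bar>LBINT s:{a..b}. f s\<bar> \<le> B * (b - a)"
proof -
  have c: "set_integrable lborel {a..b} (\<lambda>_. B)" by (auto simp: set_integrable_def emeasure_lborel_Icc_eq intro!: disjI2 integrable_real_indicator)
  show i: "set_integrable lborel {a..b} f"
    using c by (rule set_integrable_bound) (use bnd B in \<open>auto simp: set_borel_measurable_def\<close>)
  have "\<bar>LBINT s:{a..b}. f s\<bar> \<le> (LBINT s:{a..b}. \<bar>f s\<bar>)"
    using set_integral_norm_bound[OF i] by simp
  also have "\<dots> \<le> (LBINT s:{a..b}. B)"
    by (rule set_integral_mono) (use bnd i c in \<open>auto intro: set_integrable_abs\<close>)
  also have "\<dots> = B * (b - a)" using \<open>a \<le> b\<close> by (simp add: set_lebesgue_integral_def)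
  finally show "\<bar>LBINT s:{a..b}. f s\<bar> \<le> B * (b - a)" .
qed

context prob_space begin

lemma integrable_bounded:
  fixes f :: "'a \<Rightarrow> real"
  assumes "f \<in> borel_measurable M" "\<And>\<omega>. \<omega> \<in> space M \<Longrightarrow> \<bar>f \<omega>\<bar> \<le> B"
  shows "integrable M f"
  by (rule integrable_const_bound[of _ B]) (use assms in auto)

lemma abs_expectation_le:
  fixes f :: "'a \<Rightarrow> real"
  assumes f: "f \<in> borel_measurable M" and b: "\<And>\<omega>. \<omega> \<in> space M \<Longrightarrow> \<bar>f \<omega>\<bar> \<le> B"
  shows "\<bar>expectation f\<bar> \<le> B"
proof -
  note i = integrable_bounded[OF f b]
  have "\<bar>expectation f\<bar> \<le> expectation (\<lambda>\<omega>. \<bar>f \<omega>\<bar>)"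
    using integral_norm_bound[of M f] by simp
  also have "\<dots> \<le> expectation (\<lambda>_. B)" using i b by (intro integral_mono) auto
  finally show ?thesis by (simp add: prob_space)
qed

text \<open>
  Fubini for a process that is bounded in \<open>L\<^sup>1\<close> uniformly in time, with the resulting \<open>L\<^sup>1\<close> bound.
\<close>

lemma expectation_set_integral_swap_L1:
  fixes f :: "real \<Rightarrow> 'a \<Rightarrow> real"
  assumes m[measurable]: "(\<lambda>(s, \<omega>). f s \<omega>) \<in> borel_measurable (borel \<Otimes>\<^sub>M M)"
    and i: "\<And>s. s \<in> {a..b} \<Longrightarrow> integrable M (f s)"
    and bnd: "\<And>s. s \<in> {a..b} \<Longrightarrow> expectation (\<lambda>\<omega>. \<bar>f s \<omega>\<bar>) \<le> B" and ab: "a \<le> b"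
  shows "integrable M (\<lambda>\<omega>. LBINT s:{a..b}. f s \<omega>)"
    "expectation (\<lambda>\<omega>. LBINT s:{a..b}. f s \<omega>) = (LBINT s:{a..b}. expectation (f s))"
    "expectation (\<lambda>\<omega>. \<bar>LBINT s:{a..b}. f s \<omega>\<bar>) \<le> B * (b - a)"
proof -
  interpret P: pair_sigma_finite lborel M ..
  have [measurable]: "(\<lambda>z. f (fst z) (snd z)) \<in> borel_measurable (borel \<Otimes>\<^sub>M M)"
    using m by (simp add: case_prod_beta')
  have ml: "(\<lambda>z. f (fst z) (snd z)) \<in> borel_measurable (lborel \<Otimes>\<^sub>M M)"
    using m by (simp add: case_prod_beta' cong: measurable_cong_sets sets_pair_measure_cong)
  note [measurable] = ml
  let ?g = "\<lambda>z. indicator {a..b} (fst z) * f (fst z) (snd z)"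
  have "0 \<le> expectation (\<lambda>\<omega>. \<bar>f a \<omega>\<bar>)" by simp
  also have "\<dots> \<le> B" using ab by (intro bnd) simp
  finally have B: "0 \<le> B" .
  have Em: "(\<lambda>s. expectation (\<lambda>\<omega>. \<bar>f s \<omega>\<bar>)) \<in> borel_measurable borel"
    by (rule borel_measurable_lebesgue_integral) (simp add: case_prod_beta')
  have Eb: "\<bar>expectation (\<lambda>\<omega>. \<bar>f s \<omega>\<bar>)\<bar> \<le> B" if "s \<in> {a..b}" for s
    using bnd[OF that] by simp
  note Ei = set_integral_bounded_time[OF Em Eb ab B]
  have g: "integrable (lborel \<Otimes>\<^sub>M M) ?g"
  proof (rule P.Fubini_integrable)
    show "?g \<in> borel_measurable (lborel \<Otimes>\<^sub>M M)" by measurable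
    have "(\<lambda>s. \<integral>\<omega>. norm (?g (s, \<omega>)) \<partial>M) = (\<lambda>s. indicator {a..b} s *\<^sub>R expectation (\<lambda>\<omega>. \<bar>f s \<omega>\<bar>))"
      by (auto simp: indicator_def)
    then show "integrable lborel (\<lambda>s. \<integral>\<omega>. norm (?g (s, \<omega>)) \<partial>M)"
      using Ei(1) by (simp add: set_integrable_def)
    show "AE s in lborel. integrable M (\<lambda>\<omega>. ?g (s, \<omega>))"
      using i by (intro AE_I2) (auto simp: indicator_def)
  qed
  have g': "integrable (lborel \<Otimes>\<^sub>M M) (\<lambda>(s, \<omega>). indicator {a..b} s * f s \<omega>)"
    using g by (simp add: case_prod_beta')
  show ii: "integrable M (\<lambda>\<omega>. LBINT s:{a..b}. f s \<omega>)"
    using P.integrable_snd[OF g'] by (simp add: set_lebesgue_integral_def)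
  show "expectation (\<lambda>\<omega>. LBINT s:{a..b}. f s \<omega>) = (LBINT s:{a..b}. expectation (f s))"
    using P.Fubini_integral[OF g'] by (simp add: set_lebesgue_integral_def)
  have ga: "integrable (lborel \<Otimes>\<^sub>M M) (\<lambda>(s, \<omega>). indicator {a..b} s * \<bar>f s \<omega>\<bar>)"
    using integrable_abs[OF g'] by (simp add: case_prod_beta' abs_mult)
  have "expectation (\<lambda>\<omega>. \<bar>LBINT s:{a..b}. f s \<omega>\<bar>) \<le> expectation (\<lambda>\<omega>. LBINT s:{a..b}. \<bar>f s \<omega>\<bar>)"
  proof (rule integral_mono)
    show "integrable M (\<lambda>\<omega>. \<bar>LBINT s:{a..b}. f s \<omega>\<bar>)" using ii by simp
    show "integrable M (\<lambda>\<omega>. LBINT s:{a..b}. \<bar>f s \<omega>\<bar>)"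
      using P.integrable_snd[OF ga] by (simp add: set_lebesgue_integral_def)
    show "\<bar>LBINT s:{a..b}. f s \<omega>\<bar> \<le> (LBINT s:{a..b}. \<bar>f s \<omega>\<bar>)" for \<omega>
      unfolding set_lebesgue_integral_def
      using integral_norm_bound[of lborel "\<lambda>s. indicator {a..b} s *\<^sub>R f s \<omega>"] by (simp add: abs_mult)
  qed
  also have "\<dots> = (LBINT s:{a..b}. expectation (\<lambda>\<omega>. \<bar>f s \<omega>\<bar>))"
    using P.Fubini_integral[OF ga] by (simp add: set_lebesgue_integral_def)
  also have "\<dots> \<le> B * (b - a)" using Ei(2) by linarith
  finally show "expectation (\<lambda>\<omega>. \<bar>LBINT s:{a..b}. f s \<omega>\<bar>) \<le> B * (b - a)" .
qed

lemma expectation_set_integral_swap: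
  fixes f :: "real \<Rightarrow> 'a \<Rightarrow> real"
  assumes m: "(\<lambda>(s, \<omega>). f s \<omega>) \<in> borel_measurable (borel \<Otimes>\<^sub>M M)" and ab: "a \<le> b"
    and bnd: "\<And>s \<omega>. s \<in> {a..b} \<Longrightarrow> \<omega> \<in> space M \<Longrightarrow> \<bar>f s \<omega>\<bar> \<le> B"
  shows "integrable M (\<lambda>\<omega>. LBINT s:{a..b}. f s \<omega>)"
    "expectation (\<lambda>\<omega>. LBINT s:{a..b}. f s \<omega>) = (LBINT s:{a..b}. expectation (f s))"
proof -
  have fm: "f s \<in> borel_measurable M" for s
    using measurable_compose[of "\<lambda>\<omega>. (s, \<omega>)" M, OF _ m] by simp
  have i: "integrable M (f s)" and e: "expectation (\<lambda>\<omega>. \<bar>f s \<omega>\<bar>) \<le> B" if "s \<in> {a..b}" for s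
    using integrable_bounded[OF fm bnd[OF that]] abs_expectation_le[OF borel_measurable_abs[OF fm], of s B]
      bnd[OF that] by auto
  show "integrable M (\<lambda>\<omega>. LBINT s:{a..b}. f s \<omega>)"
    by (rule expectation_set_integral_swap_L1(1)[OF m i e ab])
  show "expectation (\<lambda>\<omega>. LBINT s:{a..b}. f s \<omega>) = (LBINT s:{a..b}. expectation (f s))"
    by (rule expectation_set_integral_swap_L1(2)[OF m i e ab])
qed

end

section \<open>The log-price and its one-step Markov property\<close>

text \<open>
  A Brownian motion together with the interest rate, the volatility and the horizon.
\<close>

locale gbm = brownian_motion M F W
  for M :: "'a measure" and F :: "real \<Rightarrow> 'a measure" and W :: "real \<Rightarrow> 'a \<Rightarrow> real" +
  fixes r \<sigma> T :: real
  assumes r_pos: "0 < r" and sig_pos: "0 < \<sigma>" and T_pos: "0 < T"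
begin

text \<open>
  The log-price at time \<open>s\<close> when it equals \<open>x\<close> at time \<open>t\<close>. Times are clamped at \<open>0\<close>, since
  \<open>W\<close> is unspecified at negative times; the paths are then continuous on the whole line.
\<close>

definition X :: "real \<Rightarrow> real \<Rightarrow> real \<Rightarrow> 'a \<Rightarrow> real" where
  "X x t s \<omega> = x + (r - \<sigma>\<^sup>2 / 2) * (s - t) + \<sigma> * (W (max 0 s) \<omega> - W (max 0 t) \<omega>)"

lemma X_start [simp]: "X x t t \<omega> = x"
  by (simp add: X_def)

lemma X_flow: "X x t q \<omega> = X (X x t s \<omega>) s q \<omega>"
  by (simp add: X_def field_simps)

lemma space_F_eq [simp]: "space (F t) = space M"
  by (rule space_F)

lemma measurable_F_mono:
  assumes "f \<in> measurable (F s) N" "s \<le> q" shows "f \<in> measurable (F q) N"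
  using assms sets_F_mono[of s q] by (auto simp: measurable_def)

lemma measurable_F_M:
  assumes "f \<in> measurable (F s) N" shows "f \<in> measurable M N"
  using assms sets_F_le[of s] by (auto simp: measurable_def)

lemma continuous_W_clamped:
  assumes "\<omega> \<in> space M" shows "continuous_on UNIV (\<lambda>q. W (max 0 q) \<omega>)"
  by (rule continuous_on_compose2[OF continuous_paths[OF assms]]) (auto intro!: continuous_intros)

lemma continuous_X:
  assumes "\<omega> \<in> space M" "continuous_on A a" "continuous_on A b" "continuous_on A c"
  shows "continuous_on A (\<lambda>z. X (a z) (b z) (c z) \<omega>)"
proof -
  have "continuous_on A (\<lambda>z. W (max 0 (b z)) \<omega>)" "continuous_on A (\<lambda>z. W (max 0 (c z)) \<omega>)"
    using continuous_on_compose2[OF continuous_W_clamped[OF assms(1)]] assms by auto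
  then show ?thesis unfolding X_def by (intro continuous_intros assms)
qed

lemma W_measurable_M: "0 \<le> t \<Longrightarrow> W t \<in> borel_measurable M"
  using adapted measurable_F_M by blast

lemma W_pair_measurable: "(\<lambda>(q, \<omega>). W (max 0 q) \<omega>) \<in> borel_measurable (borel \<Otimes>\<^sub>M M)"
  by (rule borel_measurable_pair_continuous_paths) (auto intro: W_measurable_M continuous_W_clamped)

lemma W_pair_measurable_F:
  assumes "0 \<le> s"
  shows "(\<lambda>(q, \<omega>). W (max 0 (min s q)) \<omega>) \<in> borel_measurable (borel \<Otimes>\<^sub>M F s)"
proof (rule borel_measurable_pair_continuous_paths)
  fix q show "W (max 0 (min s q)) \<in> borel_measurable (F s)"
    by (rule measurable_F_mono[OF adapted]) (use assms in auto)
next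
  fix \<omega> assume "\<omega> \<in> space (F s)"
  then have "\<omega> \<in> space M" by simp
  then show "continuous_on UNIV (\<lambda>q. W (max 0 (min s q)) \<omega>)"
    by (rule continuous_on_compose2[OF continuous_paths]) (auto intro!: continuous_intros)
qed

lemma X_measurable [measurable (raw)]:
  assumes [measurable]: "a \<in> borel_measurable N" "b \<in> borel_measurable N" "c \<in> borel_measurable N"
    and [measurable]: "d \<in> measurable N M"
  shows "(\<lambda>z. X (a z) (b z) (c z) (d z)) \<in> borel_measurable N"
proof -
  have "(\<lambda>z. W (max 0 (c z)) (d z)) \<in> borel_measurable N"
    using measurable_compose[of "\<lambda>z. (c z, d z)" N, OF _ W_pair_measurable] by simp
  moreover have "(\<lambda>z. W (max 0 (b z)) (d z)) \<in> borel_measurable N"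
    using measurable_compose[of "\<lambda>z. (b z, d z)" N, OF _ W_pair_measurable] by simp
  ultimately show ?thesis unfolding X_def by measurable
qed

lemma X_pair_measurable_F:
  assumes "0 \<le> t" "t \<le> s"
  shows "(\<lambda>(q, \<omega>). X x t (min s q) \<omega>) \<in> borel_measurable (borel \<Otimes>\<^sub>M F s)"
proof -
  have "W t \<in> borel_measurable (F s)" using measurable_F_mono[OF adapted] assms by blast
  then have [measurable]: "W (max 0 t) \<in> borel_measurable (F s)" using assms by simp
  have "(\<lambda>(q, \<omega>). W (max 0 (min s q)) \<omega>) \<in> borel_measurable (borel \<Otimes>\<^sub>M F s)"
    by (rule W_pair_measurable_F) (use assms in auto)
  then have [measurable]: "(\<lambda>z. W (max 0 (min s (fst z))) (snd z)) \<in> borel_measurable (borel \<Otimes>\<^sub>M F s)"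
    by (simp add: case_prod_beta')
  show ?thesis unfolding X_def case_prod_beta' by measurable
qed

lemma X_adapted:
  assumes "0 \<le> t" "t \<le> s" shows "X x t s \<in> borel_measurable (F s)"
proof -
  have "(\<lambda>\<omega>. X x t (min s s) \<omega>) \<in> borel_measurable (F s)"
    using measurable_compose[of "\<lambda>\<omega>. (s, \<omega>)" "F s", OF _ X_pair_measurable_F[OF assms]] by simp
  then show ?thesis by simp
qed

text \<open>
  An increment is independent of the past, as a product law. The variable \<open>Z\<close> may take values in
  any measurable space.
\<close>

lemma increment_indep:
  assumes "0 \<le> s" "s < q" and Z: "Z \<in> measurable (F s) N"
  shows "distr M N Z \<Otimes>\<^sub>M distr M borel (\<lambda>\<omega>. W q \<omega> - W s \<omega>)
    = distr M (N \<Otimes>\<^sub>M borel) (\<lambda>\<omega>. (Z \<omega>, W q \<omega> - W s \<omega>))"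
proof -
  let ?D = "\<lambda>\<omega>. W q \<omega> - W s \<omega>"
  have [measurable]: "W q \<in> borel_measurable M" "W s \<in> borel_measurable M"
    using W_measurable_M assms by auto
  have ZM[measurable]: "Z \<in> measurable M N" using Z by (rule measurable_F_M)
  interpret P1: prob_space "distr M N Z" by (rule prob_space_distr) simp
  interpret P2: prob_space "distr M borel ?D" by (rule prob_space_distr) simp
  show ?thesis
  proof (rule pair_measure_eqI)
    fix A B assume "A \<in> sets (distr M N Z)" "B \<in> sets (distr M borel ?D)"
    then have AB[measurable]: "A \<in> sets N" "B \<in> sets borel" by auto
    have "Z -` A \<inter> space M \<in> sets (F s)" using measurable_sets[OF Z AB(1)] by simp
    moreover have "?D -` B \<inter> space M \<in> sets (vimage_algebra (space M) ?D borel)"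
      using AB(2) by (rule in_vimage_algebra)
    ultimately have "prob ((Z -` A \<inter> space M) \<inter> (?D -` B \<inter> space M))
        = prob (Z -` A \<inter> space M) * prob (?D -` B \<inter> space M)"
      using indep_setD[OF indep_increments[OF assms(1,2)]] by blast
    moreover have "(Z -` A \<inter> space M) \<inter> (?D -` B \<inter> space M)
        = (\<lambda>\<omega>. (Z \<omega>, ?D \<omega>)) -` (A \<times> B) \<inter> space M" by auto
    ultimately show "emeasure (distr M N Z) A * emeasure (distr M borel ?D) B
        = emeasure (distr M (N \<Otimes>\<^sub>M borel) (\<lambda>\<omega>. (Z \<omega>, ?D \<omega>))) (A \<times> B)"
      by (simp add: emeasure_distr emeasure_eq_measure ennreal_mult)
  qed (auto intro: P1.sigma_finite_measure_axioms P2.sigma_finite_measure_axioms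
      cong: sets_pair_measure_cong)
qed

text \<open>
  Conditioning a function of \<open>X\<^sub>q\<close> on the past at \<open>s\<close>. This is the only form in which the Markov
  property is used; joint laws of several increments are never needed.
\<close>

lemma markov_one_step:
  fixes f :: "real \<Rightarrow> real" and Z :: "'a \<Rightarrow> real"
  assumes ts: "0 \<le> t" "t \<le> s" "s \<le> q"
    and Z: "Z \<in> borel_measurable (F s)" "\<And>\<omega>. \<omega> \<in> space M \<Longrightarrow> \<bar>Z \<omega>\<bar> \<le> B"
    and f[measurable]: "f \<in> borel_measurable borel" and fb: "\<And>y. \<bar>f y\<bar> \<le> C"
  shows "expectation (\<lambda>\<omega>. Z \<omega> * f (X x t q \<omega>))
    = expectation (\<lambda>\<omega>. Z \<omega> * expectation (\<lambda>\<omega>'. f (X (X x t s \<omega>) s q \<omega>')))"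
proof (cases "s = q")
  case True
  then have "expectation (\<lambda>\<omega>'. f (X (X x t s \<omega>) s q \<omega>')) = f (X x t q \<omega>)" for \<omega>
    using prob_space by (simp add: lebesgue_integral_const)
  then show ?thesis by simp
next
  case False
  with ts have sq: "s < q" "0 \<le> s" by auto
  let ?D = "\<lambda>\<omega>. W q \<omega> - W s \<omega>" and ?b = "(r - \<sigma>\<^sup>2 / 2) * (q - s)"
  let ?V = "\<lambda>\<omega>. (Z \<omega>, X x t s \<omega>)"
  have Wm[measurable]: "W q \<in> borel_measurable M" "W s \<in> borel_measurable M"
    using W_measurable_M sq by auto
  have [measurable]: "Z \<in> borel_measurable M" using Z(1) by (rule measurable_F_M)
  have VF: "?V \<in> measurable (F s) (borel \<Otimes>\<^sub>M borel)"
    using Z(1) X_adapted[OF ts(1,2)] by measurable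
  have VM[measurable]: "?V \<in> measurable M (borel \<Otimes>\<^sub>M borel)" using VF by (rule measurable_F_M)
  let ?P1 = "distr M (borel \<Otimes>\<^sub>M borel) ?V" and ?P2 = "distr M borel ?D"
  interpret P1: prob_space ?P1 by (rule prob_space_distr) simp
  interpret P2: prob_space ?P2 by (rule prob_space_distr) simp
  interpret P: pair_prob_space ?P1 ?P2 ..
  have eq: "?P1 \<Otimes>\<^sub>M ?P2 = distr M ((borel \<Otimes>\<^sub>M borel) \<Otimes>\<^sub>M borel) (\<lambda>\<omega>. (?V \<omega>, ?D \<omega>))"
    by (rule increment_indep[OF sq(2,1) VF])
  \<comment> \<open>Truncating \<open>Z\<close> at its bound makes the integrand bounded everywhere.\<close>
  define c where "c z = max (- B) (min B z)" for z :: real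
  have [measurable]: "c \<in> borel_measurable borel" unfolding c_def by measurable
  have B: "0 \<le> B" using Z(2) not_empty by fastforce
  have C: "0 \<le> C" using fb[of 0] by simp
  have cZ: "c (Z \<omega>) = Z \<omega>" if "\<omega> \<in> space M" for \<omega> using Z(2)[OF that] by (auto simp: c_def)
  let ?\<Phi> = "\<lambda>(v, d). c (fst v) * f (snd v + ?b + \<sigma> * d)"
  have [measurable]: "?\<Phi> \<in> borel_measurable ((borel \<Otimes>\<^sub>M borel) \<Otimes>\<^sub>M borel)" by measurable
  have b\<Phi>: "\<bar>?\<Phi> z\<bar> \<le> B * C" for z
    using fb B C by (cases z) (auto simp: abs_mult c_def intro!: mult_mono)
  have "expectation (\<lambda>\<omega>. Z \<omega> * f (X x t q \<omega>)) = expectation (\<lambda>\<omega>. ?\<Phi> (?V \<omega>, ?D \<omega>))"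
    by (rule Bochner_Integration.integral_cong) (use sq in \<open>auto simp: cZ X_flow[of x t q _ s] X_def[of _ s q]\<close>)
  also have "\<dots> = (\<integral>z. ?\<Phi> z \<partial>(?P1 \<Otimes>\<^sub>M ?P2))"
    unfolding eq by (subst integral_distr) auto
  also have "\<dots> = (\<integral>v. (\<integral>d. ?\<Phi> (v, d) \<partial>?P2) \<partial>?P1)"
  proof (rule P.integral_fst'[symmetric])
    show "integrable (?P1 \<Otimes>\<^sub>M ?P2) ?\<Phi>"
    proof (rule P.integrable_bounded)
      show "?\<Phi> \<in> borel_measurable (?P1 \<Otimes>\<^sub>M ?P2)" by measurable
    qed (rule b\<Phi>)
  qed
  also have "\<dots> = expectation (\<lambda>\<omega>. \<integral>d. ?\<Phi> (?V \<omega>, d) \<partial>?P2)"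
    by (subst integral_distr) (auto intro!: P2.borel_measurable_lebesgue_integral)
  also have "\<dots> = expectation (\<lambda>\<omega>. expectation (\<lambda>\<omega>'. ?\<Phi> (?V \<omega>, ?D \<omega>')))"
    by (subst integral_distr) auto
  also have "\<dots> = expectation (\<lambda>\<omega>. Z \<omega> * expectation (\<lambda>\<omega>'. f (X (X x t s \<omega>) s q \<omega>')))"
  proof (rule Bochner_Integration.integral_cong[OF refl])
    fix \<omega> assume "\<omega> \<in> space M"
    have "expectation (\<lambda>\<omega>'. ?\<Phi> (?V \<omega>, ?D \<omega>')) = expectation (\<lambda>\<omega>'. Z \<omega> * f (X (X x t s \<omega>) s q \<omega>'))"
      by (rule Bochner_Integration.integral_cong)
        (use sq \<open>\<omega> \<in> space M\<close> in \<open>auto simp: cZ X_def[of _ s q]\<close>)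
    then show "expectation (\<lambda>\<omega>'. ?\<Phi> (?V \<omega>, ?D \<omega>'))
        = Z \<omega> * expectation (\<lambda>\<omega>'. f (X (X x t s \<omega>) s q \<omega>'))"
      by simp
  qed
  finally show ?thesis .
qed

end

section \<open>Bounded continuous functions of log-price and time\<close>

text \<open>
  Bounded continuous functions on all of \<open>\<real> \<times> \<real>\<close>. Functions given only for \<open>t \<in> [0,T]\<close> are extended
  constantly in time, see \<open>clamp\<close> below.
\<close>

definition cbf :: "(real \<Rightarrow> real \<Rightarrow> real) \<Rightarrow> bool" where
  "cbf f \<longleftrightarrow> continuous_on UNIV (\<lambda>z. f (fst z) (snd z)) \<and> (\<exists>B. \<forall>x t. \<bar>f x t\<bar> \<le> B)"

lemma cbf_obtain_bound:
  assumes "cbf f" obtains B where "0 < B" "\<And>x t. \<bar>f x t\<bar> \<le> B"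
proof -
  from assms obtain B where B: "\<And>x t. \<bar>f x t\<bar> \<le> B" by (auto simp: cbf_def)
  have "\<bar>f x t\<bar> \<le> max B 1" for x t using B[of x t] by linarith
  then show thesis using that[of "max B 1"] by auto
qed

lemma cbf_continuous:
  assumes "cbf f" "continuous_on A a" "continuous_on A b"
  shows "continuous_on A (\<lambda>z. f (a z) (b z))"
proof -
  have "continuous_on A (\<lambda>z. (\<lambda>p. f (fst p) (snd p)) (a z, b z))"
    by (rule continuous_on_compose2[of UNIV])
      (use assms in \<open>auto simp: cbf_def intro!: continuous_intros\<close>)
  then show ?thesis by simp
qed

lemma cbf_measurable:
  assumes "cbf f" and [measurable]: "a \<in> borel_measurable N" "b \<in> borel_measurable N"
  shows "(\<lambda>z. f (a z) (b z)) \<in> borel_measurable N"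
proof -
  have "(\<lambda>p. f (fst p) (snd p)) \<in> borel_measurable borel"
    using assms by (auto simp: cbf_def intro: borel_measurable_continuous_onI)
  then have [measurable]: "(\<lambda>p. f (fst p) (snd p)) \<in> borel_measurable (borel \<Otimes>\<^sub>M borel)"
    by (simp add: borel_prod)
  have "(\<lambda>z. (\<lambda>p. f (fst p) (snd p)) (a z, b z)) \<in> borel_measurable N" by measurable
  then show ?thesis by simp
qed

lemma cbf_add: "cbf f \<Longrightarrow> cbf g \<Longrightarrow> cbf (\<lambda>x t. f x t + g x t)"
proof -
  assume a: "cbf f" "cbf g"
  from a obtain B C where "\<And>x t. \<bar>f x t\<bar> \<le> B" "\<And>x t. \<bar>g x t\<bar> \<le> C" by (meson cbf_obtain_bound)
  then have "\<And>x t. \<bar>f x t + g x t\<bar> \<le> B + C" by (meson abs_triangle_ineq add_mono order_trans)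
  then show ?thesis using a by (auto simp: cbf_def intro!: continuous_intros)
qed

lemma cbf_mult: "cbf f \<Longrightarrow> cbf g \<Longrightarrow> cbf (\<lambda>x t. f x t * g x t)"
proof -
  assume a: "cbf f" "cbf g"
  from a obtain B C where "\<And>x t. \<bar>f x t\<bar> \<le> B" "\<And>x t. \<bar>g x t\<bar> \<le> C" by (meson cbf_obtain_bound)
  then have "\<And>x t. \<bar>f x t * g x t\<bar> \<le> B * C"
    unfolding abs_mult by (meson abs_ge_zero mult_mono order_trans)
  then show ?thesis using a by (auto simp: cbf_def intro!: continuous_intros)
qed

lemma cbf_minus: "cbf f \<Longrightarrow> cbf (\<lambda>x t. - f x t)"
  by (auto simp: cbf_def intro!: continuous_intros)

lemma cbf_diff: "cbf f \<Longrightarrow> cbf g \<Longrightarrow> cbf (\<lambda>x t. f x t - g x t)"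
  using cbf_add[of f "\<lambda>x t. - g x t"] by (simp add: cbf_minus)

lemma cbf_const: "cbf (\<lambda>_ _. c)"
  by (auto simp: cbf_def intro!: exI[of _ "\<bar>c\<bar>"])

lemma cbf_exp: "cbf f \<Longrightarrow> cbf (\<lambda>x t. exp (f x t))"
proof -
  assume a: "cbf f"
  from a obtain B where "\<And>x t. \<bar>f x t\<bar> \<le> B" by (meson cbf_obtain_bound)
  then have "\<bar>exp (f x t)\<bar> \<le> exp B" for x t by (simp add: abs_le_iff)
  then have "\<exists>B. \<forall>x t. \<bar>exp (f x t)\<bar> \<le> B" by blast
  then show ?thesis using a by (auto simp: cbf_def intro!: continuous_intros)
qed

lemmas cbf_intros = cbf_add cbf_mult cbf_minus cbf_diff cbf_const cbf_exp

section \<open>Calculus of time integrals\<close>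

text \<open>
  The indicators of \<open>[t\<^sub>n, b]\<close> converge except at the limit \<open>t'\<close> of the \<open>t\<^sub>n\<close>, which is a null set.
\<close>

lemma tendsto_set_integral_lower_limit:
  fixes g :: "nat \<Rightarrow> real \<Rightarrow> real"
  assumes [measurable]: "\<And>n. g n \<in> borel_measurable borel" "g' \<in> borel_measurable borel"
    and b: "\<And>n s. s \<in> {a..b} \<Longrightarrow> \<bar>g n s\<bar> \<le> B"
    and lim: "\<And>s. s \<in> {a..b} \<Longrightarrow> (\<lambda>n. g n s) \<longlonglongrightarrow> g' s"
    and t: "\<And>n. t n \<in> {a..b}" "t \<longlonglongrightarrow> t'" "t' \<in> {a..b}"
  shows "(\<lambda>n. LBINT s:{t n..b}. g n s) \<longlonglongrightarrow> (LBINT s:{t'..b}. g' s)"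
  unfolding set_lebesgue_integral_def
proof (rule integral_dominated_convergence[where w="\<lambda>s. indicator {a..b} s * B"])
  show "integrable lborel (\<lambda>s. indicator {a..b} s * B)"
    by (auto intro!: integrable_mult_left integrable_real_indicator simp: emeasure_lborel_Icc_eq)
  show "AE s in lborel. (\<lambda>n. indicator {t n..b} s *\<^sub>R g n s) \<longlonglongrightarrow> indicator {t'..b} s *\<^sub>R g' s"
  proof (rule AE_mp[OF AE_lborel_singleton[of t']], rule AE_I2, rule impI)
    fix s assume "s \<noteq> t'"
    consider "s < t'" | "t' < s" "s \<le> b" | "b < s" using \<open>s \<noteq> t'\<close> by linarith
    then show "(\<lambda>n. indicator {t n..b} s *\<^sub>R g n s) \<longlonglongrightarrow> indicator {t'..b} s *\<^sub>R g' s"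
    proof cases
      case 1
      then have "eventually (\<lambda>n. s < t n) sequentially" using order_tendstoD(1)[OF t(2)] by blast
      then have "eventually (\<lambda>n. indicator {t n..b} s *\<^sub>R g n s = 0) sequentially"
        by eventually_elim auto
      then show ?thesis using 1 by (auto intro: tendsto_eventually)
    next
      case 2
      then have "eventually (\<lambda>n. t n < s) sequentially" using order_tendstoD(2)[OF t(2)] by blast
      then have e: "eventually (\<lambda>n. indicator {t n..b} s *\<^sub>R g n s = g n s) sequentially"
        by eventually_elim (use 2 in auto)
      have "(\<lambda>n. g n s) \<longlonglongrightarrow> g' s" using 2 t(3) by (intro lim) auto
      then show ?thesis using tendsto_cong[OF e] 2 t(3) by auto
    next
      case 3 then show ?thesis by simp
    qed
  qed
  show "AE s in lborel. norm (indicator {t n..b} s *\<^sub>R g n s) \<le> indicator {a..b} s * B" for n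
    using b t(1)[of n] abs_ge_zero[THEN order_trans, OF b[OF t(3)]]
    by (auto simp: indicator_def intro!: AE_I2)
qed measurable

lemma set_integral_combine:
  fixes g :: "real \<Rightarrow> real"
  assumes "a \<le> b" "b \<le> c" and g: "continuous_on {a..c} g"
  shows "(LBINT q:{a..c}. g q) = (LBINT q:{a..b}. g q) + (LBINT q:{b..c}. g q)"
proof -
  have "(LBINT q:{a..b} \<union> {b..c}. g q) = (LBINT q:{a..b}. g q) + (LBINT q:{b..c}. g q)"
  proof (rule set_integral_Un_AE)
    show "AE q in lborel. \<not> (q \<in> {a..b} \<and> q \<in> {b..c})"
      by (rule AE_mp[OF AE_lborel_singleton[of b]]) auto
  qed (use assms in \<open>auto intro!: borel_integrable_atLeastAtMost' continuous_on_subset[OF g]\<close>)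
  moreover have "{a..b} \<union> {b..c} = {a..c}" using assms by auto
  ultimately show ?thesis by simp
qed

lemma set_integral_eq_integral_continuous:
  fixes g :: "real \<Rightarrow> real"
  assumes g: "continuous_on {a..b} g"
  shows "(LBINT q:{a..b}. g q) = integral {a..b} g"
  by (rule set_borel_integral_eq_integral(2)[OF borel_integrable_atLeastAtMost'[OF g]])

lemma set_integral_has_real_derivative:
  fixes g :: "real \<Rightarrow> real"
  assumes g: "continuous_on {a..b} g" and s: "s \<in> {a..b}"
  shows "((\<lambda>s. LBINT q:{a..s}. g q) has_real_derivative g s) (at s within {a..b})"
proof (rule has_field_derivative_transform_within[OF integral_has_real_derivative[OF g s] zero_less_one s])
  fix x assume "x \<in> {a..b}"
  then show "integral {a..x} g = (LBINT q:{a..x}. g q)"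
    using set_integral_eq_integral_continuous[OF continuous_on_subset[OF g], of a x] by auto
qed

lemma set_integral_FTC:
  fixes \<phi> \<phi>' :: "real \<Rightarrow> real"
  assumes "a \<le> b" and d: "\<And>s. s \<in> {a..b} \<Longrightarrow> (\<phi> has_real_derivative \<phi>' s) (at s within {a..b})"
    and c: "continuous_on {a..b} \<phi>'"
  shows "(LBINT s:{a..b}. \<phi>' s) = \<phi> b - \<phi> a"
  unfolding set_lebesgue_integral_def
  by (rule integral_FTC_atLeastAtMost[OF \<open>a \<le> b\<close> _ c])
    (use d in \<open>auto simp: has_real_derivative_iff_has_vector_derivative\<close>)

lemma running_integral_measurable:
  fixes f :: "real \<Rightarrow> 'b \<Rightarrow> real"
  assumes m: "(\<lambda>(q, \<omega>). f q \<omega>) \<in> borel_measurable (borel \<Otimes>\<^sub>M N)"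
  shows "(\<lambda>(s, \<omega>). LBINT q:{a..s}. f q \<omega>) \<in> borel_measurable (borel \<Otimes>\<^sub>M N)"
proof -
  have [measurable]: "(\<lambda>z. f (snd z) (snd (fst z))) \<in> borel_measurable ((borel \<Otimes>\<^sub>M N) \<Otimes>\<^sub>M lborel)"
    using measurable_compose[of "\<lambda>z. (snd z, snd (fst z))" "(borel \<Otimes>\<^sub>M N) \<Otimes>\<^sub>M lborel", OF _ m] by simp
  have [measurable]: "Measurable.pred ((borel \<Otimes>\<^sub>M N) \<Otimes>\<^sub>M lborel) (\<lambda>z. a \<le> snd z \<and> snd z \<le> fst (fst z))"
    by measurable
  have "(\<lambda>z. \<integral>q. (if a \<le> q \<and> q \<le> fst z then f q (snd z) else 0) \<partial>lborel)
      \<in> borel_measurable (borel \<Otimes>\<^sub>M N)"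
    by measurable
  moreover have "(\<lambda>(s, \<omega>). LBINT q:{a..s}. f q \<omega>)
      = (\<lambda>z. \<integral>q. (if a \<le> q \<and> q \<le> fst z then f q (snd z) else 0) \<partial>lborel)"
    unfolding set_lebesgue_integral_def
    by (auto intro!: ext Bochner_Integration.integral_cong simp: indicator_def)
  ultimately show ?thesis by simp
qed

section \<open>Mild solutions\<close>

text \<open>
  A bounded continuous terminal payoff, as a function of the log-price.
\<close>

locale gbm_claim = gbm +
  fixes h :: "real \<Rightarrow> real" and H :: real
  assumes h_cont: "continuous_on UNIV h" and h_bound: "\<And>y. \<bar>h y\<bar> \<le> H"
begin

lemma h_measurable [measurable]: "h \<in> borel_measurable borel"
  using h_cont by (rule borel_measurable_continuous_onI)

lemma H_nonneg: "0 \<le> H" using h_bound[of 0] by simp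

lemma discount_le_one: "t \<le> s \<Longrightarrow> exp (- r * (s - t)) \<le> 1"
  using r_pos by simp

text \<open>
  The discounted terminal payoff plus the discounted income collected at rate \<open>f\<close> from \<open>t\<close> on.
\<close>

definition pay :: "(real \<Rightarrow> real \<Rightarrow> real) \<Rightarrow> real \<Rightarrow> real \<Rightarrow> 'a \<Rightarrow> real" where
  "pay f x t \<omega> = exp (- r * (T - t)) * h (X x t T \<omega>)
     + (LBINT s:{t..T}. exp (- r * (s - t)) * f (X x t s \<omega>) s)"

text \<open>
  \<open>v\<close> is a mild solution with source \<open>f\<close>: the Feynman-Kac form of \<open>v\<^sub>t + L v + f = 0\<close>, \<open>v(\<cdot>,T) = h\<close>, with
  \<open>L = \<sigma>\<^sup>2/2 \<partial>\<^sub>x\<^sub>x + (r - \<sigma>\<^sup>2/2) \<partial>\<^sub>x - r\<close>. The source may be built from \<open>v\<close> itself.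
\<close>

definition mild :: "(real \<Rightarrow> real \<Rightarrow> real) \<Rightarrow> (real \<Rightarrow> real \<Rightarrow> real) \<Rightarrow> bool" where
  "mild f v \<longleftrightarrow> (\<forall>x. \<forall>t\<in>{0..T}. v x t = expectation (pay f x t))"

lemma running_measurable:
  assumes "cbf f"
  shows "(\<lambda>(s, \<omega>). exp (- r * (s - t)) * f (X x t s \<omega>) s) \<in> borel_measurable (borel \<Otimes>\<^sub>M M)"
proof -
  have [measurable]: "(\<lambda>z. f (X x t (fst z) (snd z)) (fst z)) \<in> borel_measurable (borel \<Otimes>\<^sub>M M)"
    by (rule cbf_measurable[OF assms]) measurable
  show ?thesis unfolding case_prod_beta' by measurable
qed

lemma running_measurable_time:
  assumes "cbf f" "\<omega> \<in> space M"
  shows "(\<lambda>s. exp (- r * (s - t)) * f (X x t s \<omega>) s) \<in> borel_measurable borel"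
  using measurable_compose[of "\<lambda>s. (s, \<omega>)" borel, OF _ running_measurable[OF assms(1)]] assms(2)
  by simp

lemma running_continuous:
  assumes "cbf f" "\<omega> \<in> space M"
  shows "continuous_on A (\<lambda>s. exp (- r * (s - t)) * f (X x t s \<omega>) s)"
  by (intro continuous_intros cbf_continuous[OF assms(1)] continuous_X[OF assms(2)])

lemma running_bound:
  assumes "\<And>x t. \<bar>f x t\<bar> \<le> B" "t \<le> s"
  shows "\<bar>exp (- r * (s - t)) * f y s\<bar> \<le> B"
  using mult_mono[OF discount_le_one[OF assms(2)] assms(1)[of y s]] by (simp add: abs_mult)

lemma pay_measurable:
  assumes "cbf f" shows "pay f x t \<in> borel_measurable M"
  unfolding pay_def using borel_measurable_set_integral_time[OF running_measurable[OF assms]]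
  by measurable

lemma pay_bound:
  assumes "cbf f" and B: "\<And>x t. \<bar>f x t\<bar> \<le> B" and "t \<le> T" "\<omega> \<in> space M"
  shows "\<bar>pay f x t \<omega>\<bar> \<le> H + B * (T - t)"
proof -
  have "0 \<le> B" using B[of 0 0] by simp
  then have "\<bar>LBINT s:{t..T}. exp (- r * (s - t)) * f (X x t s \<omega>) s\<bar> \<le> B * (T - t)"
    using assms by (intro set_integral_bounded_time(2) running_measurable_time running_bound) auto
  moreover have "\<bar>exp (- r * (T - t)) * h (X x t T \<omega>)\<bar> \<le> H"
    using mult_mono[OF discount_le_one[OF assms(3)] h_bound] by (simp add: abs_mult)
  ultimately show ?thesis unfolding pay_def by linarith
qed

lemma continuous_expectation_pay:
  assumes f: "cbf f"
  shows "continuous_on (UNIV \<times> {0..T}) (\<lambda>z. expectation (pay f (fst z) (snd z)))"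
proof (rule continuous_on_sequentiallyI)
  fix u :: "nat \<Rightarrow> real \<times> real" and a
  assume u: "\<forall>n. u n \<in> UNIV \<times> {0..T}" "a \<in> UNIV \<times> {0..T}" "u \<longlonglongrightarrow> a"
  obtain B where B: "0 < B" "\<And>x t. \<bar>f x t\<bar> \<le> B" using f by (rule cbf_obtain_bound) blast
  have t: "\<And>n. snd (u n) \<in> {0..T}" "(\<lambda>n. snd (u n)) \<longlonglongrightarrow> snd a" "snd a \<in> {0..T}"
    using u(1,2) tendsto_snd[OF u(3)] by (auto simp: mem_Times_iff)
  have x: "(\<lambda>n. fst (u n)) \<longlonglongrightarrow> fst a" using tendsto_fst[OF u(3)] .
  have pt: "(\<lambda>n. pay f (fst (u n)) (snd (u n)) \<omega>) \<longlonglongrightarrow> pay f (fst a) (snd a) \<omega>" if \<omega>: "\<omega> \<in> space M" for \<omega>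
  proof -
    have c: "continuous_on UNIV (\<lambda>z. exp (- r * (s - snd z)) * f (X (fst z) (snd z) s \<omega>) s)" for s
      by (intro continuous_intros cbf_continuous[OF f] continuous_X[OF \<omega>])
    have L: "(\<lambda>n. exp (- r * (s - snd (u n))) * f (X (fst (u n)) (snd (u n)) s \<omega>) s)
        \<longlonglongrightarrow> exp (- r * (s - snd a)) * f (X (fst a) (snd a) s \<omega>) s" for s
      by (rule continuous_on_tendsto_compose[OF c u(3)]) auto
    have Bd: "\<bar>exp (- r * (s - snd (u n))) * f (X (fst (u n)) (snd (u n)) s \<omega>) s\<bar> \<le> exp (r * T) * B"
      if "s \<in> {0..T}" for n s
    proof -
      have "- r * (s - snd (u n)) \<le> r * T"
        using mult_left_mono[of "snd (u n) - s" T r] that t(1)[of n] r_pos by (simp add: algebra_simps)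
      then show ?thesis using B(2) by (auto simp: abs_mult intro!: mult_mono)
    qed
    have "(\<lambda>n. LBINT s:{snd (u n)..T}. exp (- r * (s - snd (u n))) * f (X (fst (u n)) (snd (u n)) s \<omega>) s)
        \<longlonglongrightarrow> (LBINT s:{snd a..T}. exp (- r * (s - snd a)) * f (X (fst a) (snd a) s \<omega>) s)"
      by (rule tendsto_set_integral_lower_limit[OF running_measurable_time[OF f \<omega>]
            running_measurable_time[OF f \<omega>] Bd L t])
    moreover have "(\<lambda>n. exp (- r * (T - snd (u n))) * h (X (fst (u n)) (snd (u n)) T \<omega>))
        \<longlonglongrightarrow> exp (- r * (T - snd a)) * h (X (fst a) (snd a) T \<omega>)"
    proof -
      have "continuous_on UNIV (\<lambda>z. exp (- r * (T - snd z)) * h (X (fst z) (snd z) T \<omega>))"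
        by (intro continuous_intros continuous_on_compose2[OF h_cont] continuous_X[OF \<omega>]) auto
      from continuous_on_tendsto_compose[OF this u(3)] show ?thesis by simp
    qed
    ultimately show ?thesis unfolding pay_def by (intro tendsto_add)
  qed
  show "(\<lambda>n. expectation (pay f (fst (u n)) (snd (u n)))) \<longlonglongrightarrow> expectation (pay f (fst a) (snd a))"
  proof (rule integral_dominated_convergence[where w="\<lambda>_. H + B * T"])
    show "AE \<omega> in M. norm (pay f (fst (u n)) (snd (u n)) \<omega>) \<le> H + B * T" for n
    proof (rule AE_I2)
      fix \<omega> assume \<omega>: "\<omega> \<in> space M"
      have "\<bar>pay f (fst (u n)) (snd (u n)) \<omega>\<bar> \<le> H + B * (T - snd (u n))"
        using pay_bound[OF f B(2) _ \<omega>] t(1)[of n] by auto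
      also have "\<dots> \<le> H + B * T" using t(1)[of n] B by auto
      finally show "norm (pay f (fst (u n)) (snd (u n)) \<omega>) \<le> H + B * T" by simp
    qed
  qed (use pt in \<open>auto intro: pay_measurable[OF f]\<close>)
qed

lemma expectation_pay_bound:
  assumes "cbf f" and B: "\<And>x t. \<bar>f x t\<bar> \<le> B" and "t \<le> T"
  shows "\<bar>expectation (pay f x t)\<bar> \<le> H + B * (T - t)"
  by (rule abs_expectation_le[OF pay_measurable[OF assms(1)] pay_bound[OF assms]])

lemma pay_integrable:
  assumes "cbf f" "t \<le> T" shows "integrable M (pay f x t)"
proof -
  obtain B where B: "0 < B" "\<And>x t. \<bar>f x t\<bar> \<le> B" using assms(1) by (rule cbf_obtain_bound) blast
  show ?thesis by (rule integrable_bounded[OF pay_measurable[OF assms(1)] pay_bound[OF assms(1) B(2) assms(2)]])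
qed

lemma expectation_pay:
  assumes f: "cbf f" and t: "t \<le> T"
  shows "expectation (pay f x t) = exp (- r * (T - t)) * expectation (\<lambda>\<omega>. h (X x t T \<omega>))
    + (LBINT s:{t..T}. exp (- r * (s - t)) * expectation (\<lambda>\<omega>. f (X x t s \<omega>) s))"
proof -
  obtain B where B: "0 < B" "\<And>x t. \<bar>f x t\<bar> \<le> B" using f by (rule cbf_obtain_bound) blast
  have b: "\<bar>exp (- r * (s - t)) * f (X x t s \<omega>) s\<bar> \<le> B" if "s \<in> {t..T}" for s \<omega>
    by (rule running_bound[OF B(2)]) (use that in simp)
  let ?run = "\<lambda>\<omega>. LBINT s:{t..T}. exp (- r * (s - t)) * f (X x t s \<omega>) s"
  have 1: "integrable M ?run"
    by (rule expectation_set_integral_swap(1)[OF running_measurable[OF f] t b])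
  have 2: "expectation ?run = (LBINT s:{t..T}. expectation (\<lambda>\<omega>. exp (- r * (s - t)) * f (X x t s \<omega>) s))"
    by (rule expectation_set_integral_swap(2)[OF running_measurable[OF f] t b])
  have "integrable M (\<lambda>\<omega>. exp (- r * (T - t)) * h (X x t T \<omega>))"
    by (rule integrable_bounded[where B="exp (- r * (T - t)) * H"]) (auto simp: abs_mult h_bound)
  from Bochner_Integration.integral_add[OF this 1] show ?thesis
    unfolding pay_def 2 integral_mult_right_zero .
qed

text \<open>
  The linear equation \<open>v\<^sub>t + L v + c - k v = 0\<close> has a bounded continuous mild solution. It is a
  Volterra equation in time, solved by the contraction principle.
\<close>

lemma exists_mild_feedback:
  assumes c: "cbf c" and k: "cbf k"
  shows "\<exists>v. cbf v \<and> mild (\<lambda>x t. c x t - k x t * v x t) v"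
proof -
  obtain B where B: "0 < B" "\<And>x t. \<bar>k x t\<bar> \<le> B" using k by (rule cbf_obtain_bound) blast
  define \<beta> where "\<beta> = 2 * B"
  have \<beta>: "0 < \<beta>" using B by (simp add: \<beta>_def)
  define cl where "cl t = max 0 (min T t)" for t
  have cl: "0 \<le> cl t" "cl t \<le> T" for t using T_pos by (auto simp: cl_def)
  have cl_id: "cl t = t" if "t \<in> {0..T}" for t using that by (auto simp: cl_def)
  have cl_cont: "continuous_on A cl" for A unfolding cl_def by (intro continuous_intros)
  \<comment> \<open>The unknown is \<open>exp (- \<beta> (T - t)) v\<close>; in terms of it the Picard operator is Lipschitz with
    constant \<open>B / \<beta> = 1/2\<close>.\<close>
  define val where "val g x t = exp (\<beta> * (T - cl t)) * apply_bcontfun g (x, t)"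
    for g :: "(real \<times> real) \<Rightarrow>\<^sub>C real" and x t
  define src where "src g x t = c x t - k x t * val g x t" for g x t
  have wt: "cbf (\<lambda>x t. exp (\<beta> * (T - cl t)))"
  proof (rule cbf_exp)
    have "\<bar>\<beta> * (T - cl t)\<bar> \<le> \<beta> * T" for t
      using cl[of t] \<beta> by (simp add: abs_mult)
    then show "cbf (\<lambda>x t. \<beta> * (T - cl t))"
      by (auto simp: cbf_def intro!: continuous_intros continuous_on_compose2[OF cl_cont[of UNIV]])
  qed
  have g_cbf: "cbf (\<lambda>x t. apply_bcontfun g (x, t))" for g
    unfolding cbf_def using Bounded_Continuous_Function.norm_bounded[of g] by auto
  have val_cbf: "cbf (val g)" for g unfolding val_def by (rule cbf_mult[OF wt g_cbf])
  have src_cbf: "cbf (src g)" for g unfolding src_def by (intro cbf_intros c k val_cbf)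
  define \<Gamma>f where "\<Gamma>f g z = exp (- \<beta> * (T - cl (snd z))) * expectation (pay (src g) (fst z) (cl (snd z)))" for g z
  have \<Gamma>b: "\<Gamma>f g \<in> bcontfun" for g
  proof -
    obtain C where C: "0 < C" "\<And>x t. \<bar>src g x t\<bar> \<le> C" using src_cbf by (rule cbf_obtain_bound) blast
    have "continuous_on UNIV (\<lambda>z. expectation (pay (src g) (fst (fst z, cl (snd z))) (snd (fst z, cl (snd z)))))"
      by (rule continuous_on_compose2[OF continuous_expectation_pay[OF src_cbf]])
        (use cl in \<open>auto intro!: continuous_intros continuous_on_compose2[OF cl_cont[of UNIV]]\<close>)
    then have "continuous_on UNIV (\<Gamma>f g)" unfolding \<Gamma>f_def
      by (auto intro!: continuous_intros continuous_on_compose2[OF cl_cont[of UNIV]])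
    moreover have "norm (\<Gamma>f g z) \<le> 1 * (H + C * T)" for z
      unfolding \<Gamma>f_def norm_mult
    proof (rule mult_mono)
      have "\<bar>expectation (pay (src g) (fst z) (cl (snd z)))\<bar> \<le> H + C * (T - cl (snd z))"
        by (rule expectation_pay_bound[OF src_cbf C(2)]) (rule cl)
      also have "\<dots> \<le> H + C * T" using cl C by simp
      finally show "norm (expectation (pay (src g) (fst z) (cl (snd z)))) \<le> H + C * T" by simp
    qed (use \<beta> cl in auto)
    ultimately show ?thesis by (rule bcontfun_normI)
  qed
  define \<Gamma> where "\<Gamma> g = Bcontfun (\<Gamma>f g)" for g
  have \<Gamma>_apply: "apply_bcontfun (\<Gamma> g) z = \<Gamma>f g z" for g z
    unfolding \<Gamma>_def by (simp add: Bcontfun_inverse[OF \<Gamma>b])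
  have contr: "dist (\<Gamma> g1) (\<Gamma> g2) \<le> 1/2 * dist g1 g2" for g1 g2
  proof (rule dist_bound)
    fix z :: "real \<times> real"
    let ?x = "fst z" and ?t = "cl (snd z)" and ?d = "dist g1 g2"
    have t: "0 \<le> ?t" "?t \<le> T" using cl by auto
    have pd: "\<bar>pay (src g1) ?x ?t \<omega> - pay (src g2) ?x ?t \<omega>\<bar> \<le> ?d / 2 * exp (\<beta> * (T - ?t))"
      if \<omega>: "\<omega> \<in> space M" for \<omega>
    proof -
      let ?e = "\<lambda>g s. exp (- r * (s - ?t)) * src g (X ?x ?t s \<omega>) s"
      have i: "set_integrable lborel {?t..T} (?e g)" for g
        by (rule borel_integrable_atLeastAtMost'[OF running_continuous[OF src_cbf \<omega>]])
      note id = set_integral_diff[OF i[of g1] i[of g2]]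
      have id2: "set_integrable lborel {?t..T} (\<lambda>s. \<bar>?e g1 s - ?e g2 s\<bar>)"
        by (rule set_integrable_abs[OF id(1)])
      have i3: "set_integrable lborel {?t..T} (\<lambda>s. B * ?d * exp (\<beta> * (T - s)))"
        by (intro borel_integrable_atLeastAtMost' continuous_intros)
      have le: "\<bar>?e g1 s - ?e g2 s\<bar> \<le> B * ?d * exp (\<beta> * (T - s))" if s: "s \<in> {?t..T}" for s
      proof -
        let ?y = "X ?x ?t s \<omega>"
        have "?e g1 s - ?e g2 s
            = exp (- r * (s - ?t)) * (- k ?y s * exp (\<beta> * (T - s)) * (apply_bcontfun g1 (?y, s) - apply_bcontfun g2 (?y, s)))"
          using s t cl_id[of s] by (simp add: src_def val_def algebra_simps)
        also have "\<bar>\<dots>\<bar> = exp (- r * (s - ?t)) * (\<bar>k ?y s\<bar> * exp (\<beta> * (T - s)) * dist (apply_bcontfun g1 (?y, s)) (apply_bcontfun g2 (?y, s)))"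
          by (simp add: abs_mult dist_real_def)
        also have "\<dots> \<le> 1 * (B * exp (\<beta> * (T - s)) * ?d)"
          using s B dist_bounded[of g1 "(?y, s)" g2] discount_le_one[of ?t s] by (intro mult_mono) auto
        finally show "\<bar>?e g1 s - ?e g2 s\<bar> \<le> B * ?d * exp (\<beta> * (T - s))" by (simp add: mult_ac)
      qed
      have "\<bar>pay (src g1) ?x ?t \<omega> - pay (src g2) ?x ?t \<omega>\<bar> = \<bar>LBINT s:{?t..T}. ?e g1 s - ?e g2 s\<bar>"
        unfolding pay_def id(2) by simp
      also have "\<dots> \<le> (LBINT s:{?t..T}. \<bar>?e g1 s - ?e g2 s\<bar>)"
        using set_integral_norm_bound[OF id(1)] by simp
      also have "\<dots> \<le> (LBINT s:{?t..T}. B * ?d * exp (\<beta> * (T - s)))"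
      proof (rule set_integral_mono[OF id2 i3])
        show "\<bar>?e g1 s - ?e g2 s\<bar> \<le> B * ?d * exp (\<beta> * (T - s))" if s: "s \<in> {?t..T}" for s
          by (rule le[OF s])
      qed
      also have "\<dots> = (- (?d / 2) * exp (\<beta> * (T - T))) - (- (?d / 2) * exp (\<beta> * (T - ?t)))"
      proof (rule set_integral_FTC[OF t(2)])
        fix s
        show "((\<lambda>s. - (?d / 2) * exp (\<beta> * (T - s))) has_real_derivative B * ?d * exp (\<beta> * (T - s))) (at s within {?t..T})"
          by (auto intro!: derivative_eq_intros simp: \<beta>_def)
      qed (intro continuous_intros)
      also have "\<dots> \<le> ?d / 2 * exp (\<beta> * (T - ?t))" by simp
      finally show ?thesis .
    qed
    have ig: "integrable M (pay (src g) ?x ?t)" for g by (rule pay_integrable[OF src_cbf t(2)])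
    have "dist (apply_bcontfun (\<Gamma> g1) z) (apply_bcontfun (\<Gamma> g2) z)
        = \<bar>exp (- \<beta> * (T - ?t)) * (expectation (pay (src g1) ?x ?t) - expectation (pay (src g2) ?x ?t))\<bar>"
      unfolding \<Gamma>_apply \<Gamma>f_def dist_real_def by (simp add: algebra_simps)
    also have "\<dots> = exp (- \<beta> * (T - ?t)) * \<bar>expectation (\<lambda>\<omega>. pay (src g1) ?x ?t \<omega> - pay (src g2) ?x ?t \<omega>)\<bar>"
      by (simp add: abs_mult ig)
    also have "\<dots> \<le> exp (- \<beta> * (T - ?t)) * (?d / 2 * exp (\<beta> * (T - ?t)))"
      by (intro mult_left_mono abs_expectation_le pd) (auto intro!: borel_measurable_diff pay_measurable src_cbf)
    also have "\<dots> = 1/2 * ?d * (exp (- \<beta> * (T - ?t)) * exp (\<beta> * (T - ?t)))"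
      by (simp only: mult_ac times_divide_eq_right times_divide_eq_left mult_1_left)
    also have "exp (- \<beta> * (T - ?t)) * exp (\<beta> * (T - ?t)) = 1" by (simp flip: exp_add)
    finally have "dist (apply_bcontfun (\<Gamma> g1) z) (apply_bcontfun (\<Gamma> g2) z) \<le> 1/2 * ?d * 1" .
    then show "dist (apply_bcontfun (\<Gamma> g1) z) (apply_bcontfun (\<Gamma> g2) z) \<le> 1/2 * ?d" by simp
  qed
  have "\<exists>!g. \<Gamma> g = g" by (rule banach_fix_type[of "1/2"]) (use contr in auto)
  then obtain g where g: "\<Gamma> g = g" by auto
  have "val g x t = expectation (pay (\<lambda>x t. c x t - k x t * val g x t) x t)" if "t \<in> {0..T}" for x t
  proof -
    have "apply_bcontfun g (x, t) = exp (- \<beta> * (T - t)) * expectation (pay (src g) x t)"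
      using \<Gamma>_apply[of g "(x, t)"] by (simp add: g \<Gamma>f_def cl_id[OF that])
    then have "val g x t = exp (\<beta> * (T - t)) * exp (- \<beta> * (T - t)) * expectation (pay (src g) x t)"
      by (simp add: val_def cl_id[OF that])
    also have "exp (\<beta> * (T - t)) * exp (- \<beta> * (T - t)) = 1" by (simp flip: exp_add)
    finally show ?thesis by (simp add: src_def[abs_def])
  qed
  then have "mild (\<lambda>x t. c x t - k x t * val g x t) (val g)" by (simp add: mild_def)
  then show ?thesis using val_cbf by blast
qed

end

section \<open>Mild solutions under killing\<close>

lemma set_integral_point [simp]:
  fixes g :: "real \<Rightarrow> real" shows "(LBINT q:{t}. g q) = 0"
  unfolding set_lebesgue_integral_def
  by (rule integral_eq_zero_AE, rule AE_mp[OF AE_lborel_singleton[of t]]) simp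

context gbm_claim begin

text \<open>
  The accumulated intensity of stopping along the log-price.
\<close>

definition hazard :: "(real \<Rightarrow> real \<Rightarrow> real) \<Rightarrow> real \<Rightarrow> real \<Rightarrow> real \<Rightarrow> 'a \<Rightarrow> real" where
  "hazard k x t s \<omega> = (LBINT q:{t..s}. k (X x t q \<omega>) q)"

text \<open>
  The survival weight: the solution of \<open>dp = - k(X\<^sub>s,s) p ds\<close>, \<open>p\<^sub>t = 1\<close>.
\<close>

definition weight :: "(real \<Rightarrow> real \<Rightarrow> real) \<Rightarrow> real \<Rightarrow> real \<Rightarrow> real \<Rightarrow> 'a \<Rightarrow> real" where
  "weight k x t s \<omega> = exp (- hazard k x t s \<omega>)"

lemma intensity_measurable:
  assumes "cbf k" shows "(\<lambda>(q, \<omega>). k (X x t q \<omega>) q) \<in> borel_measurable (borel \<Otimes>\<^sub>M M)"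
  unfolding case_prod_beta' by (rule cbf_measurable[OF assms]) measurable

lemma intensity_continuous:
  assumes "cbf k" "\<omega> \<in> space M" shows "continuous_on A (\<lambda>q. k (X x t q \<omega>) q)"
  by (intro continuous_intros cbf_continuous[OF assms(1)] continuous_X[OF assms(2)])

lemma weight_start [simp]: "weight k x t t \<omega> = 1"
  by (simp add: weight_def hazard_def)

lemma weight_pos [simp]: "0 < weight k x t s \<omega>"
  by (simp add: weight_def)

lemma weight_le_one:
  assumes "\<And>x t. 0 \<le> k x t" shows "weight k x t s \<omega> \<le> 1"
  unfolding weight_def hazard_def set_lebesgue_integral_def
  using assms by (simp add: integral_nonneg)

lemma weight_derivative:
  assumes k: "cbf k" and \<omega>: "\<omega> \<in> space M" and s: "s \<in> {t..T}"
  shows "((\<lambda>s. weight k x t s \<omega>) has_real_derivative - k (X x t s \<omega>) s * weight k x t s \<omega>)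
    (at s within {t..T})"
  unfolding weight_def hazard_def
  by (rule derivative_eq_intros set_integral_has_real_derivative[OF intensity_continuous[OF k \<omega>] s] refl)+
    simp

lemma weight_continuous:
  assumes "cbf k" "\<omega> \<in> space M" shows "continuous_on {t..T} (\<lambda>s. weight k x t s \<omega>)"
  using weight_derivative[OF assms] by (rule DERIV_continuous_on)

lemma weight_measurable:
  assumes "cbf k" shows "(\<lambda>(s, \<omega>). weight k x t s \<omega>) \<in> borel_measurable (borel \<Otimes>\<^sub>M M)"
proof -
  have [measurable]: "(\<lambda>z. hazard k x t (fst z) (snd z)) \<in> borel_measurable (borel \<Otimes>\<^sub>M M)"
    using running_integral_measurable[OF intensity_measurable[OF assms]]
    unfolding hazard_def case_prod_beta' .
  show ?thesis unfolding weight_def case_prod_beta' by measurable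
qed

lemma running_integral_adapted:
  assumes "cbf f" and ts: "0 \<le> t" "t \<le> s" and [measurable]: "g \<in> borel_measurable borel"
  shows "(\<lambda>\<omega>. LBINT q:{t..s}. g q * f (X x t q \<omega>) q) \<in> borel_measurable (F s)"
proof -
  have [measurable]: "(\<lambda>z. X x t (min s (fst z)) (snd z)) \<in> borel_measurable (borel \<Otimes>\<^sub>M F s)"
    using X_pair_measurable_F[OF ts] by (simp add: case_prod_beta')
  have [measurable]: "(\<lambda>z. f (X x t (min s (fst z)) (snd z)) (fst z)) \<in> borel_measurable (borel \<Otimes>\<^sub>M F s)"
    by (rule cbf_measurable[OF assms(1)]) measurable
  have "(\<lambda>(q, \<omega>). g q * f (X x t (min s q) \<omega>) q) \<in> borel_measurable (borel \<Otimes>\<^sub>M F s)"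
    unfolding case_prod_beta' by measurable
  from borel_measurable_set_integral_time[OF this]
  have "(\<lambda>\<omega>. LBINT q:{t..s}. g q * f (X x t (min s q) \<omega>) q) \<in> borel_measurable (F s)" .
  also have "(\<lambda>\<omega>. LBINT q:{t..s}. g q * f (X x t (min s q) \<omega>) q)
      = (\<lambda>\<omega>. LBINT q:{t..s}. g q * f (X x t q \<omega>) q)"
    by (intro ext set_lebesgue_integral_cong) (auto simp: min_def)
  finally show ?thesis .
qed

lemma weight_adapted:
  assumes "cbf k" "0 \<le> t" "t \<le> s"
  shows "weight k x t s \<in> borel_measurable (F s)"
proof -
  have "hazard k x t s \<in> borel_measurable (F s)"
    using running_integral_adapted[OF assms, of "\<lambda>_. 1"] unfolding hazard_def by simp
  then show ?thesis unfolding weight_def by measurable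
qed

text \<open>
  For a mild solution, \<open>v(X\<^sub>s,s)\<close> is the conditional expectation at time \<open>s\<close> of the remaining income.
\<close>

lemma mild_markov:
  assumes f: "cbf f" and v: "cbf v" and mild: "mild f v"
    and ts: "0 \<le> t" "t \<le> s" "s \<le> T"
    and Z: "Z \<in> borel_measurable (F s)" "\<And>\<omega>. \<omega> \<in> space M \<Longrightarrow> \<bar>Z \<omega>\<bar> \<le> B"
  shows "expectation (\<lambda>\<omega>. Z \<omega> * (exp (- r * (T - s)) * h (X x t T \<omega>)
      + (LBINT q:{s..T}. exp (- r * (q - s)) * f (X x t q \<omega>) q)))
    = expectation (\<lambda>\<omega>. Z \<omega> * v (X x t s \<omega>) s)"
proof -
  obtain C where C: "0 < C" "\<And>x t. \<bar>f x t\<bar> \<le> C" using f by (rule cbf_obtain_bound) blast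
  have ZM[measurable]: "Z \<in> borel_measurable M" using Z(1) by (rule measurable_F_M)
  have B: "0 \<le> B" using Z(2) not_empty by fastforce
  define G where "G q y = exp (- r * (q - s)) * expectation (\<lambda>\<omega>'. f (X y s q \<omega>') q)" for q y
  define G0 where "G0 y = exp (- r * (T - s)) * expectation (\<lambda>\<omega>'. h (X y s T \<omega>'))" for y
  have fm: "(\<lambda>z. f (X (snd (fst z)) s (fst (fst z)) (snd z)) (fst (fst z)))
      \<in> borel_measurable ((borel \<Otimes>\<^sub>M borel) \<Otimes>\<^sub>M M)"
    by (rule cbf_measurable[OF f]) measurable
  have [measurable]: "(\<lambda>z. G (fst z) (snd z)) \<in> borel_measurable (borel \<Otimes>\<^sub>M borel)"
    unfolding G_def using fm by measurable
  have [measurable]: "(\<lambda>q. f (X y s q \<omega>') q) \<in> borel_measurable borel" if "\<omega>' \<in> space M" for y \<omega>'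
    using that by (intro cbf_measurable[OF f]) measurable
  have f1[measurable]: "(\<lambda>y. f y q) \<in> borel_measurable borel" for q
    by (rule cbf_measurable[OF f]) measurable
  have f2[measurable]: "(\<lambda>\<omega>. f (X y t q \<omega>) q) \<in> borel_measurable M" for y t q
    by (rule cbf_measurable[OF f]) measurable
  have Gb: "\<bar>G q y\<bar> \<le> C" if "s \<le> q" for q y
  proof -
    have "\<bar>expectation (\<lambda>\<omega>'. f (X y s q \<omega>') q)\<bar> \<le> C"
      by (rule abs_expectation_le[OF f2]) (rule C(2))
    then show ?thesis unfolding G_def
      using mult_mono[OF discount_le_one[OF that]] by (fastforce simp: abs_mult)
  qed
  have G0_meas[measurable]: "G0 \<in> borel_measurable borel" unfolding G0_def by measurable
  have G0b: "\<bar>G0 y\<bar> \<le> H" for y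
  proof -
    have "\<bar>expectation (\<lambda>\<omega>'. h (X y s T \<omega>'))\<bar> \<le> H"
      by (rule abs_expectation_le) (measurable, rule h_bound)
    then show ?thesis unfolding G0_def
      using mult_mono[OF discount_le_one[OF ts(3)]] by (fastforce simp: abs_mult)
  qed
  have v_eq: "v y s = G0 y + (LBINT q:{s..T}. G q y)" for y
  proof -
    have "v y s = expectation (pay f y s)" using mild ts by (simp add: mild_def)
    then show ?thesis unfolding expectation_pay[OF f ts(3)] G_def G0_def .
  qed
  have ef: "expectation (\<lambda>\<omega>. Z \<omega> * (exp (- r * (q - s)) * f (X x t q \<omega>) q))
      = expectation (\<lambda>\<omega>. Z \<omega> * G q (X x t s \<omega>))" if "s \<le> q" for q
    using markov_one_step[OF ts(1,2) that Z f1[of q] C(2), where x=x]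
    by (simp only: G_def mult.left_commute[of _ "exp (- r * (q - s))"] integral_mult_right_zero)
  have eh: "expectation (\<lambda>\<omega>. Z \<omega> * (exp (- r * (T - s)) * h (X x t T \<omega>)))
      = expectation (\<lambda>\<omega>. Z \<omega> * G0 (X x t s \<omega>))"
    using markov_one_step[OF ts Z h_measurable h_bound, of x]
    by (simp only: G0_def mult.left_commute[of _ "exp (- r * (T - s))"] integral_mult_right_zero)
  let ?L = "\<lambda>\<omega>. LBINT q:{s..T}. Z \<omega> * (exp (- r * (q - s)) * f (X x t q \<omega>) q)"
  let ?R = "\<lambda>\<omega>. LBINT q:{s..T}. Z \<omega> * G q (X x t s \<omega>)"
  have Lm: "(\<lambda>(q, \<omega>). Z \<omega> * (exp (- r * (q - s)) * f (X x t q \<omega>) q)) \<in> borel_measurable (borel \<Otimes>\<^sub>M M)"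
  proof -
    have [measurable]: "(\<lambda>z. f (X x t (fst z) (snd z)) (fst z)) \<in> borel_measurable (borel \<Otimes>\<^sub>M M)"
      by (rule cbf_measurable[OF f]) measurable
    show ?thesis unfolding case_prod_beta' by measurable
  qed
  have Rm: "(\<lambda>(q, \<omega>). Z \<omega> * G q (X x t s \<omega>)) \<in> borel_measurable (borel \<Otimes>\<^sub>M M)"
  proof -
    have [measurable]: "(\<lambda>z. G (fst z) (X x t s (snd z))) \<in> borel_measurable (borel \<Otimes>\<^sub>M M)"
      using measurable_compose[of "\<lambda>z. (fst z, X x t s (snd z))" "borel \<Otimes>\<^sub>M M" "borel \<Otimes>\<^sub>M borel"
          "\<lambda>z. G (fst z) (snd z)"] by simp
    show ?thesis unfolding case_prod_beta' by measurable
  qed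
  have Lb: "\<bar>Z \<omega> * (exp (- r * (q - s)) * f (X x t q \<omega>) q)\<bar> \<le> B * C"
    if "q \<in> {s..T}" "\<omega> \<in> space M" for q \<omega>
    unfolding abs_mult[of "Z \<omega>"]
    by (rule mult_mono) (use that B Z(2) running_bound[OF C(2), of s q] in auto)
  have Rb: "\<bar>Z \<omega> * G q (X x t s \<omega>)\<bar> \<le> B * C" if "q \<in> {s..T}" "\<omega> \<in> space M" for q \<omega>
    unfolding abs_mult by (rule mult_mono) (use that B Z(2) Gb in auto)
  have "expectation (\<lambda>\<omega>. Z \<omega> * (exp (- r * (T - s)) * h (X x t T \<omega>)
      + (LBINT q:{s..T}. exp (- r * (q - s)) * f (X x t q \<omega>) q)))
    = expectation (\<lambda>\<omega>. Z \<omega> * (exp (- r * (T - s)) * h (X x t T \<omega>)) + ?L \<omega>)"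
    by (simp add: distrib_left)
  also have "\<dots> = expectation (\<lambda>\<omega>. Z \<omega> * (exp (- r * (T - s)) * h (X x t T \<omega>))) + expectation ?L"
  proof (rule Bochner_Integration.integral_add)
    show "integrable M (\<lambda>\<omega>. Z \<omega> * (exp (- r * (T - s)) * h (X x t T \<omega>)))"
    proof (rule integrable_bounded[where B="B * (exp (- r * (T - s)) * H)"])
      show "\<bar>Z \<omega> * (exp (- r * (T - s)) * h (X x t T \<omega>))\<bar> \<le> B * (exp (- r * (T - s)) * H)"
        if "\<omega> \<in> space M" for \<omega>
        unfolding abs_mult by (intro mult_mono) (use that B Z(2) h_bound in auto)
    qed measurable
    show "integrable M ?L" by (rule expectation_set_integral_swap(1)[OF Lm ts(3) Lb])
  qed
  also have "expectation ?L = (LBINT q:{s..T}. expectation (\<lambda>\<omega>. Z \<omega> * (exp (- r * (q - s)) * f (X x t q \<omega>) q)))"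
    by (rule expectation_set_integral_swap(2)[OF Lm ts(3) Lb])
  also have "\<dots> = (LBINT q:{s..T}. expectation (\<lambda>\<omega>. Z \<omega> * G q (X x t s \<omega>)))"
    by (rule set_lebesgue_integral_cong) (use ef in auto)
  also have "\<dots> = expectation ?R"
    by (rule expectation_set_integral_swap(2)[OF Rm ts(3) Rb, symmetric])
  also have "expectation (\<lambda>\<omega>. Z \<omega> * (exp (- r * (T - s)) * h (X x t T \<omega>))) + expectation ?R
      = expectation (\<lambda>\<omega>. Z \<omega> * G0 (X x t s \<omega>) + ?R \<omega>)"
    unfolding eh
  proof (rule Bochner_Integration.integral_add[symmetric])
    show "integrable M (\<lambda>\<omega>. Z \<omega> * G0 (X x t s \<omega>))"
    proof (rule integrable_bounded[where B="B * H"])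
      show "\<bar>Z \<omega> * G0 (X x t s \<omega>)\<bar> \<le> B * H" if "\<omega> \<in> space M" for \<omega>
        unfolding abs_mult by (intro mult_mono) (use that B Z(2) G0b in auto)
    qed measurable
    show "integrable M ?R" by (rule expectation_set_integral_swap(1)[OF Rm ts(3) Rb])
  qed
  also have "\<dots> = expectation (\<lambda>\<omega>. Z \<omega> * v (X x t s \<omega>) s)"
    by (simp add: v_eq distrib_left)
  finally show ?thesis .
qed

text \<open>
  Killing at rate \<open>k\<close> is compensated by the additional income \<open>k v\<close>. With \<open>Y\<close> the total income, and
  \<open>\<Phi>\<^sub>s\<close> the part collected up to \<open>s\<close>, write \<open>Y = p\<^sub>T Y + \<integral> \<rho>\<^sub>s Y ds\<close> with \<open>\<rho> = k p\<close>, condition the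
  integrand at time \<open>s\<close>, and integrate \<open>d(p \<Phi>)\<close> along each path.
\<close>

lemma killed_representation:
  assumes f: "cbf f" and v: "cbf v" and mild: "mild f v"
    and k: "cbf k" and k0: "\<And>x t. 0 \<le> k x t" and t: "t \<in> {0..T}"
  shows "v x t = expectation (\<lambda>\<omega>. exp (- r * (T - t)) * h (X x t T \<omega>) * weight k x t T \<omega>
      + (LBINT s:{t..T}. exp (- r * (s - t))
          * (f (X x t s \<omega>) s + k (X x t s \<omega>) s * v (X x t s \<omega>) s) * weight k x t s \<omega>))"
proof -
  obtain C where C: "0 < C" "\<And>x t. \<bar>f x t\<bar> \<le> C" using f by (rule cbf_obtain_bound) blast
  obtain D where D: "0 < D" "\<And>x t. \<bar>k x t\<bar> \<le> D" using k by (rule cbf_obtain_bound) blast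
  obtain E where E: "0 < E" "\<And>x t. \<bar>v x t\<bar> \<le> E" using v by (rule cbf_obtain_bound) blast
  have t': "0 \<le> t" "t \<le> T" using t by auto
  define \<Phi> where "\<Phi> s \<omega> = (LBINT q:{t..s}. exp (- r * (q - t)) * f (X x t q \<omega>) q)" for s \<omega>
  define p where "p = weight k x t"
  define \<rho> where "\<rho> s \<omega> = k (X x t s \<omega>) s * p s \<omega>" for s \<omega>
  define Y where "Y = pay f x t"
  define N where "N = H + C * T"
  have N: "0 \<le> N" using H_nonneg C T_pos by (simp add: N_def)
  have Yb: "\<bar>Y \<omega>\<bar> \<le> N" if "\<omega> \<in> space M" for \<omega>
  proof -
    have "\<bar>Y \<omega>\<bar> \<le> H + C * (T - t)" unfolding Y_def by (rule pay_bound[OF f C(2) t'(2) that])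
    also have "\<dots> \<le> N" using t' C by (simp add: N_def)
    finally show ?thesis .
  qed
  have Y_meas[measurable]: "Y \<in> borel_measurable M" unfolding Y_def by (rule pay_measurable[OF f])
  have p01: "0 < p s \<omega>" "p s \<omega> \<le> 1" for s \<omega>
    unfolding p_def using weight_le_one[of k, OF k0] by auto
  have \<rho>b: "\<bar>\<rho> s \<omega>\<bar> \<le> D" for s \<omega>
    unfolding \<rho>_def abs_mult using mult_mono[OF D(2), of "\<bar>p s \<omega>\<bar>" 1] p01[of s \<omega>] D(1) by simp
  have \<Phi>_meas: "(\<lambda>(s, \<omega>). \<Phi> s \<omega>) \<in> borel_measurable (borel \<Otimes>\<^sub>M M)"
    unfolding \<Phi>_def by (rule running_integral_measurable[OF running_measurable[OF f]])
  have \<rho>_meas: "(\<lambda>(s, \<omega>). \<rho> s \<omega>) \<in> borel_measurable (borel \<Otimes>\<^sub>M M)"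
    using weight_measurable[OF k] intensity_measurable[OF k]
    unfolding \<rho>_def p_def case_prod_beta' by measurable
  have [measurable]: "(\<lambda>z. \<Phi> (fst z) (snd z)) \<in> borel_measurable (borel \<Otimes>\<^sub>M M)"
      "(\<lambda>z. \<rho> (fst z) (snd z)) \<in> borel_measurable (borel \<Otimes>\<^sub>M M)"
    using \<Phi>_meas \<rho>_meas by (simp_all add: case_prod_beta')
  have [measurable]: "(\<lambda>z. v (X x t (fst z) (snd z)) (fst z)) \<in> borel_measurable (borel \<Otimes>\<^sub>M M)"
    by (rule cbf_measurable[OF v]) measurable
  have \<Phi>b: "\<bar>\<Phi> s \<omega>\<bar> \<le> N" if "s \<in> {t..T}" "\<omega> \<in> space M" for s \<omega>
  proof -
    have "\<bar>\<Phi> s \<omega>\<bar> \<le> C * (s - t)" unfolding \<Phi>_def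
      using that C by (intro set_integral_bounded_time(2) running_measurable_time[OF f] running_bound) auto
    also have "\<dots> \<le> C * T" using that t' C by (intro mult_left_mono) auto
    also have "\<dots> \<le> N" using H_nonneg by (simp add: N_def)
    finally show ?thesis .
  qed
  have slice: "(\<lambda>\<omega>. g s \<omega>) \<in> borel_measurable M"
    if "(\<lambda>z. g (fst z) (snd z)) \<in> borel_measurable (borel \<Otimes>\<^sub>M M)" for s and g :: "real \<Rightarrow> 'a \<Rightarrow> real"
    using measurable_compose[of "\<lambda>\<omega>. (s, \<omega>)" M, OF _ that] by simp
  have [measurable]: "(\<lambda>\<omega>. \<Phi> s \<omega>) \<in> borel_measurable M" "(\<lambda>\<omega>. \<rho> s \<omega>) \<in> borel_measurable M"
    "(\<lambda>\<omega>. v (X x t s \<omega>) s) \<in> borel_measurable M" for s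
    by (rule slice, measurable)+
  have p_meas[measurable]: "p T \<in> borel_measurable M"
    unfolding p_def by (rule measurable_F_M[OF weight_adapted[OF k t']])
  let ?w = "\<lambda>s \<omega>. \<rho> s \<omega> * \<Phi> s \<omega> + \<rho> s \<omega> * exp (- r * (s - t)) * v (X x t s \<omega>) s"
  have wb: "\<bar>?w s \<omega>\<bar> \<le> D * N + D * E" if "s \<in> {t..T}" "\<omega> \<in> space M" for s \<omega>
  proof -
    have "\<bar>\<rho> s \<omega> * \<Phi> s \<omega>\<bar> \<le> D * N"
      unfolding abs_mult by (intro mult_mono \<rho>b \<Phi>b that) (use D in auto)
    moreover have "\<bar>\<rho> s \<omega> * (exp (- r * (s - t)) * v (X x t s \<omega>) s)\<bar> \<le> D * E"
      unfolding abs_mult[of "\<rho> s \<omega>"]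
      by (intro mult_mono \<rho>b running_bound[OF E(2)]) (use D that in auto)
    ultimately show ?thesis by (simp add: mult.assoc)
  qed
  have cond: "expectation (\<lambda>\<omega>. \<rho> s \<omega> * Y \<omega>) = expectation (?w s)" if s: "s \<in> {t..T}" for s
  proof -
    have ts: "0 \<le> t" "t \<le> s" "s \<le> T" using s t by auto
    let ?tail = "\<lambda>\<omega>. exp (- r * (T - s)) * h (X x t T \<omega>)
        + (LBINT q:{s..T}. exp (- r * (q - s)) * f (X x t q \<omega>) q)"
    have \<rho>F: "(\<lambda>\<omega>. \<rho> s \<omega> * exp (- r * (s - t))) \<in> borel_measurable (F s)"
    proof -
      have [measurable]: "(\<lambda>\<omega>. k (X x t s \<omega>) s) \<in> borel_measurable (F s)"
        by (rule cbf_measurable[OF k X_adapted[OF ts(1,2)]]) simp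
      show ?thesis using weight_adapted[OF k ts(1,2)] unfolding \<rho>_def p_def by measurable
    qed
    have ee: "exp (- r * (s - t)) * (exp (- r * (q - s)) * y) = exp (- r * (q - t)) * y" for q y
    proof -
      have "exp (- r * (s - t)) * exp (- r * (q - s)) = exp (- r * (q - t))"
        by (simp add: exp_add[symmetric] algebra_simps)
      then show ?thesis by (simp only: mult.assoc[symmetric])
    qed
    have Y_split: "Y \<omega> = \<Phi> s \<omega> + exp (- r * (s - t)) * ?tail \<omega>" if \<omega>: "\<omega> \<in> space M" for \<omega>
    proof -
      let ?e = "\<lambda>q. exp (- r * (q - t)) * f (X x t q \<omega>) q"
      let ?E = "LBINT q:{s..T}. exp (- r * (q - s)) * f (X x t q \<omega>) q"
      have "(LBINT q:{t..T}. ?e q) = (LBINT q:{t..s}. ?e q) + (LBINT q:{s..T}. ?e q)"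
        by (rule set_integral_combine[OF ts(2,3) running_continuous[OF f \<omega>]])
      moreover have "(LBINT q:{s..T}. ?e q) = exp (- r * (s - t)) * ?E"
        using set_integral_mult_right[where A="{s..T}" and M=lborel
            and a="exp (- r * (s - t))" and f="\<lambda>q. exp (- r * (q - s)) * f (X x t q \<omega>) q"] unfolding ee .
      ultimately have "(LBINT q:{t..T}. ?e q) = \<Phi> s \<omega> + exp (- r * (s - t)) * ?E"
        unfolding \<Phi>_def by simp
      then show ?thesis unfolding Y_def pay_def distrib_left ee by (simp only: add.left_commute)
    qed
    have tail_b: "\<bar>exp (- r * (s - t)) * ?tail \<omega>\<bar> \<le> N + N" if \<omega>: "\<omega> \<in> space M" for \<omega>
      using Y_split[OF \<omega>] Yb[OF \<omega>] \<Phi>b[OF s \<omega>] by linarith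
    have "expectation (\<lambda>\<omega>. \<rho> s \<omega> * Y \<omega>)
        = expectation (\<lambda>\<omega>. \<rho> s \<omega> * \<Phi> s \<omega> + (\<rho> s \<omega> * exp (- r * (s - t))) * ?tail \<omega>)"
      by (rule Bochner_Integration.integral_cong) (simp_all only: Y_split distrib_left mult.assoc)
    also have "\<dots> = expectation (\<lambda>\<omega>. \<rho> s \<omega> * \<Phi> s \<omega>)
        + expectation (\<lambda>\<omega>. (\<rho> s \<omega> * exp (- r * (s - t))) * ?tail \<omega>)"
    proof (rule Bochner_Integration.integral_add)
      show "integrable M (\<lambda>\<omega>. \<rho> s \<omega> * \<Phi> s \<omega>)"
        by (rule integrable_bounded[where B="D * N"])
          (use D \<rho>b \<Phi>b s in \<open>auto simp: abs_mult intro!: mult_mono\<close>)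
      show "integrable M (\<lambda>\<omega>. (\<rho> s \<omega> * exp (- r * (s - t))) * ?tail \<omega>)"
      proof (rule integrable_bounded[where B="D * (N + N)"])
        have [measurable]: "(\<lambda>\<omega>. LBINT q:{s..T}. exp (- r * (q - s)) * f (X x t q \<omega>) q) \<in> borel_measurable M"
        proof (rule borel_measurable_set_integral_time)
          show "(\<lambda>(q, \<omega>). exp (- r * (q - s)) * f (X x t q \<omega>) q) \<in> borel_measurable (borel \<Otimes>\<^sub>M M)"
            using intensity_measurable[OF f, of x t] unfolding case_prod_beta' by measurable
        qed
        show "(\<lambda>\<omega>. (\<rho> s \<omega> * exp (- r * (s - t))) * ?tail \<omega>) \<in> borel_measurable M" by measurable
        show "\<bar>(\<rho> s \<omega> * exp (- r * (s - t))) * ?tail \<omega>\<bar> \<le> D * (N + N)" if "\<omega> \<in> space M" for \<omega>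
          unfolding mult.assoc abs_mult[of "\<rho> s \<omega>"]
          by (intro mult_mono \<rho>b tail_b that) (use D in auto)
      qed
    qed
    also have "expectation (\<lambda>\<omega>. (\<rho> s \<omega> * exp (- r * (s - t))) * ?tail \<omega>)
        = expectation (\<lambda>\<omega>. (\<rho> s \<omega> * exp (- r * (s - t))) * v (X x t s \<omega>) s)"
    proof (rule mild_markov[OF f v mild ts \<rho>F])
      show "\<bar>\<rho> s \<omega> * exp (- r * (s - t))\<bar> \<le> D" for \<omega>
        using mult_mono[OF \<rho>b discount_le_one[OF ts(2)]] D by (simp add: abs_mult)
    qed
    also have "expectation (\<lambda>\<omega>. \<rho> s \<omega> * \<Phi> s \<omega>)
        + expectation (\<lambda>\<omega>. (\<rho> s \<omega> * exp (- r * (s - t))) * v (X x t s \<omega>) s) = expectation (?w s)"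
    proof (rule Bochner_Integration.integral_add[symmetric])
      show "integrable M (\<lambda>\<omega>. \<rho> s \<omega> * \<Phi> s \<omega>)"
        by (rule integrable_bounded[where B="D * N"])
          (use D \<rho>b \<Phi>b s in \<open>auto simp: abs_mult intro!: mult_mono\<close>)
      show "integrable M (\<lambda>\<omega>. \<rho> s \<omega> * exp (- r * (s - t)) * v (X x t s \<omega>) s)"
      proof (rule integrable_bounded[where B="D * E"])
        show "\<bar>\<rho> s \<omega> * exp (- r * (s - t)) * v (X x t s \<omega>) s\<bar> \<le> D * E" if "\<omega> \<in> space M" for \<omega>
          unfolding mult.assoc abs_mult[of "\<rho> s \<omega>"]
          by (intro mult_mono \<rho>b running_bound[OF E(2)]) (use D s in auto)
      qed measurable
    qed
    finally show ?thesis .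
  qed
  have w_meas: "(\<lambda>(s, \<omega>). ?w s \<omega>) \<in> borel_measurable (borel \<Otimes>\<^sub>M M)"
    unfolding case_prod_beta' by measurable
  have \<rho>Y_meas: "(\<lambda>(s, \<omega>). \<rho> s \<omega> * Y \<omega>) \<in> borel_measurable (borel \<Otimes>\<^sub>M M)"
    unfolding case_prod_beta' by measurable
  have \<rho>Yb: "\<bar>\<rho> s \<omega> * Y \<omega>\<bar> \<le> D * N" if "s \<in> {t..T}" "\<omega> \<in> space M" for s \<omega>
    unfolding abs_mult by (intro mult_mono \<rho>b Yb that) (use D in auto)
  have pY: "integrable M (\<lambda>\<omega>. p T \<omega> * Y \<omega>)"
  proof (rule integrable_bounded[where B=N])
    show "\<bar>p T \<omega> * Y \<omega>\<bar> \<le> N" if "\<omega> \<in> space M" for \<omega>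
      unfolding abs_mult using mult_mono[of "\<bar>p T \<omega>\<bar>" 1 "\<bar>Y \<omega>\<bar>" N] p01[of T \<omega>] Yb[OF that] by simp
  qed measurable
  have "v x t = expectation Y" using mild t by (simp add: mild_def Y_def)
  also have "\<dots> = expectation (\<lambda>\<omega>. p T \<omega> * Y \<omega> + (LBINT s:{t..T}. \<rho> s \<omega> * Y \<omega>))"
  proof (rule Bochner_Integration.integral_cong[OF refl])
    fix \<omega> assume \<omega>: "\<omega> \<in> space M"
    have "(LBINT s:{t..T}. - k (X x t s \<omega>) s * p s \<omega>) = p T \<omega> - p t \<omega>"
    proof (rule set_integral_FTC[OF t'(2)])
      show "((\<lambda>s. p s \<omega>) has_real_derivative - k (X x t s \<omega>) s * p s \<omega>) (at s within {t..T})"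
        if "s \<in> {t..T}" for s
        unfolding p_def by (rule weight_derivative[OF k \<omega> that])
      show "continuous_on {t..T} (\<lambda>s. - k (X x t s \<omega>) s * p s \<omega>)"
        unfolding p_def by (intro continuous_intros intensity_continuous[OF k \<omega>] weight_continuous[OF k \<omega>])
    qed
    then have "(LBINT s:{t..T}. - \<rho> s \<omega>) = p T \<omega> - 1" by (simp add: \<rho>_def p_def)
    moreover have "(LBINT s:{t..T}. - \<rho> s \<omega>) = - (LBINT s:{t..T}. \<rho> s \<omega>)"
      unfolding set_lebesgue_integral_def by simp
    ultimately have "1 = p T \<omega> + (LBINT s:{t..T}. \<rho> s \<omega>)" by simp
    then have "Y \<omega> = (p T \<omega> + (LBINT s:{t..T}. \<rho> s \<omega>)) * Y \<omega>" by simp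
    then show "Y \<omega> = p T \<omega> * Y \<omega> + (LBINT s:{t..T}. \<rho> s \<omega> * Y \<omega>)" by (simp add: algebra_simps)
  qed
  also have "\<dots> = expectation (\<lambda>\<omega>. p T \<omega> * Y \<omega>) + expectation (\<lambda>\<omega>. LBINT s:{t..T}. \<rho> s \<omega> * Y \<omega>)"
  proof (rule Bochner_Integration.integral_add[OF pY])
    show "integrable M (\<lambda>\<omega>. LBINT s:{t..T}. \<rho> s \<omega> * Y \<omega>)"
      by (rule expectation_set_integral_swap(1)[OF \<rho>Y_meas t'(2) \<rho>Yb])
  qed
  also have "expectation (\<lambda>\<omega>. LBINT s:{t..T}. \<rho> s \<omega> * Y \<omega>) = (LBINT s:{t..T}. expectation (\<lambda>\<omega>. \<rho> s \<omega> * Y \<omega>))"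
    by (rule expectation_set_integral_swap(2)[OF \<rho>Y_meas t'(2) \<rho>Yb])
  also have "\<dots> = (LBINT s:{t..T}. expectation (?w s))"
    by (rule set_lebesgue_integral_cong) (use cond in auto)
  also have "\<dots> = expectation (\<lambda>\<omega>. LBINT s:{t..T}. ?w s \<omega>)"
    by (rule expectation_set_integral_swap(2)[OF w_meas t'(2) wb, symmetric])
  also have "expectation (\<lambda>\<omega>. p T \<omega> * Y \<omega>) + expectation (\<lambda>\<omega>. LBINT s:{t..T}. ?w s \<omega>)
      = expectation (\<lambda>\<omega>. p T \<omega> * Y \<omega> + (LBINT s:{t..T}. ?w s \<omega>))"
  proof (rule Bochner_Integration.integral_add[OF pY, symmetric])
    show "integrable M (\<lambda>\<omega>. LBINT s:{t..T}. ?w s \<omega>)"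
      by (rule expectation_set_integral_swap(1)[OF w_meas t'(2) wb])
  qed
  also have "\<dots> = expectation (\<lambda>\<omega>. exp (- r * (T - t)) * h (X x t T \<omega>) * weight k x t T \<omega>
      + (LBINT s:{t..T}. exp (- r * (s - t))
          * (f (X x t s \<omega>) s + k (X x t s \<omega>) s * v (X x t s \<omega>) s) * weight k x t s \<omega>))"
  proof (rule Bochner_Integration.integral_cong[OF refl])
    fix \<omega> assume \<omega>: "\<omega> \<in> space M"
    let ?e = "\<lambda>s. exp (- r * (s - t)) * f (X x t s \<omega>) s"
    let ?d = "\<lambda>s. p s \<omega> * ?e s - \<rho> s \<omega> * \<Phi> s \<omega>"
    have \<Phi>d: "((\<lambda>s. \<Phi> s \<omega>) has_real_derivative ?e s) (at s within {t..T})" if "s \<in> {t..T}" for s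
      unfolding \<Phi>_def by (rule set_integral_has_real_derivative[OF running_continuous[OF f \<omega>] that])
    have \<Phi>c: "continuous_on {t..T} (\<lambda>s. \<Phi> s \<omega>)" using \<Phi>d by (rule DERIV_continuous_on)
    have pc: "continuous_on {t..T} (\<lambda>s. p s \<omega>)" unfolding p_def by (rule weight_continuous[OF k \<omega>])
    have \<rho>c: "continuous_on {t..T} (\<lambda>s. \<rho> s \<omega>)"
      unfolding \<rho>_def by (intro continuous_intros intensity_continuous[OF k \<omega>] pc)
    have ec: "continuous_on {t..T} ?e" by (rule running_continuous[OF f \<omega>])
    have vc: "continuous_on {t..T} (\<lambda>s. v (X x t s \<omega>) s)" by (rule intensity_continuous[OF v \<omega>])
    have wc: "continuous_on {t..T} (\<lambda>s. ?w s \<omega>)"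
      by (intro continuous_intros \<rho>c \<Phi>c vc)
    have dc: "continuous_on {t..T} ?d" by (intro continuous_on_diff continuous_on_mult pc ec \<rho>c \<Phi>c)
    have "(LBINT s:{t..T}. ?d s) = p T \<omega> * \<Phi> T \<omega> - p t \<omega> * \<Phi> t \<omega>"
    proof (rule set_integral_FTC[OF t'(2) _ dc])
      show "((\<lambda>s. p s \<omega> * \<Phi> s \<omega>) has_real_derivative ?d s) (at s within {t..T})" if "s \<in> {t..T}" for s
        using DERIV_mult[OF weight_derivative[OF k \<omega> that, of x] \<Phi>d[OF that]]
        by (simp add: p_def \<rho>_def algebra_simps)
    qed
    moreover have "\<Phi> t \<omega> = 0" by (simp add: \<Phi>_def)
    ultimately have d: "(LBINT s:{t..T}. ?d s) = p T \<omega> * \<Phi> T \<omega>" by simp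
    note di = borel_integrable_atLeastAtMost'[OF dc] and wi = borel_integrable_atLeastAtMost'[OF wc]
    have "p T \<omega> * \<Phi> T \<omega> + (LBINT s:{t..T}. ?w s \<omega>) = (LBINT s:{t..T}. ?d s + ?w s \<omega>)"
      unfolding set_integral_add(2)[OF di wi] d ..
    also have "\<dots> = (LBINT s:{t..T}. exp (- r * (s - t))
          * (f (X x t s \<omega>) s + k (X x t s \<omega>) s * v (X x t s \<omega>) s) * weight k x t s \<omega>)"
      by (rule set_lebesgue_integral_cong) (auto simp: p_def \<rho>_def algebra_simps)
    finally have *: "p T \<omega> * \<Phi> T \<omega> + (LBINT s:{t..T}. ?w s \<omega>) = \<dots>" .
    have "p T \<omega> * Y \<omega> = exp (- r * (T - t)) * h (X x t T \<omega>) * p T \<omega> + p T \<omega> * \<Phi> T \<omega>"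
      unfolding Y_def pay_def \<Phi>_def by (simp only: algebra_simps)
    then show "p T \<omega> * Y \<omega> + (LBINT s:{t..T}. ?w s \<omega>)
        = exp (- r * (T - t)) * h (X x t T \<omega>) * weight k x t T \<omega>
        + (LBINT s:{t..T}. exp (- r * (s - t))
          * (f (X x t s \<omega>) s + k (X x t s \<omega>) s * v (X x t s \<omega>) s) * weight k x t s \<omega>)"
      unfolding *[symmetric] by (simp only: p_def add.assoc)
  qed
  finally show ?thesis .
qed

end

section \<open>The Gaussian kernel and moments of Brownian increments\<close>

text \<open>
  The density as a single exponential, which can be differentiated in the variance.
\<close>

lemma normal_density_exp_form:
  assumes "0 < \<sigma>" "0 < \<tau>"
  shows "normal_density \<mu> (\<sigma> * sqrt \<tau>) y
    = exp (- ln (2 * pi * \<sigma>\<^sup>2 * \<tau>) / 2 - (y - \<mu>)\<^sup>2 / (2 * \<sigma>\<^sup>2 * \<tau>))"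
proof -
  have v: "(\<sigma> * sqrt \<tau>)\<^sup>2 = \<sigma>\<^sup>2 * \<tau>" using assms by (simp add: power_mult_distrib)
  have p: "0 < 2 * pi * \<sigma>\<^sup>2 * \<tau>" using assms by simp
  have "exp (- ln (2 * pi * \<sigma>\<^sup>2 * \<tau>) / 2) = inverse (exp (ln (sqrt (2 * pi * \<sigma>\<^sup>2 * \<tau>))))"
    using p by (simp add: ln_sqrt exp_minus)
  also have "\<dots> = 1 / sqrt (2 * pi * \<sigma>\<^sup>2 * \<tau>)" using p by (simp add: inverse_eq_divide)
  finally show ?thesis unfolding normal_density_def v exp_diff
    by (simp add: exp_minus mult.assoc inverse_eq_divide)
qed

text \<open>
  The density at \<open>y\<close>, a time \<open>\<tau>\<close> after the start in \<open>x\<close>, of Brownian motion with drift \<open>b\<close> and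
  volatility \<open>\<sigma>\<close>.
\<close>

definition gauss :: "real \<Rightarrow> real \<Rightarrow> real \<Rightarrow> real \<Rightarrow> real \<Rightarrow> real" where
  "gauss \<sigma> b x \<tau> y = normal_density (x + b * \<tau>) (\<sigma> * sqrt \<tau>) y"

lemma gauss_exp:
  assumes "0 < \<sigma>" "0 < \<tau>"
  shows "gauss \<sigma> b x \<tau> y = exp (- ln (2 * pi * \<sigma>\<^sup>2 * \<tau>) / 2 - (y - x - b * \<tau>)\<^sup>2 / (2 * \<sigma>\<^sup>2 * \<tau>))"
  unfolding gauss_def normal_density_exp_form[OF assms] by (simp add: algebra_simps)

lemma gauss_deriv_space:
  assumes "0 < \<sigma>" "0 < \<tau>"
  shows "((\<lambda>y. gauss \<sigma> b x \<tau> y) has_real_derivative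
    - ((y - x - b * \<tau>) / (\<sigma>\<^sup>2 * \<tau>)) * gauss \<sigma> b x \<tau> y) (at y within S)"
  unfolding gauss_exp[OF assms] using assms
  by (auto intro!: derivative_eq_intros simp: field_simps)

lemma gauss_deriv_space2:
  assumes "0 < \<sigma>" "0 < \<tau>"
  shows "((\<lambda>y. - ((y - x - b * \<tau>) / (\<sigma>\<^sup>2 * \<tau>)) * gauss \<sigma> b x \<tau> y) has_real_derivative
    (((y - x - b * \<tau>) / (\<sigma>\<^sup>2 * \<tau>))\<^sup>2 - 1 / (\<sigma>\<^sup>2 * \<tau>)) * gauss \<sigma> b x \<tau> y) (at y within S)"
proof -
  have "((\<lambda>y. - ((y - x - b * \<tau>) / (\<sigma>\<^sup>2 * \<tau>))) has_real_derivative - 1 / (\<sigma>\<^sup>2 * \<tau>)) (at y within S)"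
    using assms by (auto intro!: derivative_eq_intros simp: field_simps)
  from DERIV_mult[OF this gauss_deriv_space[OF assms, of b x y S]] show ?thesis
  proof (rule DERIV_cong)
    have "- 1 / v * G + - w * G * - w = (w\<^sup>2 - 1 / v) * G" for v w G :: real
      by (simp add: algebra_simps power2_eq_square)
    then show "- 1 / (\<sigma>\<^sup>2 * \<tau>) * gauss \<sigma> b x \<tau> y
        + - ((y - x - b * \<tau>) / (\<sigma>\<^sup>2 * \<tau>)) * gauss \<sigma> b x \<tau> y * - ((y - x - b * \<tau>) / (\<sigma>\<^sup>2 * \<tau>))
        = (((y - x - b * \<tau>) / (\<sigma>\<^sup>2 * \<tau>))\<^sup>2 - 1 / (\<sigma>\<^sup>2 * \<tau>)) * gauss \<sigma> b x \<tau> y" .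
  qed
qed

text \<open>
  The forward equation \<open>\<partial>\<^sub>s G = \<sigma>\<^sup>2/2 \<partial>\<^sub>y\<^sub>y G - b \<partial>\<^sub>y G\<close>, with the space derivatives written out.
\<close>

lemma gauss_deriv_time:
  assumes \<sigma>: "0 < \<sigma>" and ts: "t < s"
  shows "((\<lambda>s. gauss \<sigma> b x (s - t) y) has_real_derivative
    (\<sigma>\<^sup>2 / 2 * ((((y - x - b * (s - t)) / (\<sigma>\<^sup>2 * (s - t)))\<^sup>2 - 1 / (\<sigma>\<^sup>2 * (s - t))) * gauss \<sigma> b x (s - t) y)
      - b * (- ((y - x - b * (s - t)) / (\<sigma>\<^sup>2 * (s - t))) * gauss \<sigma> b x (s - t) y))) (at s)"
proof -
  define g where "g s = - ln (2 * pi * \<sigma>\<^sup>2 * (s - t)) / 2 - (y - x - b * (s - t))\<^sup>2 / (2 * \<sigma>\<^sup>2 * (s - t))" for s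
  define z where "z = y - x - b * (s - t)"
  define \<tau> where "\<tau> = s - t"
  have \<tau>: "0 < \<tau>" "\<tau> \<noteq> 0" "\<sigma> \<noteq> 0" using ts \<sigma> by (auto simp: \<tau>_def)
  have d1: "((\<lambda>s. ln (2 * pi * \<sigma>\<^sup>2 * (s - t))) has_real_derivative 1 / \<tau>) (at s)"
    using ts \<sigma> by (auto intro!: derivative_eq_intros simp: \<tau>_def field_simps)
  have d2: "((\<lambda>s. (y - x - b * (s - t))\<^sup>2) has_real_derivative - 2 * b * z) (at s)"
    by (auto intro!: derivative_eq_intros simp: z_def)
  have d3: "((\<lambda>s. 2 * \<sigma>\<^sup>2 * (s - t)) has_real_derivative 2 * \<sigma>\<^sup>2) (at s)"
    by (auto intro!: derivative_eq_intros)
  have "(g has_real_derivative - (1 / \<tau>) / 2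
      - ((- 2 * b * z) * (2 * \<sigma>\<^sup>2 * \<tau>) - z\<^sup>2 * (2 * \<sigma>\<^sup>2)) / ((2 * \<sigma>\<^sup>2 * \<tau>) * (2 * \<sigma>\<^sup>2 * \<tau>))) (at s)"
    unfolding g_def z_def \<tau>_def
    using DERIV_divide[OF d2 d3] d1 ts \<sigma>
    by (intro DERIV_diff DERIV_cdivide DERIV_minus) (auto simp: z_def \<tau>_def)
  also have "- (1 / \<tau>) / 2 - ((- 2 * b * z) * (2 * \<sigma>\<^sup>2 * \<tau>) - z\<^sup>2 * (2 * \<sigma>\<^sup>2)) / ((2 * \<sigma>\<^sup>2 * \<tau>) * (2 * \<sigma>\<^sup>2 * \<tau>))
      = \<sigma>\<^sup>2 / 2 * ((z / (\<sigma>\<^sup>2 * \<tau>))\<^sup>2 - 1 / (\<sigma>\<^sup>2 * \<tau>)) + b * (z / (\<sigma>\<^sup>2 * \<tau>))"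
    using \<tau> by (simp add: field_simps power2_eq_square)
  finally have g: "(g has_real_derivative \<sigma>\<^sup>2 / 2 * ((z / (\<sigma>\<^sup>2 * \<tau>))\<^sup>2 - 1 / (\<sigma>\<^sup>2 * \<tau>)) + b * (z / (\<sigma>\<^sup>2 * \<tau>))) (at s)" .
  have e: "((\<lambda>s. exp (g s)) has_real_derivative
      exp (g s) * (\<sigma>\<^sup>2 / 2 * ((z / (\<sigma>\<^sup>2 * \<tau>))\<^sup>2 - 1 / (\<sigma>\<^sup>2 * \<tau>)) + b * (z / (\<sigma>\<^sup>2 * \<tau>)))) (at s)"
    using DERIV_chain2[OF DERIV_exp g] .
  have eq: "gauss \<sigma> b x (s' - t) y = exp (g s')" if "t < s'" for s'
    using that unfolding g_def by (subst gauss_exp[OF \<sigma>]) (auto simp: algebra_simps)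
  have "((\<lambda>s. gauss \<sigma> b x (s - t) y) has_real_derivative
      exp (g s) * (\<sigma>\<^sup>2 / 2 * ((z / (\<sigma>\<^sup>2 * \<tau>))\<^sup>2 - 1 / (\<sigma>\<^sup>2 * \<tau>)) + b * (z / (\<sigma>\<^sup>2 * \<tau>)))) (at s)"
    by (rule has_field_derivative_transform_within_open[OF e, of "{t<..}"]) (use ts eq in auto)
  moreover have L: "G * (c * (w\<^sup>2 - v) + b * w) = c * ((w\<^sup>2 - v) * G) - b * (- w * G)" for G c v w :: real
    by (simp add: algebra_simps)
  ultimately show ?thesis unfolding eq[OF ts, symmetric] z_def \<tau>_def by - (rule DERIV_cong, assumption, rule L)
qed

context brownian_motion begin

lemma increment_moments:
  assumes st: "0 \<le> s" "s < t"
  shows "integrable M (\<lambda>\<omega>. (W t \<omega> - W s \<omega>)\<^sup>2)" "expectation (\<lambda>\<omega>. (W t \<omega> - W s \<omega>)\<^sup>2) = t - s"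
    "integrable M (\<lambda>\<omega>. W t \<omega> - W s \<omega>)" "expectation (\<lambda>\<omega>. W t \<omega> - W s \<omega>) = 0"
proof -
  note D = normal_increments[OF st]
  have p: "0 < sqrt (t - s)" using st by simp
  have m2: "has_bochner_integral lborel (\<lambda>x. normal_density 0 (sqrt (t - s)) x * x\<^sup>2) (t - s)"
    using normal_moment_even[OF p, of 0 1] st by (simp add: diff_divide_distrib)
  have m1: "has_bochner_integral lborel (\<lambda>x. normal_density 0 (sqrt (t - s)) x * x) 0"
    using normal_moment_nz_1[OF p, of 0] by simp
  show "integrable M (\<lambda>\<omega>. (W t \<omega> - W s \<omega>)\<^sup>2)"
    using distributed_integrable[OF D, of "\<lambda>x. x\<^sup>2"] m2 by (auto dest: integrable.intros)
  show "expectation (\<lambda>\<omega>. (W t \<omega> - W s \<omega>)\<^sup>2) = t - s"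
    using distributed_integral[OF D, of "\<lambda>x. x\<^sup>2"] has_bochner_integral_integral_eq[OF m2] by simp
  show "integrable M (\<lambda>\<omega>. W t \<omega> - W s \<omega>)"
    using distributed_integrable[OF D, of "\<lambda>x. x"] m1 by (auto dest: integrable.intros)
  show "expectation (\<lambda>\<omega>. W t \<omega> - W s \<omega>) = 0"
    using distributed_integral[OF D, of "\<lambda>x. x"] has_bochner_integral_integral_eq[OF m1] by simp
qed

lemma increment_exp_moments:
  assumes st: "0 \<le> s" "s < t"
  shows "integrable M (\<lambda>\<omega>. exp (a * (W t \<omega> - W s \<omega>)))"
    "expectation (\<lambda>\<omega>. exp (a * (W t \<omega> - W s \<omega>))) = exp (a\<^sup>2 * (t - s) / 2)"
    "integrable M (\<lambda>\<omega>. (W t \<omega> - W s \<omega>) * exp (a * (W t \<omega> - W s \<omega>)))"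
    "expectation (\<lambda>\<omega>. (W t \<omega> - W s \<omega>) * exp (a * (W t \<omega> - W s \<omega>))) = a * (t - s) * exp (a\<^sup>2 * (t - s) / 2)"
proof -
  note D = normal_increments[OF st]
  define \<tau> where "\<tau> = t - s"
  have \<tau>: "0 < \<tau>" "0 < sqrt \<tau>" using st by (auto simp: \<tau>_def)
  \<comment> \<open>Exponential tilting shifts the mean of a Gaussian density.\<close>
  have tilt: "normal_density 0 (sqrt \<tau>) x * exp (a * x)
      = exp (a\<^sup>2 * \<tau> / 2) * normal_density (a * \<tau>) (sqrt \<tau>) x" for x
  proof -
    have "- x\<^sup>2 / (2 * \<tau>) + a * x = a\<^sup>2 * \<tau> / 2 - (x - a * \<tau>)\<^sup>2 / (2 * \<tau>)"
      using \<tau> by (simp add: field_simps power2_eq_square)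
    then have "exp (- x\<^sup>2 / (2 * \<tau>)) * exp (a * x) = exp (a\<^sup>2 * \<tau> / 2) * exp (- (x - a * \<tau>)\<^sup>2 / (2 * \<tau>))"
      by (simp add: exp_add[symmetric])
    then show ?thesis using \<tau> by (simp add: normal_density_def mult.commute)
  qed
  have m0: "has_bochner_integral lborel (\<lambda>x. normal_density 0 (sqrt \<tau>) x * exp (a * x)) (exp (a\<^sup>2 * \<tau> / 2))"
    unfolding tilt using has_bochner_integral_mult_right[OF
        has_bochner_integral_integrable[OF integrable_normal_density[OF \<tau>(2)]], of "exp (a\<^sup>2 * \<tau> / 2)"]
    by (simp add: integral_normal_density[OF \<tau>(2)])
  have m1: "has_bochner_integral lborel (\<lambda>x. normal_density 0 (sqrt \<tau>) x * (x * exp (a * x)))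
      (exp (a\<^sup>2 * \<tau> / 2) * (a * \<tau>))"
  proof -
    have "has_bochner_integral lborel (\<lambda>x. exp (a\<^sup>2 * \<tau> / 2) * (normal_density (a * \<tau>) (sqrt \<tau>) x * x))
        (exp (a\<^sup>2 * \<tau> / 2) * (a * \<tau>))"
      by (rule has_bochner_integral_mult_right) (use normal_moment_nz_1[OF \<tau>(2)] in auto)
    also have "(\<lambda>x. exp (a\<^sup>2 * \<tau> / 2) * (normal_density (a * \<tau>) (sqrt \<tau>) x * x))
        = (\<lambda>x. normal_density 0 (sqrt \<tau>) x * (x * exp (a * x)))"
    proof
      fix x show "exp (a\<^sup>2 * \<tau> / 2) * (normal_density (a * \<tau>) (sqrt \<tau>) x * x)
          = normal_density 0 (sqrt \<tau>) x * (x * exp (a * x))"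
        using tilt[of x] by (metis mult.assoc mult.commute)
    qed
    finally show ?thesis .
  qed
  show "integrable M (\<lambda>\<omega>. exp (a * (W t \<omega> - W s \<omega>)))"
    using distributed_integrable[OF D, of "\<lambda>x. exp (a * x)"] m0 by (auto simp: \<tau>_def dest: integrable.intros)
  show "expectation (\<lambda>\<omega>. exp (a * (W t \<omega> - W s \<omega>))) = exp (a\<^sup>2 * (t - s) / 2)"
    using distributed_integral[OF D, of "\<lambda>x. exp (a * x)"] has_bochner_integral_integral_eq[OF m0]
    by (simp add: \<tau>_def)
  show "integrable M (\<lambda>\<omega>. (W t \<omega> - W s \<omega>) * exp (a * (W t \<omega> - W s \<omega>)))"
    using distributed_integrable[OF D, of "\<lambda>x. x * exp (a * x)"] m1 by (auto simp: \<tau>_def dest: integrable.intros)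
  show "expectation (\<lambda>\<omega>. (W t \<omega> - W s \<omega>) * exp (a * (W t \<omega> - W s \<omega>))) = a * (t - s) * exp (a\<^sup>2 * (t - s) / 2)"
    using distributed_integral[OF D, of "\<lambda>x. x * exp (a * x)"] has_bochner_integral_integral_eq[OF m1]
    by (simp add: \<tau>_def mult.commute)
qed

lemma increment_abs_moment:
  assumes st: "0 \<le> s" "s < t"
  shows "integrable M (\<lambda>\<omega>. \<bar>W t \<omega> - W s \<omega>\<bar>)" "expectation (\<lambda>\<omega>. \<bar>W t \<omega> - W s \<omega>\<bar>) \<le> sqrt (t - s)"
proof -
  show i: "integrable M (\<lambda>\<omega>. \<bar>W t \<omega> - W s \<omega>\<bar>)" using increment_moments(3)[OF st] by simp
  define c where "c = sqrt (t - s)"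
  have c: "0 < c" "t - s = c * c" using st by (auto simp: c_def)
  have "expectation (\<lambda>\<omega>. \<bar>W t \<omega> - W s \<omega>\<bar>) \<le> expectation (\<lambda>\<omega>. (W t \<omega> - W s \<omega>)\<^sup>2 * (1 / (2 * c)) + c / 2)"
  proof (rule integral_mono[OF i])
    show "integrable M (\<lambda>\<omega>. (W t \<omega> - W s \<omega>)\<^sup>2 * (1 / (2 * c)) + c / 2)"
      using increment_moments(1)[OF st] by (intro Bochner_Integration.integrable_add integrable_mult_left) auto
    fix \<omega>
    define d where "d = \<bar>W t \<omega> - W s \<omega>\<bar>"
    have "0 \<le> (d - c)\<^sup>2" by simp
    then have "2 * (d * c) \<le> d\<^sup>2 + c * c" by (simp add: power2_eq_square algebra_simps)
    then have "d \<le> d\<^sup>2 * (1 / (2 * c)) + c / 2" using c(1) by (simp add: field_simps power2_eq_square)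
    then show "\<bar>W t \<omega> - W s \<omega>\<bar> \<le> (W t \<omega> - W s \<omega>)\<^sup>2 * (1 / (2 * c)) + c / 2" by (simp add: d_def)
  qed
  also have "\<dots> = c * c * (1 / (2 * c)) + c / 2"
    using increment_moments(1,2)[OF st] by (simp add: prob_space c(2))
  also have "\<dots> = c" using c by (simp add: field_simps)
  finally show "expectation (\<lambda>\<omega>. \<bar>W t \<omega> - W s \<omega>\<bar>) \<le> sqrt (t - s)" by (simp add: c_def)
qed

end

section \<open>Bounded classical solutions are mild\<close>

text \<open>
  The cutoff \<open>(1 - (y/m)\<^sup>2)\<^sup>2\<close> on \<open>[-m, m]\<close> and its first two derivatives. It vanishes to first order at
  \<open>\<plusminus>m\<close>, so integrating by parts twice over \<open>[-m, m]\<close> leaves no boundary terms.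
\<close>

definition cut :: "real \<Rightarrow> real \<Rightarrow> real" where "cut m y = (1 - (y / m)\<^sup>2)\<^sup>2"
definition cut1 :: "real \<Rightarrow> real \<Rightarrow> real" where "cut1 m y = - 4 * (y / m\<^sup>2) * (1 - (y / m)\<^sup>2)"
definition cut2 :: "real \<Rightarrow> real \<Rightarrow> real" where
  "cut2 m y = 8 * (y / m\<^sup>2)\<^sup>2 - 4 / m\<^sup>2 * (1 - (y / m)\<^sup>2)"

lemma cut_deriv: "m \<noteq> 0 \<Longrightarrow> (cut m has_real_derivative cut1 m y) (at y within S)"
  unfolding cut_def[abs_def] cut1_def
  by (rule derivative_eq_intros refl | simp)+ (simp add: field_simps power2_eq_square)

lemma cut1_deriv: "m \<noteq> 0 \<Longrightarrow> (cut1 m has_real_derivative cut2 m y) (at y within S)"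
  unfolding cut1_def[abs_def] cut2_def
  by (rule derivative_eq_intros refl | simp)+ (simp add: field_simps power2_eq_square power4_eq_xxxx)

lemma cut_boundary: "m \<noteq> 0 \<Longrightarrow> cut m m = 0" "m \<noteq> 0 \<Longrightarrow> cut m (- m) = 0"
  "m \<noteq> 0 \<Longrightarrow> cut1 m m = 0" "m \<noteq> 0 \<Longrightarrow> cut1 m (- m) = 0"
  by (auto simp: cut_def cut1_def)

lemma cut_bounds:
  assumes m: "1 \<le> m" and y: "y \<in> {- m..m}"
  shows "\<bar>cut m y\<bar> \<le> 1" "\<bar>cut1 m y\<bar> \<le> 4" "\<bar>cut2 m y\<bar> \<le> 12"
proof -
  have "\<bar>y / m\<bar> \<le> 1" using assms by (auto simp: abs_le_iff field_simps)
  then have q: "0 \<le> (y / m)\<^sup>2" "(y / m)\<^sup>2 \<le> 1" by (auto simp: abs_square_le_1)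
  then have q1: "\<bar>1 - (y / m)\<^sup>2\<bar> \<le> 1" by simp
  show "\<bar>cut m y\<bar> \<le> 1" unfolding cut_def using q1 by (simp add: abs_square_le_1)
  have i: "\<bar>1 / m\<bar> \<le> 1" using m by simp
  have "\<bar>y / m\<^sup>2\<bar> = \<bar>y / m\<bar> * \<bar>1 / m\<bar>" using m by (simp add: power2_eq_square abs_mult)
  also have "\<dots> \<le> 1 * 1" by (intro mult_mono \<open>\<bar>y / m\<bar> \<le> 1\<close> i) auto
  finally have ym: "\<bar>y / m\<^sup>2\<bar> \<le> 1" by simp
  have "\<bar>cut1 m y\<bar> = 4 * (\<bar>y / m\<^sup>2\<bar> * \<bar>1 - (y / m)\<^sup>2\<bar>)" unfolding cut1_def by (simp add: abs_mult)
  also have "\<dots> \<le> 4 * (1 * 1)" by (intro mult_left_mono mult_mono ym q1) auto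
  finally show "\<bar>cut1 m y\<bar> \<le> 4" by simp
  have "\<bar>8 * (y / m\<^sup>2)\<^sup>2\<bar> \<le> 8" using ym by (simp add: abs_mult abs_square_le_1)
  moreover have "\<bar>4 / m\<^sup>2 * (1 - (y / m)\<^sup>2)\<bar> \<le> 4 * 1"
  proof -
    have "\<bar>4 / m\<^sup>2\<bar> \<le> 4" using m by (simp add: field_simps power2_eq_square mult_ge1_I)
    then show ?thesis unfolding abs_mult by (intro mult_mono q1) auto
  qed
  ultimately show "\<bar>cut2 m y\<bar> \<le> 12"
    unfolding cut2_def by (intro order_trans[OF abs_triangle_ineq4]) simp
qed

lemma cut_limits:
  "(\<lambda>n. cut (real (Suc n)) y) \<longlonglongrightarrow> 1" "(\<lambda>n. cut1 (real (Suc n)) y) \<longlonglongrightarrow> 0"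
  "(\<lambda>n. cut2 (real (Suc n)) y) \<longlonglongrightarrow> 0"
proof -
  have i: "(\<lambda>n. inverse (real (Suc n))) \<longlonglongrightarrow> 0" by (rule LIMSEQ_inverse_real_of_nat)
  have a: "(\<lambda>n. y * inverse (real (Suc n))) \<longlonglongrightarrow> 0" using tendsto_mult_right_zero[OF i] .
  have b: "(\<lambda>n. y * (inverse (real (Suc n)))\<^sup>2) \<longlonglongrightarrow> y * 0\<^sup>2"
    by (intro tendsto_intros i)
  have "(\<lambda>n. (1 - (y * inverse (real (Suc n)))\<^sup>2)\<^sup>2) \<longlonglongrightarrow> (1 - 0\<^sup>2)\<^sup>2"
    by (intro tendsto_intros a)
  then show "(\<lambda>n. cut (real (Suc n)) y) \<longlonglongrightarrow> 1" by (simp add: cut_def divide_inverse)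
  have "(\<lambda>n. - 4 * (y * (inverse (real (Suc n)))\<^sup>2) * (1 - (y * inverse (real (Suc n)))\<^sup>2)) \<longlonglongrightarrow> - 4 * (y * 0\<^sup>2) * (1 - 0\<^sup>2)"
    by (intro tendsto_intros a b)
  then show "(\<lambda>n. cut1 (real (Suc n)) y) \<longlonglongrightarrow> 0"
    by (simp add: cut1_def divide_inverse power_inverse)
  have "(\<lambda>n. 8 * (y * (inverse (real (Suc n)))\<^sup>2)\<^sup>2 - 4 * (inverse (real (Suc n)))\<^sup>2 * (1 - (y * inverse (real (Suc n)))\<^sup>2))
      \<longlonglongrightarrow> 8 * (y * 0\<^sup>2)\<^sup>2 - 4 * 0\<^sup>2 * (1 - 0\<^sup>2)"
    by (intro tendsto_intros a b i)
  then show "(\<lambda>n. cut2 (real (Suc n)) y) \<longlonglongrightarrow> 0"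
    by (simp add: cut2_def divide_inverse power_inverse)
qed

lemma cut_continuous [continuous_intros]:
  assumes "m \<noteq> 0" "continuous_on A g"
  shows "continuous_on A (\<lambda>z. cut m (g z))" "continuous_on A (\<lambda>z. cut1 m (g z))" "continuous_on A (\<lambda>z. cut2 m (g z))"
  unfolding cut_def cut1_def cut2_def using assms by (auto intro!: continuous_intros)

text \<open>
  A bounded function \<open>u\<close>, continuous up to the boundary, that solves \<open>u\<^sub>t + L u + f = 0\<close> in \<open>\<real> \<times> (0,T)\<close>
  and equals \<open>h\<close> at \<open>T\<close>; the representation is proved at the point \<open>(x,t)\<close>. No growth bound on the
  space derivatives of \<open>u\<close> is available.
\<close>

locale classical_solution = gbm_claim +
  fixes u vt vx vxx f :: "real \<Rightarrow> real \<Rightarrow> real" and U x t :: real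
  assumes u_cont: "continuous_on (UNIV \<times> {0..T}) (\<lambda>z. u (fst z) (snd z))"
    and vt_cont: "continuous_on (UNIV \<times> {0<..<T}) (\<lambda>z. vt (fst z) (snd z))"
    and dt: "\<And>y s. s \<in> {0<..<T} \<Longrightarrow> ((\<lambda>s. u y s) has_real_derivative vt y s) (at s)"
    and dx: "\<And>y s. s \<in> {0<..<T} \<Longrightarrow> ((\<lambda>y. u y s) has_real_derivative vx y s) (at y)"
    and dxx: "\<And>y s. s \<in> {0<..<T} \<Longrightarrow> ((\<lambda>y. vx y s) has_real_derivative vxx y s) (at y)"
    and pde: "\<And>y s. s \<in> {0<..<T} \<Longrightarrow>
      vt y s + (\<sigma>\<^sup>2 / 2 * vxx y s + (r - \<sigma>\<^sup>2 / 2) * vx y s - r * u y s) + f y s = 0"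
    and u_bound: "\<And>y s. s \<in> {0..T} \<Longrightarrow> \<bar>u y s\<bar> \<le> U"
    and terminal: "\<And>y. u y T = h y"
    and f_cbf: "cbf f"
    and t_range: "0 \<le> t" "t < T"
begin

abbreviation (input) b where "b \<equiv> r - \<sigma>\<^sup>2 / 2"
abbreviation (input) G where "G s y \<equiv> gauss \<sigma> b x (s - t) y"
abbreviation (input) G1 where "G1 s y \<equiv> - ((y - x - b * (s - t)) / (\<sigma>\<^sup>2 * (s - t))) * G s y"
abbreviation (input) G2 where
  "G2 s y \<equiv> (((y - x - b * (s - t)) / (\<sigma>\<^sup>2 * (s - t)))\<^sup>2 - 1 / (\<sigma>\<^sup>2 * (s - t))) * G s y"

text \<open>
  \<open>Phi m s\<close> is \<open>E [cut m X\<^sub>s e\<^bsup>-r(s-t)\<^esup> u(X\<^sub>s,s)]\<close>, restricted to \<open>\<bar>X\<^sub>s\<bar> \<le> m\<close>, and \<open>J m s\<close> is its time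
  derivative. The integrand \<open>kern\<close> of the latter is what remains after the derivatives of \<open>u\<close> have been moved to the
  density and the cutoff; as \<open>m\<close> grows only \<open>- f\<close> survives.
\<close>

definition kern :: "real \<Rightarrow> real \<Rightarrow> real \<Rightarrow> real" where
  "kern m s y = (y - x - b * (s - t)) / (s - t) * cut1 m y * u y s
     - \<sigma>\<^sup>2 / 2 * cut2 m y * u y s + b * cut1 m y * u y s - cut m y * f y s"

definition J :: "real \<Rightarrow> real \<Rightarrow> real" where
  "J m s = expectation (\<lambda>\<omega>. indicator {-m..m} (X x t s \<omega>) * (exp (- r * (s - t)) * kern m s (X x t s \<omega>)))"

definition Phi :: "real \<Rightarrow> real \<Rightarrow> real" where
  "Phi m s = expectation (\<lambda>\<omega>. (indicator {-m..m} (X x t s \<omega>) * cut m (X x t s \<omega>))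
     * (exp (- r * (s - t)) * u (X x t s \<omega>) s))"

lemma U_nonneg: "0 \<le> U"
  using u_bound[of 0 0] T_pos by simp

lemma X_distributed:
  assumes "t < s" shows "distributed M lborel (X x t s) (\<lambda>y. ennreal (G s y))"
proof -
  have D: "distributed M lborel (\<lambda>\<omega>. W s \<omega> - W t \<omega>) (normal_density 0 (sqrt (s - t)))"
    by (rule normal_increments) (use assms t_range in auto)
  have "distributed M lborel (\<lambda>\<omega>. (x + b * (s - t)) + \<sigma> * (W s \<omega> - W t \<omega>))
      (normal_density ((x + b * (s - t)) + \<sigma> * 0) (\<bar>\<sigma>\<bar> * sqrt (s - t)))"
    by (rule normal_density_affine[OF D]) (use assms sig_pos in auto)
  moreover have "(\<lambda>\<omega>. (x + b * (s - t)) + \<sigma> * (W s \<omega> - W t \<omega>)) = X x t s"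
    using assms t_range by (auto simp: X_def)
  ultimately show ?thesis using sig_pos by (simp add: gauss_def)
qed

lemma u_compose_continuous:
  assumes "continuous_on A p" "continuous_on A q" "\<And>z. z \<in> A \<Longrightarrow> q z \<in> {0..T}"
  shows "continuous_on A (\<lambda>z. u (p z) (q z))"
proof -
  have "continuous_on A (\<lambda>z. (\<lambda>p. u (fst p) (snd p)) (p z, q z))"
    by (rule continuous_on_compose2[OF u_cont]) (use assms in \<open>auto intro!: continuous_on_Pair\<close>)
  then show ?thesis by simp
qed

lemma vt_compose_continuous:
  assumes "continuous_on A p" "continuous_on A q" "\<And>z. z \<in> A \<Longrightarrow> q z \<in> {0<..<T}"
  shows "continuous_on A (\<lambda>z. vt (p z) (q z))"
proof -
  have "continuous_on A (\<lambda>z. (\<lambda>p. vt (fst p) (snd p)) (p z, q z))"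
    by (rule continuous_on_compose2[OF vt_cont]) (use assms in \<open>auto intro!: continuous_on_Pair\<close>)
  then show ?thesis by simp
qed

lemma u_slice_continuous: "s \<in> {0..T} \<Longrightarrow> continuous_on A (\<lambda>y. u y s)"
  by (rule u_compose_continuous) (auto intro!: continuous_intros)

lemma u_slice_measurable: "s \<in> {0..T} \<Longrightarrow> (\<lambda>y. u y s) \<in> borel_measurable borel"
  by (rule borel_measurable_continuous_onI) (rule u_slice_continuous)

lemma f_slice_measurable [measurable]: "(\<lambda>y. f y s) \<in> borel_measurable borel"
  by (rule cbf_measurable[OF f_cbf]) simp_all

lemma cut_measurable [measurable]: "m \<noteq> 0 \<Longrightarrow> cut m \<in> borel_measurable borel"
    "m \<noteq> 0 \<Longrightarrow> cut1 m \<in> borel_measurable borel" "m \<noteq> 0 \<Longrightarrow> cut2 m \<in> borel_measurable borel"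
  by (auto intro!: borel_measurable_continuous_onI continuous_intros)

lemma kern_measurable:
  assumes "m \<noteq> 0" "s \<in> {0..T}" shows "kern m s \<in> borel_measurable borel"
  using u_slice_measurable[OF assms(2)] cut_measurable[OF assms(1)]
  unfolding kern_def[abs_def] by measurable

lemma gauss_continuous:
  assumes "\<And>z. z \<in> A \<Longrightarrow> t < p z" "continuous_on A p" "continuous_on A q"
  shows "continuous_on A (\<lambda>z. G (p z) (q z))"
proof -
  have "continuous_on A (\<lambda>z. exp (- ln (2 * pi * \<sigma>\<^sup>2 * (p z - t)) / 2
      - (q z - x - b * (p z - t))\<^sup>2 / (2 * \<sigma>\<^sup>2 * (p z - t))))"
    using assms sig_pos by (intro continuous_intros) force+
  then show ?thesis
    by (rule continuous_on_eq) (use assms sig_pos in \<open>auto simp: gauss_exp\<close>)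
qed

text \<open>
  Differentiate under the integral, insert the equation for \<open>u\<close> and the forward equation for the
  density, and integrate by parts.
\<close>

lemma Phi_derivative:
  assumes s: "s \<in> {t<..<T}" and m: "0 < m"
  shows "(Phi m has_real_derivative J m s) (at s)"
proof -
  have m0: "m \<noteq> 0" using m by simp
  have expect_box: "expectation (\<lambda>\<omega>. indicator {-m..m} (X x t s \<omega>) * g (X x t s \<omega>))
      = integral {-m..m} (\<lambda>y. G s y * g y)"
    if s: "s \<in> {t<..<T}" and g: "continuous_on {-m..m} g" "g \<in> borel_measurable borel"
    for s and g :: "real \<Rightarrow> real"
  proof -
    have "expectation (\<lambda>\<omega>. indicator {-m..m} (X x t s \<omega>) * g (X x t s \<omega>))
        = (\<integral>y. G s y * (indicator {-m..m} y * g y) \<partial>lborel)"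
      by (rule distributed_integral[symmetric, OF X_distributed])
        (use s g(2) in \<open>auto simp: gauss_def intro!: borel_measurable_times\<close>)
    also have "\<dots> = (LBINT y:{-m..m}. G s y * g y)"
      unfolding set_lebesgue_integral_def
      by (rule Bochner_Integration.integral_cong) (auto simp: indicator_def)
    also have "\<dots> = integral {-m..m} (\<lambda>y. G s y * g y)"
      using s by (intro set_integral_eq_integral_continuous continuous_intros g gauss_continuous) auto
    finally show ?thesis .
  qed
  let ?e = "\<lambda>s. exp (- r * (s - t))"
  let ?P = "\<lambda>s y. G s y * (cut m y * (?e s * u y s))"
  let ?Gt = "\<lambda>s y. \<sigma>\<^sup>2 / 2 * G2 s y - b * G1 s y"
  let ?fx = "\<lambda>s y. cut m y * ?e s * (?Gt s y * u y s + G s y * vt y s - r * (G s y * u y s))"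
  let ?S = "{t<..<T}"
  have sub: "?S \<subseteq> {0<..<T}" "?S \<subseteq> {0..T}" using t_range by auto
  have Pd: "((\<lambda>s. ?P s y) has_real_derivative ?fx s y) (at s within ?S)" if "s \<in> ?S" for s y
  proof -
    have Gd: "((\<lambda>s. G s y) has_real_derivative ?Gt s y) (at s within ?S)"
      by (rule has_field_derivative_at_within[OF gauss_deriv_time]) (use that sig_pos in auto)
    have ud: "((\<lambda>s. u y s) has_real_derivative vt y s) (at s within ?S)"
      by (rule has_field_derivative_at_within[OF dt]) (use that sub in auto)
    have ed: "(?e has_real_derivative - r * ?e s) (at s within ?S)"
      by (auto intro!: derivative_eq_intros)
    show ?thesis
      by (rule DERIV_cong[OF DERIV_mult[OF Gd DERIV_mult[OF DERIV_const DERIV_mult[OF ed ud]]]])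
        (simp add: algebra_simps del: mult_minus_left mult_minus_right)
  qed
  have uc: "continuous_on (?S \<times> cbox (-m) m) (\<lambda>z. u (snd z) (fst z))"
    by (rule u_compose_continuous) (use sub in \<open>auto intro!: continuous_intros\<close>)
  have vc: "continuous_on (?S \<times> cbox (-m) m) (\<lambda>z. vt (snd z) (fst z))"
    by (rule vt_compose_continuous) (use sub in \<open>auto intro!: continuous_intros\<close>)
  have fxc: "continuous_on (?S \<times> cbox (-m) m) (\<lambda>(s, y). ?fx s y)"
    unfolding case_prod_beta'
    by (intro continuous_intros uc vc gauss_continuous m0) (use sig_pos in auto)
  have Pint: "?P s integrable_on cbox (-m) m" if "s \<in> ?S" for s
    by (rule integrable_continuous, intro continuous_intros gauss_continuous m0 u_slice_continuous)
      (use that sub in auto)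
  have "((\<lambda>s. integral (cbox (-m) m) (?P s)) has_field_derivative integral (cbox (-m) m) (?fx s)) (at s within ?S)"
    by (rule leibniz_rule_field_derivative[OF Pd Pint fxc s]) auto
  then have d: "((\<lambda>s. integral {-m..m} (?P s)) has_real_derivative integral {-m..m} (?fx s)) (at s)"
    using at_within_open[OF s] by simp
  have sub': "s \<in> {0<..<T}" "s \<in> {0..T}" "t < s" using s sub by auto
  \<comment> \<open>The derivative of the flux \<open>?Q\<close> carries all derivatives of \<open>u\<close>; \<open>?Q\<close> vanishes at \<open>\<plusminus>m\<close>.\<close>
  let ?Q = "\<lambda>y. ?e s * (- (\<sigma>\<^sup>2 / 2) * (G s y * cut m y * vx y s - (G1 s y * cut m y + G s y * cut1 m y) * u y s)
      - b * (G s y * cut m y * u y s))"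
  let ?dQ = "\<lambda>y. ?e s * (- (\<sigma>\<^sup>2 / 2) * (G s y * cut m y * vxx y s
        - (G2 s y * cut m y + 2 * (G1 s y * cut1 m y) + G s y * cut2 m y) * u y s)
      - b * (G1 s y * cut m y * u y s + G s y * cut1 m y * u y s + G s y * cut m y * vx y s))"
  have Qd: "(?Q has_real_derivative ?dQ y) (at y within {-m..m})" for y
  proof -
    note g1 = gauss_deriv_space[OF sig_pos, of "s - t" b x y "{-m..m}"]
    note g2 = gauss_deriv_space2[OF sig_pos, of "s - t" x b y "{-m..m}"]
    have p: "0 < s - t" using s by simp
    note k0 = cut_deriv[OF m0, of y "{-m..m}"] and k1 = cut1_deriv[OF m0, of y "{-m..m}"]
    note ux = has_field_derivative_at_within[OF dx[OF sub'(1)], of y "{-m..m}"]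
      and uxx = has_field_derivative_at_within[OF dxx[OF sub'(1)], of y "{-m..m}"]
    have a1: "((\<lambda>y. G s y * cut m y * vx y s) has_real_derivative
        (G1 s y * cut m y + cut1 m y * G s y) * vx y s + vxx y s * (G s y * cut m y)) (at y within {-m..m})"
      by (rule DERIV_mult[OF DERIV_mult[OF g1[OF p] k0] uxx])
    have a2: "((\<lambda>y. (G1 s y * cut m y + G s y * cut1 m y) * u y s) has_real_derivative
        ((G2 s y * cut m y + cut1 m y * G1 s y) + (G1 s y * cut1 m y + cut2 m y * G s y)) * u y s
          + vx y s * (G1 s y * cut m y + G s y * cut1 m y)) (at y within {-m..m})"
      by (rule DERIV_mult[OF DERIV_add[OF DERIV_mult[OF g2[OF p] k0] DERIV_mult[OF g1[OF p] k1]] ux])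
    have a3: "((\<lambda>y. G s y * cut m y * u y s) has_real_derivative
        (G1 s y * cut m y + cut1 m y * G s y) * u y s + vx y s * (G s y * cut m y)) (at y within {-m..m})"
      by (rule DERIV_mult[OF DERIV_mult[OF g1[OF p] k0] ux])
    have alg: "e * (k * (((g1 * c + c1 * g) * p + q * (g * c)) - (((g2 * c + c1 * g1) + (g1 * c1 + c2 * g)) * v
          + p * (g1 * c + g * c1))) - d * ((g1 * c + c1 * g) * v + p * (g * c)))
        = e * (k * (g * c * q - (g2 * c + 2 * (g1 * c1) + g * c2) * v) - d * (g1 * c * v + g * c1 * v + g * c * p))"
      for e k g1 c c1 g p q g2 c2 v d :: real
      by (simp add: algebra_simps)
    show ?thesis
      by (rule DERIV_cong[OF DERIV_cmult[OF DERIV_diff[OF DERIV_cmult[OF DERIV_diff[OF a1 a2]] DERIV_cmult[OF a3]]]])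
        (rule alg)
  qed
  have "(?dQ has_integral ?Q m - ?Q (-m)) {-m..m}"
    by (rule fundamental_theorem_of_calculus)
      (use m Qd in \<open>auto simp: has_real_derivative_iff_has_vector_derivative[symmetric]\<close>)
  then have dQ0: "(?dQ has_integral 0) {-m..m}" using cut_boundary[OF m0] by simp
  have split: "?fx s y - ?dQ y = G s y * (?e s * kern m s y)" for y
  proof -
    define w where "w = (y - x - b * (s - t)) / (\<sigma>\<^sup>2 * (s - t))"
    have kw: "(y - x - b * (s - t)) / (s - t) = \<sigma>\<^sup>2 * w"
      using sig_pos s by (simp add: w_def)
    have vt: "vt y s = - (\<sigma>\<^sup>2 / 2 * vxx y s) - b * vx y s + r * u y s - f y s"
      using pde[OF sub'(1), of y] by simp
    have alg: "c * e * ((k / 2 * g2 - d * (- w * g)) * v + g * (- (k / 2 * q) - d * p + r * v - F) - r * (g * v))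
        - e * (- (k / 2) * (g * c * q - (g2 * c + 2 * (- w * g * c1) + g * c2) * v)
          - d * (- w * g * c * v + g * c1 * v + g * c * p))
      = g * (e * (k * w * c1 * v - k / 2 * c2 * v + d * c1 * v - c * F))"
      for c e k g2 d w g v q p r F c1 c2 :: real
      by (simp add: field_simps)
    show ?thesis unfolding kern_def kw vt w_def[symmetric] by (rule alg)
  qed
  have "(?fx s has_integral integral {-m..m} (?fx s)) {-m..m}"
  proof (rule integrable_integral, rule integrable_continuous_interval)
    have "continuous_on {-m..m} (\<lambda>y. (\<lambda>(s, y). ?fx s y) (s, y))"
      by (rule continuous_on_compose2[OF fxc]) (use s in \<open>auto intro!: continuous_intros\<close>)
    then show "continuous_on {-m..m} (?fx s)" by (simp only: prod.case)
  qed
  from has_integral_diff[OF this dQ0]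
  have "integral {-m..m} (?fx s) = integral {-m..m} (\<lambda>y. G s y * (?e s * kern m s y))"
    unfolding split by (simp add: integral_unique)
  also have "\<dots> = J m s" unfolding J_def
  proof (rule expect_box[OF s, symmetric])
    show "continuous_on {-m..m} (\<lambda>y. ?e s * kern m s y)"
      unfolding kern_def
      by (intro continuous_intros m0 u_slice_continuous cbf_continuous[OF f_cbf]) (use s sub' in auto)
    show "(\<lambda>y. ?e s * kern m s y) \<in> borel_measurable borel"
      using kern_measurable[OF m0 sub'(2)] by measurable
  qed
  finally have dJ: "((\<lambda>s. integral {-m..m} (?P s)) has_real_derivative J m s) (at s)" using d by simp
  have PhiP: "Phi m s = integral {-m..m} (?P s)" if "s \<in> ?S" for s
  proof -
    have "s \<in> {0..T}" using that sub by auto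
    have "expectation (\<lambda>\<omega>. indicator {-m..m} (X x t s \<omega>) * (cut m (X x t s \<omega>) * (?e s * u (X x t s \<omega>) s)))
        = integral {-m..m} (?P s)"
    proof (rule expect_box[OF that])
      show "continuous_on {-m..m} (\<lambda>y. cut m y * (?e s * u y s))"
        by (intro continuous_intros m0 u_slice_continuous \<open>s \<in> {0..T}\<close>)
      show "(\<lambda>y. cut m y * (?e s * u y s)) \<in> borel_measurable borel"
        using u_slice_measurable[OF \<open>s \<in> {0..T}\<close>] cut_measurable[OF m0] by measurable
    qed
    then show ?thesis unfolding Phi_def by (simp add: mult.assoc)
  qed
  show ?thesis
    by (rule has_field_derivative_transform_within_open[OF dJ _ s]) (auto simp: PhiP)
qed

lemma cut_indicator:
  assumes "0 < m" shows "indicator {-m..m} y * cut m y = (max 0 (1 - (y / m)\<^sup>2))\<^sup>2"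
proof (cases "y \<in> {-m..m}")
  case True
  then have "\<bar>y / m\<bar> \<le> 1" using assms by (auto simp: abs_le_iff field_simps)
  then show ?thesis using True by (simp add: cut_def abs_square_le_1 max_def)
next
  case False
  then have "1 \<le> \<bar>y / m\<bar>" using assms by (auto simp: abs_le_iff field_simps)
  then have "1 \<le> (y / m)\<^sup>2" by (metis abs_ge_zero abs_one abs_square_le_1 nle_le power2_abs abs_le_square_iff one_power2)
  then show ?thesis using False by simp
qed

lemma cutoff_value_bound:
  assumes "1 \<le> m" "s \<in> {t..T}"
  shows "\<bar>(indicator {-m..m} y * cut m y) * (exp (- r * (s - t)) * u y s)\<bar> \<le> U"
proof -
  have "\<bar>indicator {-m..m} y * cut m y\<bar> \<le> 1"
    using cut_bounds(1)[OF assms(1), of y] by (auto simp: indicator_def)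
  moreover have "\<bar>exp (- r * (s - t)) * u y s\<bar> \<le> 1 * U"
    unfolding abs_mult by (intro mult_mono) (use assms t_range u_bound[of s y] r_pos in auto)
  ultimately show ?thesis unfolding abs_mult[of "_ * _" "_ * _"] using mult_mono by fastforce
qed

lemma Phi_integrand_measurable:
  assumes "m \<noteq> 0" "s \<in> {t..T}"
  shows "(\<lambda>\<omega>. (indicator {-m..m} (X x t s \<omega>) * cut m (X x t s \<omega>)) * (exp (- r * (s - t)) * u (X x t s \<omega>) s))
    \<in> borel_measurable M"
proof -
  have "s \<in> {0..T}" using assms t_range by auto
  note [measurable] = u_slice_measurable[OF this] cut_measurable[OF assms(1)]
  show ?thesis by measurable
qed

lemma Phi_continuous:
  assumes m: "1 \<le> m" shows "continuous_on {t..T} (Phi m)"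
proof (rule continuous_on_sequentiallyI)
  fix p a assume p: "\<forall>n. p n \<in> {t..T}" "a \<in> {t..T}" "p \<longlonglongrightarrow> a"
  let ?g = "\<lambda>s \<omega>. (indicator {-m..m} (X x t s \<omega>) * cut m (X x t s \<omega>)) * (exp (- r * (s - t)) * u (X x t s \<omega>) s)"
  show "(\<lambda>n. Phi m (p n)) \<longlonglongrightarrow> Phi m a" unfolding Phi_def
  proof (rule integral_dominated_convergence[where w="\<lambda>_. U"])
    show "AE \<omega> in M. (\<lambda>n. ?g (p n) \<omega>) \<longlonglongrightarrow> ?g a \<omega>"
    proof (rule AE_I2)
      fix \<omega> assume \<omega>: "\<omega> \<in> space M"
      have "continuous_on {t..T} (\<lambda>s. ?g s \<omega>)"
        unfolding cut_indicator[OF less_le_trans[OF zero_less_one m]]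
        by (intro continuous_intros u_compose_continuous continuous_X[OF \<omega>]) (use m t_range in auto)
      from continuous_on_tendsto_compose[OF this p(3,2)] p(1)
      show "(\<lambda>n. ?g (p n) \<omega>) \<longlonglongrightarrow> ?g a \<omega>" by simp
    qed
    show "AE \<omega> in M. norm (?g (p n) \<omega>) \<le> U" for n
      using cutoff_value_bound[OF m] p(1) by (intro AE_I2) (simp only: real_norm_def)
    show "?g a \<in> borel_measurable M" by (rule Phi_integrand_measurable) (use p m in auto)
    show "?g (p n) \<in> borel_measurable M" for n by (rule Phi_integrand_measurable) (use p m in auto)
  qed simp
qed

text \<open>
  The modulus of the centred Gaussian part of \<open>X\<^sub>s\<close>.
\<close>

definition dev :: "real \<Rightarrow> 'a \<Rightarrow> real" where "dev s \<omega> = \<bar>X x t s \<omega> - x - b * (s - t)\<bar>"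

lemma dev_integrable:
  assumes "s \<in> {t..T}"
  shows "integrable M (dev s)" "expectation (dev s) \<le> \<sigma> * sqrt (s - t)"
proof -
  have e: "dev s = (\<lambda>\<omega>. \<sigma> * \<bar>W s \<omega> - W t \<omega>\<bar>)"
    using assms t_range sig_pos by (auto simp: dev_def X_def abs_mult)
  have "integrable M (dev s) \<and> expectation (dev s) \<le> \<sigma> * sqrt (s - t)"
  proof (cases "s = t")
    case True then show ?thesis unfolding e by simp
  next
    case False
    then have "0 \<le> t" "t < s" using assms t_range by auto
    from increment_abs_moment[OF this] show ?thesis using sig_pos by (simp add: e)
  qed
  then show "integrable M (dev s)" "expectation (dev s) \<le> \<sigma> * sqrt (s - t)" by auto
qed

lemma kern_bound:
  assumes m: "1 \<le> m" and s: "s \<in> {t..T}" and C: "\<And>y s. \<bar>f y s\<bar> \<le> C" and y: "y \<in> {-m..m}"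
  shows "\<bar>kern m s y\<bar> \<le> 4 * U / (s - t) * \<bar>y - x - b * (s - t)\<bar> + (6 * \<sigma>\<^sup>2 * U + 4 * \<bar>b\<bar> * U + C)"
proof -
  note c = cut_bounds[OF m y]
  have u: "\<bar>u y s\<bar> \<le> U" using u_bound s t_range by auto
  have C0: "0 \<le> C" using C[of 0 0] by simp
  let ?z = "(y - x - b * (s - t)) / (s - t)"
  have c1u: "\<bar>cut1 m y * u y s\<bar> \<le> 4 * U" unfolding abs_mult by (intro mult_mono c u) auto
  have c2u: "\<bar>cut2 m y * u y s\<bar> \<le> 12 * U" unfolding abs_mult by (intro mult_mono c u) auto
  have cf: "\<bar>cut m y * f y s\<bar> \<le> 1 * C" unfolding abs_mult by (intro mult_mono c C) auto
  have 1: "\<bar>?z * (cut1 m y * u y s)\<bar> \<le> \<bar>?z\<bar> * (4 * U)"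
    unfolding abs_mult[of ?z] by (intro mult_left_mono c1u) auto
  have 2: "\<bar>\<sigma>\<^sup>2 / 2 * (cut2 m y * u y s)\<bar> \<le> \<sigma>\<^sup>2 / 2 * (12 * U)"
    unfolding abs_mult[of "\<sigma>\<^sup>2 / 2"] by (intro mult_mono c2u) auto
  have 3: "\<bar>b * (cut1 m y * u y s)\<bar> \<le> \<bar>b\<bar> * (4 * U)"
    unfolding abs_mult[of b] by (intro mult_left_mono c1u) auto
  have e: "kern m s y = ?z * (cut1 m y * u y s) - \<sigma>\<^sup>2 / 2 * (cut2 m y * u y s)
      + b * (cut1 m y * u y s) - cut m y * f y s"
    unfolding kern_def by (simp only: mult.assoc)
  have tri: "\<bar>p - q + v - w\<bar> \<le> \<bar>p\<bar> + \<bar>q\<bar> + \<bar>v\<bar> + \<bar>w\<bar>" for p q v w :: real by linarith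
  have "\<bar>kern m s y\<bar> \<le> \<bar>?z\<bar> * (4 * U) + \<sigma>\<^sup>2 / 2 * (12 * U) + \<bar>b\<bar> * (4 * U) + 1 * C"
    unfolding e by (rule order_trans[OF tri]) (intro add_mono 1 2 3 cf)
  also have "\<bar>?z\<bar> * (4 * U) = 4 * U / (s - t) * \<bar>y - x - b * (s - t)\<bar>"
    using s by (simp add: abs_divide)
  finally show ?thesis by (simp add: algebra_simps)
qed

lemma J_integrand_bound:
  assumes m: "1 \<le> m" and s: "s \<in> {t..T}" and C: "\<And>y s. \<bar>f y s\<bar> \<le> C"
  shows "\<bar>indicator {-m..m} (X x t s \<omega>) * (exp (- r * (s - t)) * kern m s (X x t s \<omega>))\<bar>
    \<le> 4 * U / (s - t) * dev s \<omega> + (6 * \<sigma>\<^sup>2 * U + 4 * \<bar>b\<bar> * U + C)"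
proof (cases "X x t s \<omega> \<in> {-m..m}")
  case True
  have "\<bar>exp (- r * (s - t)) * kern m s (X x t s \<omega>)\<bar> \<le> 1 * \<bar>kern m s (X x t s \<omega>)\<bar>"
    unfolding abs_mult by (intro mult_mono) (use s r_pos in auto)
  also have "\<dots> \<le> 4 * U / (s - t) * dev s \<omega> + (6 * \<sigma>\<^sup>2 * U + 4 * \<bar>b\<bar> * U + C)"
    unfolding dev_def using kern_bound[OF m s C True] by simp
  finally show ?thesis using True by simp
next
  case False
  have "0 \<le> 4 * U / (s - t) * dev s \<omega> + (6 * \<sigma>\<^sup>2 * U + 4 * \<bar>b\<bar> * U + C)"
    using U_nonneg s C[of 0 0] by (intro add_nonneg_nonneg mult_nonneg_nonneg) (auto simp: dev_def)
  then show ?thesis using False by simp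
qed

lemma J_dominating_integrable:
  assumes s: "s \<in> {t..T}"
  shows "integrable M (\<lambda>\<omega>. 4 * U / (s - t) * dev s \<omega> + K)"
  using dev_integrable(1)[OF s] by (intro Bochner_Integration.integrable_add integrable_mult_right) auto

lemma J_integrand_measurable:
  assumes "m \<noteq> 0" "s \<in> {t..T}"
  shows "(\<lambda>\<omega>. indicator {-m..m} (X x t s \<omega>) * (exp (- r * (s - t)) * kern m s (X x t s \<omega>))) \<in> borel_measurable M"
proof -
  have "s \<in> {0..T}" using assms t_range by auto
  note [measurable] = kern_measurable[OF assms(1) this]
  show ?thesis by measurable
qed

text \<open>
  The singularity at \<open>s = t\<close> is integrable, so the fundamental theorem and dominated convergence
  apply on the whole of \<open>[t,T]\<close>. At \<open>s = t\<close> itself the quotients are \<open>0\<close> by convention.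
\<close>

lemma J_bound:
  assumes m: "1 \<le> m" and s: "s \<in> {t..T}" and C: "\<And>y s. \<bar>f y s\<bar> \<le> C"
  shows "\<bar>J m s\<bar> \<le> 4 * U * \<sigma> * (1 / sqrt (s - t)) + (6 * \<sigma>\<^sup>2 * U + 4 * \<bar>b\<bar> * U + C)"
proof -
  let ?K = "6 * \<sigma>\<^sup>2 * U + 4 * \<bar>b\<bar> * U + C"
  let ?g = "\<lambda>\<omega>. indicator {-m..m} (X x t s \<omega>) * (exp (- r * (s - t)) * kern m s (X x t s \<omega>))"
  have d: "integrable M (\<lambda>\<omega>. 4 * U / (s - t) * dev s \<omega> + ?K)" by (rule J_dominating_integrable[OF s])
  have bd: "\<bar>?g \<omega>\<bar> \<le> 4 * U / (s - t) * dev s \<omega> + ?K" for \<omega> by (rule J_integrand_bound[OF m s C])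
  have gi: "integrable M ?g"
  proof (rule Bochner_Integration.integrable_bound[OF d])
    show "?g \<in> borel_measurable M" by (rule J_integrand_measurable[OF _ s]) (use m in auto)
    show "AE \<omega> in M. norm (?g \<omega>) \<le> norm (4 * U / (s - t) * dev s \<omega> + ?K)"
      unfolding real_norm_def by (intro AE_I2 order_trans[OF bd abs_ge_self])
  qed
  have "\<bar>J m s\<bar> \<le> expectation (\<lambda>\<omega>. 4 * U / (s - t) * dev s \<omega> + ?K)"
  proof -
    have "\<bar>J m s\<bar> \<le> expectation (\<lambda>\<omega>. \<bar>?g \<omega>\<bar>)"
      unfolding J_def using integral_norm_bound[of M ?g] by simp
    also have "\<dots> \<le> expectation (\<lambda>\<omega>. 4 * U / (s - t) * dev s \<omega> + ?K)"
      by (rule integral_mono[OF _ d bd]) (use gi in simp)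
    finally show ?thesis .
  qed
  also have "\<dots> = 4 * U / (s - t) * expectation (dev s) + ?K"
    using dev_integrable(1)[OF s] by (simp add: prob_space)
  also have "\<dots> \<le> 4 * U / (s - t) * (\<sigma> * sqrt (s - t)) + ?K"
    using dev_integrable(2)[OF s] U_nonneg s by (intro add_right_mono mult_left_mono) auto
  also have "4 * U / (s - t) * (\<sigma> * sqrt (s - t)) = 4 * U * \<sigma> * (sqrt (s - t) / (s - t))" by simp
  also have "sqrt (s - t) / (s - t) = 1 / sqrt (s - t)"
    using s by (cases "s = t") (auto simp: field_simps)
  finally show ?thesis .
qed

lemma J_limit:
  assumes s: "s \<in> {t..T}"
  shows "(\<lambda>n. J (real (Suc n)) s) \<longlonglongrightarrow> - expectation (\<lambda>\<omega>. exp (- r * (s - t)) * f (X x t s \<omega>) s)"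
proof -
  obtain C where C: "0 < C" "\<And>y s. \<bar>f y s\<bar> \<le> C" using f_cbf by (rule cbf_obtain_bound) blast
  let ?K = "6 * \<sigma>\<^sup>2 * U + 4 * \<bar>b\<bar> * U + C"
  let ?g = "\<lambda>n \<omega>. indicator {-real (Suc n)..real (Suc n)} (X x t s \<omega>)
      * (exp (- r * (s - t)) * kern (real (Suc n)) s (X x t s \<omega>))"
  have "(\<lambda>n. J (real (Suc n)) s) \<longlonglongrightarrow> expectation (\<lambda>\<omega>. - (exp (- r * (s - t)) * f (X x t s \<omega>) s))"
    unfolding J_def
  proof (rule integral_dominated_convergence[OF _ _ J_dominating_integrable[OF s, of ?K]])
    show "AE \<omega> in M. (\<lambda>n. ?g n \<omega>) \<longlonglongrightarrow> - (exp (- r * (s - t)) * f (X x t s \<omega>) s)"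
    proof (rule AE_I2)
      fix \<omega>
      let ?y = "X x t s \<omega>"
      have "(\<lambda>n. kern (real (Suc n)) s ?y) \<longlonglongrightarrow>
          (?y - x - b * (s - t)) / (s - t) * 0 * u ?y s - \<sigma>\<^sup>2 / 2 * 0 * u ?y s + b * 0 * u ?y s - 1 * f ?y s"
        unfolding kern_def by (intro tendsto_intros cut_limits)
      then have k: "(\<lambda>n. kern (real (Suc n)) s ?y) \<longlonglongrightarrow> - f ?y s" by simp
      have "eventually (\<lambda>n. indicator {-real (Suc n)..real (Suc n)} ?y = (1::real)) sequentially"
      proof -
        have "eventually (\<lambda>n. \<bar>?y\<bar> \<le> real n) sequentially"
          using eventually_ge_at_top[of "nat \<lceil>\<bar>?y\<bar>\<rceil>"] by eventually_elim linarith
        then show ?thesis by eventually_elim (auto simp: abs_le_iff)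
      qed
      then have i: "(\<lambda>n. indicator {-real (Suc n)..real (Suc n)} ?y) \<longlonglongrightarrow> (1::real)"
        by (rule tendsto_eventually)
      have "(\<lambda>n. ?g n \<omega>) \<longlonglongrightarrow> 1 * (exp (- r * (s - t)) * - f ?y s)"
        by (intro tendsto_mult i tendsto_const k)
      then show "(\<lambda>n. ?g n \<omega>) \<longlonglongrightarrow> - (exp (- r * (s - t)) * f (X x t s \<omega>) s)" by simp
    qed
    show "AE \<omega> in M. norm (?g n \<omega>) \<le> 4 * U / (s - t) * dev s \<omega> + ?K" for n
      unfolding real_norm_def by (intro AE_I2 J_integrand_bound[OF _ s C(2)]) simp
    show "?g n \<in> borel_measurable M" for n by (rule J_integrand_measurable[OF _ s]) simp
    show "(\<lambda>\<omega>. - (exp (- r * (s - t)) * f (X x t s \<omega>) s)) \<in> borel_measurable M" by measurable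
  qed
  then show ?thesis by simp
qed

lemma value_eq_expectation_pay: "u x t = expectation (pay f x t)"
proof -
  obtain C where C: "0 < C" "\<And>y s. \<bar>f y s\<bar> \<le> C" using f_cbf by (rule cbf_obtain_bound) blast
  let ?K = "6 * \<sigma>\<^sup>2 * U + 4 * \<bar>b\<bar> * U + C"
  let ?k = "\<lambda>s. 4 * U * \<sigma> * (1 / sqrt (s - t)) + ?K"
  let ?E = "\<lambda>s. expectation (\<lambda>\<omega>. exp (- r * (s - t)) * f (X x t s \<omega>) s)"
  have ftc: "(J (real (Suc n)) has_integral Phi (real (Suc n)) T - Phi (real (Suc n)) t) {t..T}" for n
    by (rule fundamental_theorem_of_calculus_interior)
      (use t_range in \<open>auto intro!: Phi_continuous Phi_derivative
        simp: has_real_derivative_iff_has_vector_derivative[symmetric]\<close>)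
  have k: "?k integrable_on {t..T}"
  proof -
    have "((\<lambda>s. 4 * U * \<sigma> * (1 / sqrt (s - t)) + ?K) has_integral
        (8 * U * \<sigma> * sqrt (T - t) + ?K * T) - (8 * U * \<sigma> * sqrt (t - t) + ?K * t)) {t..T}"
    proof (rule fundamental_theorem_of_calculus_interior)
      show "continuous_on {t..T} (\<lambda>s. 8 * U * \<sigma> * sqrt (s - t) + ?K * s)" by (intro continuous_intros)
      show "((\<lambda>s. 8 * U * \<sigma> * sqrt (s - t) + ?K * s) has_vector_derivative
          4 * U * \<sigma> * (1 / sqrt (s - t)) + ?K) (at s)" if "s \<in> {t<..<T}" for s
        unfolding has_real_derivative_iff_has_vector_derivative[symmetric]
        using that by (auto intro!: derivative_eq_intros simp: field_simps)
    qed (use t_range in auto)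
    then show ?thesis by (rule has_integral_integrable)
  qed
  have "(\<lambda>n. integral {t..T} (J (real (Suc n)))) \<longlonglongrightarrow> integral {t..T} (\<lambda>s. - ?E s)"
  proof (rule dominated_convergence(2)[OF _ k])
    show "J (real (Suc n)) integrable_on {t..T}" for n using ftc by (rule has_integral_integrable)
    show "norm (J (real (Suc n)) s) \<le> ?k s" if "s \<in> {t..T}" for n s
      unfolding real_norm_def by (rule J_bound[OF _ that C(2)]) simp
  qed (rule J_limit)
  then have l1: "(\<lambda>n. Phi (real (Suc n)) T - Phi (real (Suc n)) t) \<longlonglongrightarrow> - integral {t..T} ?E"
    unfolding integral_unique[OF ftc] integral_neg .
  have Phi_lim: "(\<lambda>n. Phi (real (Suc n)) s) \<longlonglongrightarrow> expectation (\<lambda>\<omega>. exp (- r * (s - t)) * u (X x t s \<omega>) s)"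
    if s: "s \<in> {t..T}" for s
    unfolding Phi_def
  proof (rule integral_dominated_convergence[where w="\<lambda>_. U"])
    let ?g = "\<lambda>n \<omega>. (indicator {-real (Suc n)..real (Suc n)} (X x t s \<omega>) * cut (real (Suc n)) (X x t s \<omega>))
        * (exp (- r * (s - t)) * u (X x t s \<omega>) s)"
    show "AE \<omega> in M. (\<lambda>n. ?g n \<omega>) \<longlonglongrightarrow> exp (- r * (s - t)) * u (X x t s \<omega>) s"
    proof (rule AE_I2)
      fix \<omega>
      let ?y = "X x t s \<omega>"
      have "(\<lambda>n. (max 0 (1 - (?y * inverse (real (Suc n)))\<^sup>2))\<^sup>2) \<longlonglongrightarrow> (max 0 (1 - 0\<^sup>2))\<^sup>2"
        by (intro tendsto_intros tendsto_mult_right_zero LIMSEQ_inverse_real_of_nat)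
      then have "(\<lambda>n. indicator {-real (Suc n)..real (Suc n)} ?y * cut (real (Suc n)) ?y) \<longlonglongrightarrow> 1"
        by (subst cut_indicator) (simp_all add: divide_inverse)
      from tendsto_mult[OF this tendsto_const[of "exp (- r * (s - t)) * u ?y s"]]
      show "(\<lambda>n. ?g n \<omega>) \<longlonglongrightarrow> exp (- r * (s - t)) * u ?y s" by simp
    qed
    show "AE \<omega> in M. norm (?g n \<omega>) \<le> U" for n
      unfolding real_norm_def by (intro AE_I2 cutoff_value_bound[OF _ s]) simp
    show "?g n \<in> borel_measurable M" for n by (rule Phi_integrand_measurable[OF _ s]) simp
    have "s \<in> {0..T}" using s t_range by auto
    note [measurable] = u_slice_measurable[OF this]
    show "(\<lambda>\<omega>. exp (- r * (s - t)) * u (X x t s \<omega>) s) \<in> borel_measurable M" by measurable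
  qed simp
  have "(\<lambda>n. Phi (real (Suc n)) T - Phi (real (Suc n)) t)
      \<longlonglongrightarrow> expectation (\<lambda>\<omega>. exp (- r * (T - t)) * h (X x t T \<omega>)) - u x t"
    using tendsto_diff[OF Phi_lim[of T] Phi_lim[of t]] t_range
    by (simp add: terminal prob_space)
  from LIMSEQ_unique[OF this l1]
  have u_eq: "u x t = expectation (\<lambda>\<omega>. exp (- r * (T - t)) * h (X x t T \<omega>)) + integral {t..T} ?E" by simp
  have Em: "?E \<in> borel_measurable borel"
    by (rule borel_measurable_lebesgue_integral[OF running_measurable[OF f_cbf]])
  have Eb: "\<bar>?E s\<bar> \<le> C" if "s \<in> {t..T}" for s
    by (rule abs_expectation_le[OF _ running_bound[OF C(2)]]) (use that in auto)
  have "integral {t..T} ?E = (LBINT s:{t..T}. ?E s)"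
    by (rule set_borel_integral_eq_integral(2)[OF set_integral_bounded_time(1)[OF Em Eb], symmetric])
      (use t_range C in auto)
  then show ?thesis using t_range by (simp add: u_eq expectation_pay[OF f_cbf])
qed

end

section \<open>Geometric Brownian motion solves the stock price equation\<close>

lemma integrable_product_of_squares:
  fixes f g :: "'b \<Rightarrow> real"
  assumes [measurable]: "f \<in> borel_measurable N" "g \<in> borel_measurable N"
    and i: "integrable N (\<lambda>x. (f x)\<^sup>2)" "integrable N (\<lambda>x. (g x)\<^sup>2)"
  shows "integrable N (\<lambda>x. f x * g x)"
proof (rule Bochner_Integration.integrable_bound[OF Bochner_Integration.integrable_add[OF i]])
  have "\<bar>a * b\<bar> \<le> a\<^sup>2 + b\<^sup>2" for a b :: real
  proof -
    have "2 * (\<bar>a\<bar> * \<bar>b\<bar>) \<le> a\<^sup>2 + b\<^sup>2"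
      using zero_le_power2[of "\<bar>a\<bar> - \<bar>b\<bar>"] by (simp add: power2_diff)
    moreover have "0 \<le> \<bar>a\<bar> * \<bar>b\<bar>" by simp
    ultimately show ?thesis unfolding abs_mult by linarith
  qed
  then show "AE x in N. norm (f x * g x) \<le> norm ((f x)\<^sup>2 + (g x)\<^sup>2)" by simp
qed measurable

context prob_space begin

lemma prob_le_expectation:
  fixes g :: "'a \<Rightarrow> real"
  assumes "integrable M g" "A \<in> events" "\<And>\<omega>. \<omega> \<in> space M \<Longrightarrow> 0 \<le> g \<omega>" "\<And>\<omega>. \<omega> \<in> A \<Longrightarrow> 1 \<le> g \<omega>"
  shows "prob A \<le> expectation g"
proof -
  have "prob A = expectation (indicator A)" using assms(2) by simp
  also have "\<dots> \<le> expectation g"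
    using assms by (intro integral_mono) (auto simp: indicator_def emeasure_eq_measure)
  finally show ?thesis .
qed

end

lemma exp_minus_one_le: "0 \<le> v \<Longrightarrow> exp v - 1 \<le> v * exp v" for v :: real
proof -
  assume "0 \<le> v"
  have "1 - v \<le> exp (- v)" using exp_ge_add_one_self[of "- v"] by simp
  then have "(1 - v) * exp v \<le> exp (- v) * exp v" by (intro mult_right_mono) auto
  then show ?thesis by (simp add: exp_minus field_simps)
qed

lemma exp_second_order_le: "0 \<le> v \<Longrightarrow> exp v - 1 - v \<le> v\<^sup>2 * exp v" for v :: real
proof -
  assume v: "0 \<le> v"
  have "exp v - 1 - v \<le> v * (exp v - 1)" using exp_minus_one_le[OF v] by (simp add: algebra_simps)
  also have "\<dots> \<le> v * (v * exp v)" by (intro mult_left_mono exp_minus_one_le v)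
  finally show ?thesis by (simp add: power2_eq_square)
qed

context gbm begin

lemma increment_product:
  fixes Z :: "'a \<Rightarrow> real" and g :: "real \<Rightarrow> real"
  assumes ab: "0 \<le> a" "a < b" and Z: "Z \<in> borel_measurable (F a)" "integrable M Z"
    and g: "g \<in> borel_measurable borel" "integrable M (\<lambda>\<omega>. g (W b \<omega> - W a \<omega>))"
  shows "integrable M (\<lambda>\<omega>. Z \<omega> * g (W b \<omega> - W a \<omega>))"
    "expectation (\<lambda>\<omega>. Z \<omega> * g (W b \<omega> - W a \<omega>)) = expectation Z * expectation (\<lambda>\<omega>. g (W b \<omega> - W a \<omega>))"
proof -
  have m: "W b \<in> borel_measurable M" "W a \<in> borel_measurable M"
    using W_measurable_M ab by auto
  have "indep_var borel Z borel (\<lambda>\<omega>. W b \<omega> - W a \<omega>)"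
    using increment_indep[OF ab Z(1)] m measurable_F_M[OF Z(1)] by (auto simp: indep_var_distribution_eq)
  from indep_var_compose[OF this measurable_ident g(1)]
  have i: "indep_var borel Z borel (\<lambda>\<omega>. g (W b \<omega> - W a \<omega>))" by (simp add: comp_def id_def)
  show "integrable M (\<lambda>\<omega>. Z \<omega> * g (W b \<omega> - W a \<omega>))" by (rule indep_var_integrable[OF i Z(2) g(2)])
  show "expectation (\<lambda>\<omega>. Z \<omega> * g (W b \<omega> - W a \<omega>)) = expectation Z * expectation (\<lambda>\<omega>. g (W b \<omega> - W a \<omega>))"
    by (rule indep_var_lebesgue_integral[OF i Z(2) g(2)])
qed

text \<open>
  Geometric Brownian motion, started at \<open>e\<^sup>x\<close> at time \<open>t\<close>.
\<close>

definition stock :: "real \<Rightarrow> real \<Rightarrow> real \<Rightarrow> 'a \<Rightarrow> real" where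
  "stock x t s \<omega> = exp (X x t s \<omega>)"

lemma stock_step:
  assumes "0 \<le> a" "a \<le> b"
  shows "stock x t b \<omega> = stock x t a \<omega> * exp ((r - \<sigma>\<^sup>2 / 2) * (b - a) + \<sigma> * (W b \<omega> - W a \<omega>))"
  unfolding stock_def X_flow[of x t b \<omega> a] using assms
  by (simp add: X_def[of _ a b] exp_add mult.assoc)

lemma stock_adapted: "0 \<le> t \<Longrightarrow> t \<le> s \<Longrightarrow> stock x t s \<in> borel_measurable (F s)"
  using X_adapted unfolding stock_def by measurable

lemma stock_measurable: "(\<lambda>(s, \<omega>). stock x t s \<omega>) \<in> borel_measurable (borel \<Otimes>\<^sub>M M)"
  unfolding stock_def case_prod_beta' by measurable

lemma stock_square:
  assumes ta: "0 \<le> t" "t \<le> a" "a \<le> T"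
  shows "integrable M (\<lambda>\<omega>. (stock x t a \<omega>)\<^sup>2)"
    "expectation (\<lambda>\<omega>. (stock x t a \<omega>)\<^sup>2) \<le> exp (2 * x + (2 * r + \<sigma>\<^sup>2) * T)"
proof -
  have "integrable M (\<lambda>\<omega>. (stock x t a \<omega>)\<^sup>2) \<and>
    expectation (\<lambda>\<omega>. (stock x t a \<omega>)\<^sup>2) = exp (2 * x + (2 * r + \<sigma>\<^sup>2) * (a - t))"
  proof (cases "t = a")
    case True
    then show ?thesis by (simp add: stock_def prob_space exp_double[symmetric])
  next
    case False
    have e: "(stock x t a \<omega>)\<^sup>2 = exp (2 * x + 2 * (r - \<sigma>\<^sup>2 / 2) * (a - t)) * exp (2 * \<sigma> * (W a \<omega> - W t \<omega>))" for \<omega>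
      using ta unfolding stock_def X_def exp_double[symmetric] exp_add[symmetric]
      by (simp add: field_simps)
    have "0 \<le> t" "t < a" using ta False by auto
    note m = increment_exp_moments(1,2)[OF this, of "2 * \<sigma>"]
    have "exp (2 * x + 2 * (r - \<sigma>\<^sup>2 / 2) * (a - t)) * exp ((2 * \<sigma>)\<^sup>2 * (a - t) / 2)
        = exp (2 * x + (2 * r + \<sigma>\<^sup>2) * (a - t))"
      unfolding exp_add[symmetric] by (simp add: power_mult_distrib field_simps)
    then show ?thesis unfolding e using m by simp
  qed
  moreover have "exp (2 * x + (2 * r + \<sigma>\<^sup>2) * (a - t)) \<le> exp (2 * x + (2 * r + \<sigma>\<^sup>2) * T)"
    using ta r_pos by (auto intro!: mult_left_mono)
  ultimately show "integrable M (\<lambda>\<omega>. (stock x t a \<omega>)\<^sup>2)"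
    "expectation (\<lambda>\<omega>. (stock x t a \<omega>)\<^sup>2) \<le> exp (2 * x + (2 * r + \<sigma>\<^sup>2) * T)" by auto
qed

text \<open>
  For an interval of length \<open>d\<close> on which \<open>W\<close> increases by \<open>n\<close>, \<open>step d n\<close> is, relative to the price at
  its left end, the difference between the summand \<open>\<sigma> S \<Delta>W\<close> of the stochastic integral and the
  centred price increment. It has mean zero and variance of order \<open>d\<^sup>2\<close>.
\<close>

definition step :: "real \<Rightarrow> real \<Rightarrow> real" where
  "step d n = \<sigma> * n - exp ((r - \<sigma>\<^sup>2 / 2) * d + \<sigma> * n) + exp (r * d)"

text \<open>
  Constants in the bounds \<open>O(d\<^sup>2)\<close> for the variance of \<open>step\<close> and \<open>O(d)\<close> for that of a relative price
  increment over an interval of length \<open>d \<le> T\<close>.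
\<close>

definition step_const :: real where
  "step_const = exp (2 * r * T) * (\<sigma>\<^sup>2 * r\<^sup>2 * T + \<sigma>^4 * exp (\<sigma>\<^sup>2 * T))"

definition drift_const :: real where
  "drift_const = exp (2 * r * T) * \<sigma>\<^sup>2 * exp (\<sigma>\<^sup>2 * T)"

lemma const_nonneg: "0 \<le> step_const" "0 \<le> drift_const"
  using r_pos T_pos by (auto simp: step_const_def drift_const_def)

lemma step_moments:
  assumes ab: "0 \<le> a" "a < b" "b - a \<le> T"
  shows "integrable M (\<lambda>\<omega>. step (b - a) (W b \<omega> - W a \<omega>))"
    "expectation (\<lambda>\<omega>. step (b - a) (W b \<omega> - W a \<omega>)) = 0"
    "integrable M (\<lambda>\<omega>. (step (b - a) (W b \<omega> - W a \<omega>))\<^sup>2)"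
    "expectation (\<lambda>\<omega>. (step (b - a) (W b \<omega> - W a \<omega>))\<^sup>2) \<le> step_const * (b - a)\<^sup>2"
    "integrable M (\<lambda>\<omega>. (exp ((r - \<sigma>\<^sup>2 / 2) * (b - a) + \<sigma> * (W b \<omega> - W a \<omega>)) - exp (r * (b - a)))\<^sup>2)"
    "expectation (\<lambda>\<omega>. (exp ((r - \<sigma>\<^sup>2 / 2) * (b - a) + \<sigma> * (W b \<omega> - W a \<omega>)) - exp (r * (b - a)))\<^sup>2)
      \<le> drift_const * (b - a)"
proof -
  define d where "d = b - a"
  define p where "p = exp (r * d)"
  define q where "q = exp ((r - \<sigma>\<^sup>2 / 2) * d)"
  define N where "N \<omega> = W b \<omega> - W a \<omega>" for \<omega>
  have d: "0 < d" "d \<le> T" using ab by (auto simp: d_def)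
  note m = increment_moments[OF ab(1,2), folded N_def d_def]
  note e1 = increment_exp_moments[OF ab(1,2), of \<sigma>, folded N_def d_def]
  note e2 = increment_exp_moments(1,2)[OF ab(1,2), of "2 * \<sigma>", folded N_def d_def]
  have q1: "q * exp (\<sigma>\<^sup>2 * d / 2) = p"
    unfolding q_def p_def exp_add[symmetric] by (simp add: field_simps)
  have q2: "q\<^sup>2 * exp ((2 * \<sigma>)\<^sup>2 * d / 2) = p\<^sup>2 * exp (\<sigma>\<^sup>2 * d)"
    unfolding q_def p_def exp_double[symmetric] exp_add[symmetric]
    by (simp add: field_simps power_mult_distrib)
  have s1: "step (b - a) (W b \<omega> - W a \<omega>) = \<sigma> * N \<omega> - q * exp (\<sigma> * N \<omega>) + p" for \<omega>
    unfolding step_def q_def p_def N_def d_def by (simp add: exp_add)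
  have s2: "(\<sigma> * N \<omega> - q * exp (\<sigma> * N \<omega>) + p)\<^sup>2
    = \<sigma>\<^sup>2 * (N \<omega>)\<^sup>2 + q\<^sup>2 * exp (2 * \<sigma> * N \<omega>) + p\<^sup>2 - 2 * \<sigma> * q * (N \<omega> * exp (\<sigma> * N \<omega>))
      + 2 * \<sigma> * p * N \<omega> - 2 * p * q * exp (\<sigma> * N \<omega>)" for \<omega>
  proof -
    have "exp (2 * \<sigma> * N \<omega>) = (exp (\<sigma> * N \<omega>))\<^sup>2" by (simp add: exp_double[symmetric] mult.assoc)
    then show ?thesis by (simp add: power2_eq_square algebra_simps)
  qed
  have s3: "exp ((r - \<sigma>\<^sup>2 / 2) * (b - a) + \<sigma> * (W b \<omega> - W a \<omega>)) - exp (r * (b - a))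
    = q * exp (\<sigma> * N \<omega>) - p" for \<omega>
    unfolding q_def p_def N_def d_def by (simp add: exp_add)
  have s4: "(q * exp (\<sigma> * N \<omega>) - p)\<^sup>2
    = q\<^sup>2 * exp (2 * \<sigma> * N \<omega>) + p\<^sup>2 - 2 * p * q * exp (\<sigma> * N \<omega>)" for \<omega>
  proof -
    have "exp (2 * \<sigma> * N \<omega>) = (exp (\<sigma> * N \<omega>))\<^sup>2" by (simp add: exp_double[symmetric] mult.assoc)
    then show ?thesis by (simp add: power2_eq_square algebra_simps)
  qed
  show "integrable M (\<lambda>\<omega>. step (b - a) (W b \<omega> - W a \<omega>))" unfolding s1 using m e1 by simp
  show "expectation (\<lambda>\<omega>. step (b - a) (W b \<omega> - W a \<omega>)) = 0"
    unfolding s1 using m e1 q1 by (simp add: prob_space)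
  show "integrable M (\<lambda>\<omega>. (step (b - a) (W b \<omega> - W a \<omega>))\<^sup>2)" unfolding s1 s2 using m e1 e2 by simp
  show "integrable M (\<lambda>\<omega>. (exp ((r - \<sigma>\<^sup>2 / 2) * (b - a) + \<sigma> * (W b \<omega> - W a \<omega>)) - exp (r * (b - a)))\<^sup>2)"
    unfolding s3 s4 using e1 e2 by simp
  have pT: "1 \<le> p" "p\<^sup>2 \<le> exp (2 * r * T)" and sT: "exp (\<sigma>\<^sup>2 * d) \<le> exp (\<sigma>\<^sup>2 * T)"
    using d r_pos by (auto simp: p_def exp_double[symmetric] mult.assoc intro!: mult_left_mono)
  have v: "0 \<le> \<sigma>\<^sup>2 * d" using d by simp
  have p1: "(1 - p)\<^sup>2 \<le> (r * d)\<^sup>2 * p\<^sup>2"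
  proof -
    have "p - 1 \<le> r * d * p" using exp_minus_one_le[of "r * d"] d r_pos by (simp add: p_def)
    then have "(p - 1)\<^sup>2 \<le> (r * d * p)\<^sup>2" using pT(1) by (intro power_mono) auto
    then show ?thesis by (simp add: power_mult_distrib power2_commute)
  qed
  have "expectation (\<lambda>\<omega>. (step (b - a) (W b \<omega> - W a \<omega>))\<^sup>2)
      = \<sigma>\<^sup>2 * d + q\<^sup>2 * exp ((2 * \<sigma>)\<^sup>2 * d / 2) + p\<^sup>2 - 2 * \<sigma> * q * (\<sigma> * d * exp (\<sigma>\<^sup>2 * d / 2))
        - 2 * p * q * exp (\<sigma>\<^sup>2 * d / 2)"
    unfolding s1 s2 using m e1 e2 by (simp add: prob_space)
  also have "\<dots> = \<sigma>\<^sup>2 * d + p\<^sup>2 * exp (\<sigma>\<^sup>2 * d) + p\<^sup>2 - 2 * \<sigma>\<^sup>2 * d * (q * exp (\<sigma>\<^sup>2 * d / 2))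
        - 2 * p * (q * exp (\<sigma>\<^sup>2 * d / 2))"
    unfolding q2 by (simp add: power2_eq_square mult_ac)
  also have "\<dots> = \<sigma>\<^sup>2 * d * (1 - p)\<^sup>2 + p\<^sup>2 * (exp (\<sigma>\<^sup>2 * d) - 1 - \<sigma>\<^sup>2 * d)"
    unfolding q1 by (simp add: power2_eq_square algebra_simps)
  also have "\<dots> \<le> \<sigma>\<^sup>2 * d * ((r * d)\<^sup>2 * p\<^sup>2) + p\<^sup>2 * ((\<sigma>\<^sup>2 * d)\<^sup>2 * exp (\<sigma>\<^sup>2 * d))"
    by (intro add_mono mult_left_mono p1 exp_second_order_le v) simp_all
  also have "\<dots> = p\<^sup>2 * (\<sigma>\<^sup>2 * r\<^sup>2 * d + \<sigma>^4 * exp (\<sigma>\<^sup>2 * d)) * d\<^sup>2"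
    by (simp add: power_mult_distrib power2_eq_square power4_eq_xxxx algebra_simps)
  also have "\<dots> \<le> step_const * d\<^sup>2"
    unfolding step_const_def using d pT sT by (intro mult_right_mono mult_mono add_mono) auto
  finally show "expectation (\<lambda>\<omega>. (step (b - a) (W b \<omega> - W a \<omega>))\<^sup>2) \<le> step_const * (b - a)\<^sup>2"
    by (simp add: d_def)
  have "expectation (\<lambda>\<omega>. (q * exp (\<sigma> * N \<omega>) - p)\<^sup>2)
      = q\<^sup>2 * exp ((2 * \<sigma>)\<^sup>2 * d / 2) + p\<^sup>2 - 2 * p * (q * exp (\<sigma>\<^sup>2 * d / 2))"
    unfolding s4 using e1 e2 by (simp add: prob_space)
  also have "\<dots> = p\<^sup>2 * (exp (\<sigma>\<^sup>2 * d) - 1)"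
    unfolding q2 q1 by (simp add: power2_eq_square algebra_simps)
  also have "\<dots> \<le> p\<^sup>2 * (\<sigma>\<^sup>2 * d * exp (\<sigma>\<^sup>2 * d))"
    by (intro mult_left_mono exp_minus_one_le v) simp
  also have "\<dots> = p\<^sup>2 * \<sigma>\<^sup>2 * exp (\<sigma>\<^sup>2 * d) * d" by simp
  also have "\<dots> \<le> drift_const * d"
    unfolding drift_const_def using d pT sT by (intro mult_right_mono mult_mono) auto
  finally show "expectation (\<lambda>\<omega>. (exp ((r - \<sigma>\<^sup>2 / 2) * (b - a) + \<sigma> * (W b \<omega> - W a \<omega>)) - exp (r * (b - a)))\<^sup>2)
      \<le> drift_const * (b - a)"
    unfolding s3 by (simp add: d_def)
qed

lemma partition_mono:
  assumes "\<forall>i<k. \<tau> i < \<tau> (Suc i)" "i \<le> j" "j \<le> k" shows "\<tau> i \<le> (\<tau> j :: real)"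
  using assms(2,3)
proof (induction j rule: dec_induct)
  case (step j)
  then show ?case using assms(1)[rule_format, of j] by simp
qed simp

text \<open>
  The summands are martingale differences, so the cross terms vanish in the second moment.
\<close>

lemma martingale_sum:
  fixes \<tau> :: "nat \<Rightarrow> real" and x t :: real
  assumes t0: "0 \<le> t" "t \<le> \<tau> 0" and part: "\<forall>i<k. \<tau> i < \<tau> (Suc i)" and kT: "\<tau> k \<le> T"
  defines "Q \<equiv> exp (2 * x + (2 * r + \<sigma>\<^sup>2) * T)"
    and "Y \<equiv> \<lambda>i \<omega>. step (\<tau> (Suc i) - \<tau> i) (W (\<tau> (Suc i)) \<omega> - W (\<tau> i) \<omega>)"
  defines "Z \<equiv> \<lambda>k \<omega>. \<Sum>i<k. stock x t (\<tau> i) \<omega> * Y i \<omega>"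
  shows "Z k \<in> borel_measurable (F (\<tau> k)) \<and> integrable M (\<lambda>\<omega>. (Z k \<omega>)\<^sup>2) \<and>
    expectation (\<lambda>\<omega>. (Z k \<omega>)\<^sup>2) \<le> (\<Sum>i<k. Q * (step_const * (\<tau> (Suc i) - \<tau> i)\<^sup>2))"
  using part kT
proof (induction k)
  case 0 then show ?case by (simp add: Z_def)
next
  case (Suc k)
  let ?a = "\<tau> k" and ?b = "\<tau> (Suc k)" and ?S = "stock x t (\<tau> k)"
  have part: "\<forall>i<k. \<tau> i < \<tau> (Suc i)" and ab: "?a < ?b" using Suc.prems(1) by auto
  have ka: "t \<le> ?a" "0 \<le> ?a" using partition_mono[OF part, of 0 k] t0 by auto
  have ba: "?b - ?a \<le> T" "?a \<le> T" using Suc.prems(2) ka ab by auto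
  have IH: "Z k \<in> borel_measurable (F ?a)" "integrable M (\<lambda>\<omega>. (Z k \<omega>)\<^sup>2)"
    "expectation (\<lambda>\<omega>. (Z k \<omega>)\<^sup>2) \<le> (\<Sum>i<k. Q * (step_const * (\<tau> (Suc i) - \<tau> i)\<^sup>2))"
    using Suc.IH[OF part ba(2)] by auto
  note S2 = stock_square[OF t0(1) ka(1) ba(2), of x]
  note y = step_moments[OF ka(2) ab ba(1)]
  have SF: "?S \<in> borel_measurable (F ?a)" by (rule stock_adapted[OF t0(1) ka(1)])
  note SM[measurable] = measurable_F_M[OF SF] and ZM[measurable] = measurable_F_M[OF IH(1)]
  have step_meas[measurable]: "step d \<in> borel_measurable borel" for d
    unfolding step_def[abs_def] by measurable
  have Yb: "Y k \<in> borel_measurable (F ?b)"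
  proof -
    have [measurable]: "W ?b \<in> borel_measurable (F ?b)" "W ?a \<in> borel_measurable (F ?b)"
      using adapted[of ?b] measurable_F_mono[OF adapted[of ?a], of ?b] ka ab by auto
    show ?thesis unfolding Y_def by measurable
  qed
  note YM[measurable] = measurable_F_M[OF Yb]
  have ZS: "Z (Suc k) \<omega> = Z k \<omega> + ?S \<omega> * Y k \<omega>" for \<omega> by (simp add: Z_def)
  have meas: "Z (Suc k) \<in> borel_measurable (F ?b)"
  proof -
    have [measurable]: "Z k \<in> borel_measurable (F ?b)" "?S \<in> borel_measurable (F ?b)"
      using measurable_F_mono[OF IH(1)] measurable_F_mono[OF SF] ab by auto
    note [measurable] = Yb
    have "(\<lambda>\<omega>. Z k \<omega> + ?S \<omega> * Y k \<omega>) \<in> borel_measurable (F ?b)" by measurable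
    then show ?thesis by (simp only: ZS[abs_def])
  qed
  have cross_int: "integrable M (\<lambda>\<omega>. Z k \<omega> * ?S \<omega>)"
    by (rule integrable_product_of_squares[OF ZM SM IH(2) S2(1)])
  have crossF: "(\<lambda>\<omega>. Z k \<omega> * ?S \<omega>) \<in> borel_measurable (F ?a)" using IH(1) SF by measurable
  note cross = increment_product[OF ka(2) ab crossF cross_int step_meas y(1)]
  have sqF: "(\<lambda>\<omega>. (?S \<omega>)\<^sup>2) \<in> borel_measurable (F ?a)" using SF by measurable
  have step2: "(\<lambda>n. (step (?b - ?a) n)\<^sup>2) \<in> borel_measurable borel" by measurable
  note sq = increment_product[OF ka(2) ab sqF S2(1) step2 y(3)]
  have expand: "(Z (Suc k) \<omega>)\<^sup>2 = (Z k \<omega>)\<^sup>2 + 2 * (Z k \<omega> * ?S \<omega> * Y k \<omega>) + (?S \<omega>)\<^sup>2 * (Y k \<omega>)\<^sup>2" for \<omega>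
    unfolding ZS by (simp add: power2_eq_square algebra_simps)
  have i3: "integrable M (\<lambda>\<omega>. (Z (Suc k) \<omega>)\<^sup>2)"
    unfolding expand using IH(2) cross(1) sq(1) by (simp add: Y_def)
  have "expectation (\<lambda>\<omega>. (Z (Suc k) \<omega>)\<^sup>2)
      = expectation (\<lambda>\<omega>. (Z k \<omega>)\<^sup>2) + 2 * expectation (\<lambda>\<omega>. Z k \<omega> * ?S \<omega> * Y k \<omega>)
        + expectation (\<lambda>\<omega>. (?S \<omega>)\<^sup>2 * (Y k \<omega>)\<^sup>2)"
    unfolding expand using IH(2) cross(1) sq(1) by (simp add: Y_def)
  also have "expectation (\<lambda>\<omega>. Z k \<omega> * ?S \<omega> * Y k \<omega>) = 0"
    using cross(2) y(2) by (simp add: Y_def)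
  also have "expectation (\<lambda>\<omega>. (?S \<omega>)\<^sup>2 * (Y k \<omega>)\<^sup>2)
      = expectation (\<lambda>\<omega>. (?S \<omega>)\<^sup>2) * expectation (\<lambda>\<omega>. (Y k \<omega>)\<^sup>2)"
    using sq(2) by (simp add: Y_def)
  also have "expectation (\<lambda>\<omega>. (?S \<omega>)\<^sup>2) * expectation (\<lambda>\<omega>. (Y k \<omega>)\<^sup>2) \<le> Q * (step_const * (?b - ?a)\<^sup>2)"
    using S2(2) y(4) unfolding Y_def Q_def by (intro mult_mono) auto
  finally have "expectation (\<lambda>\<omega>. (Z (Suc k) \<omega>)\<^sup>2) \<le> (\<Sum>i<Suc k. Q * (step_const * (\<tau> (Suc i) - \<tau> i)\<^sup>2))"
    using IH(3) by simp
  then show ?case using meas i3 by blast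
qed

text \<open>
  The remaining error on \<open>[a,b]\<close> equals \<open>\<integral>\<^sub>a\<^sup>b r (S\<^sub>q - S\<^sub>a e\<^bsup>r(q-a)\<^esup>) dq\<close>, and its integrand is of order
  \<open>(q - a)\<^bsup>1/2\<^esup>\<close> in \<open>L\<^sup>1\<close>.
\<close>

lemma drift_error:
  fixes x t a b :: real
  assumes ta: "0 \<le> t" "t \<le> a" "a < b" "b \<le> T"
  defines "Q \<equiv> exp (2 * x + (2 * r + \<sigma>\<^sup>2) * T)"
    and "A \<equiv> \<lambda>\<omega>. stock x t a \<omega> * (1 - exp (r * (b - a))) + (LBINT q:{a..b}. r * stock x t q \<omega>)"
  shows "integrable M A" "expectation (\<lambda>\<omega>. \<bar>A \<omega>\<bar>) \<le> r * (Q + drift_const) * sqrt (b - a) * (b - a)"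
proof -
  let ?f = "\<lambda>q \<omega>. r * (stock x t q \<omega> - stock x t a \<omega> * exp (r * (q - a)))"
  let ?S = "stock x t a"
  have SM[measurable]: "?S \<in> borel_measurable M" by (rule measurable_F_M[OF stock_adapted[OF ta(1,2)]])
  have a: "0 \<le> a" "a \<le> T" using ta by auto
  note S2 = stock_square[OF ta(1,2) a(2), of x, folded Q_def]
  have [measurable]: "(\<lambda>z. stock x t (fst z) (snd z)) \<in> borel_measurable (borel \<Otimes>\<^sub>M M)"
    using stock_measurable by (simp add: case_prod_beta')
  have fm: "(\<lambda>(q, \<omega>). ?f q \<omega>) \<in> borel_measurable (borel \<Otimes>\<^sub>M M)"
    unfolding case_prod_beta' by measurable
  have one: "integrable M (?f q) \<and> expectation (\<lambda>\<omega>. \<bar>?f q \<omega>\<bar>) \<le> r * (Q + drift_const) * sqrt (b - a)"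
    if q: "q \<in> {a..b}" for q
  proof (cases "q = a")
    case True then show ?thesis using r_pos const_nonneg ta by (auto simp: Q_def)
  next
    case False
    define c where "c = sqrt (q - a)"
    define y where "y \<omega> = exp ((r - \<sigma>\<^sup>2 / 2) * (q - a) + \<sigma> * (W q \<omega> - W a \<omega>)) - exp (r * (q - a))" for \<omega>
    have aq: "a < q" "q - a \<le> T" using q False ta by auto
    have c: "0 < c" "q - a = c * c" "c \<le> sqrt (b - a)" using aq q by (auto simp: c_def)
    note y2 = step_moments(5,6)[OF a(1) aq, folded y_def]
    have [measurable]: "W q \<in> borel_measurable M" "W a \<in> borel_measurable M"
      using W_measurable_M a aq by auto
    have ym[measurable]: "y \<in> borel_measurable M" unfolding y_def by measurable
    have fe: "?f q \<omega> = r * (?S \<omega> * y \<omega>)" for \<omega>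
      unfolding stock_step[OF a(1) less_imp_le[OF aq(1)], of x t \<omega>] y_def by (simp add: algebra_simps)
    have pi: "integrable M (\<lambda>\<omega>. ?S \<omega> * y \<omega>)"
      by (rule integrable_product_of_squares[OF SM ym S2(1) y2(1)])
    \<comment> \<open>Weighted arithmetic-geometric mean inequality: \<open>y\<^sup>2\<close> has expectation of order \<open>c\<^sup>2\<close>.\<close>
    have "expectation (\<lambda>\<omega>. \<bar>?S \<omega> * y \<omega>\<bar>) \<le> expectation (\<lambda>\<omega>. c * (?S \<omega>)\<^sup>2 + (1 / c) * (y \<omega>)\<^sup>2)"
    proof (rule integral_mono)
      show "integrable M (\<lambda>\<omega>. \<bar>?S \<omega> * y \<omega>\<bar>)" using pi by simp
      show "integrable M (\<lambda>\<omega>. c * (?S \<omega>)\<^sup>2 + (1 / c) * (y \<omega>)\<^sup>2)" using S2(1) y2(1) by simp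
      fix \<omega>
      let ?u = "c * \<bar>?S \<omega>\<bar>" and ?v = "\<bar>y \<omega>\<bar>"
      have "2 * (?u * ?v) \<le> ?u\<^sup>2 + ?v\<^sup>2" using zero_le_power2[of "?u - ?v"] by (simp add: power2_diff)
      moreover have "0 \<le> ?u * ?v" using c by simp
      ultimately have "?u * ?v \<le> ?u\<^sup>2 + ?v\<^sup>2" by linarith
      then have "c * (\<bar>?S \<omega>\<bar> * ?v) \<le> c * (c * (?S \<omega>)\<^sup>2 + (1 / c) * (y \<omega>)\<^sup>2)"
        using c(1) by (simp add: power_mult_distrib power2_eq_square algebra_simps)
      then show "\<bar>?S \<omega> * y \<omega>\<bar> \<le> c * (?S \<omega>)\<^sup>2 + (1 / c) * (y \<omega>)\<^sup>2"
        using c(1) by (simp only: abs_mult mult_le_cancel_left_pos)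
    qed
    also have "\<dots> = c * expectation (\<lambda>\<omega>. (?S \<omega>)\<^sup>2) + (1 / c) * expectation (\<lambda>\<omega>. (y \<omega>)\<^sup>2)"
      using S2(1) y2(1) by simp
    also have "\<dots> \<le> c * Q + (1 / c) * (drift_const * (q - a))"
      using c(1) by (intro add_mono mult_left_mono S2(2) y2(2)) auto
    also have "\<dots> = c * (Q + drift_const)" using c by (simp add: field_simps)
    also have "\<dots> \<le> sqrt (b - a) * (Q + drift_const)"
      using c const_nonneg by (intro mult_right_mono) (auto simp: Q_def)
    finally have "expectation (\<lambda>\<omega>. \<bar>?S \<omega> * y \<omega>\<bar>) \<le> (Q + drift_const) * sqrt (b - a)" by (simp add: mult.commute)
    then have "r * expectation (\<lambda>\<omega>. \<bar>?S \<omega> * y \<omega>\<bar>) \<le> r * (Q + drift_const) * sqrt (b - a)"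
      using r_pos by (simp add: mult.assoc)
    moreover have "\<bar>?f q \<omega>\<bar> = r * \<bar>?S \<omega> * y \<omega>\<bar>" for \<omega> unfolding fe using r_pos by (simp add: abs_mult)
    ultimately show ?thesis unfolding fe using pi r_pos by (simp add: abs_mult)
  qed
  have ab: "a \<le> b" using ta by simp
  have one1: "\<And>q. q \<in> {a..b} \<Longrightarrow> integrable M (?f q)"
    and one2: "\<And>q. q \<in> {a..b} \<Longrightarrow> expectation (\<lambda>\<omega>. \<bar>?f q \<omega>\<bar>) \<le> r * (Q + drift_const) * sqrt (b - a)"
    using one by blast+
  have sw1: "integrable M (\<lambda>\<omega>. LBINT q:{a..b}. ?f q \<omega>)"
    by (rule expectation_set_integral_swap_L1(1)[OF fm one1 one2 ab])
  have sw2: "expectation (\<lambda>\<omega>. \<bar>LBINT q:{a..b}. ?f q \<omega>\<bar>) \<le> r * (Q + drift_const) * sqrt (b - a) * (b - a)"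
    by (rule expectation_set_integral_swap_L1(3)[OF fm one1 one2 ab])
  have Ae: "A \<omega> = (LBINT q:{a..b}. ?f q \<omega>)" if \<omega>: "\<omega> \<in> space M" for \<omega>
  proof -
    have sc: "continuous_on {a..b} (\<lambda>q. stock x t q \<omega>)"
      unfolding stock_def by (intro continuous_intros continuous_X[OF \<omega>])
    have e: "(LBINT q:{a..b}. r * exp (r * (q - a))) = exp (r * (b - a)) - exp (r * (a - a))"
      by (rule set_integral_FTC[OF ab]) (auto intro!: derivative_eq_intros continuous_intros)
    have "(LBINT q:{a..b}. ?f q \<omega>) = (LBINT q:{a..b}. r * stock x t q \<omega> - ?S \<omega> * (r * exp (r * (q - a))))"
      by (simp add: algebra_simps)
    also have "\<dots> = (LBINT q:{a..b}. r * stock x t q \<omega>) - (LBINT q:{a..b}. ?S \<omega> * (r * exp (r * (q - a))))"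
      by (rule set_integral_diff(2)) (auto intro!: borel_integrable_atLeastAtMost' continuous_intros sc)
    also have "(LBINT q:{a..b}. ?S \<omega> * (r * exp (r * (q - a)))) = ?S \<omega> * (exp (r * (b - a)) - 1)"
      unfolding set_integral_mult_right[where a="?S \<omega>"] e by simp
    finally show ?thesis unfolding A_def by (simp add: algebra_simps)
  qed
  show "integrable M A" using sw1 by (subst Bochner_Integration.integrable_cong[OF refl Ae])
  have "expectation (\<lambda>\<omega>. \<bar>A \<omega>\<bar>) = expectation (\<lambda>\<omega>. \<bar>LBINT q:{a..b}. ?f q \<omega>\<bar>)"
    by (rule Bochner_Integration.integral_cong[OF refl]) (simp add: Ae)
  then show "expectation (\<lambda>\<omega>. \<bar>A \<omega>\<bar>) \<le> r * (Q + drift_const) * sqrt (b - a) * (b - a)"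
    using sw2 by simp
qed

lemma ito_integral_stock:
  assumes ts: "0 \<le> t" "t \<le> s" "s \<le> T"
  shows "has_ito_integral M W (\<lambda>q \<omega>. \<sigma> * stock x t q \<omega>)
    (\<lambda>\<omega>. stock x t s \<omega> - stock x t t \<omega> - (LBINT q:{t..s}. r * stock x t q \<omega>)) t s"
  unfolding has_ito_integral_def
proof (intro conjI allI impI)
  have [measurable]: "(\<lambda>\<omega>. LBINT q:{t..s}. r * stock x t q \<omega>) \<in> borel_measurable M"
    by (rule borel_measurable_set_integral_time)
      (use stock_measurable in \<open>unfold case_prod_beta', measurable\<close>)
  have stock_M[measurable]: "stock x t q \<in> borel_measurable M" for q
    unfolding stock_def by measurable
  show I_meas: "(\<lambda>\<omega>. stock x t s \<omega> - stock x t t \<omega> - (LBINT q:{t..s}. r * stock x t q \<omega>)) \<in> borel_measurable M"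
    by measurable
  let ?I = "\<lambda>\<omega>. stock x t s \<omega> - stock x t t \<omega> - (LBINT q:{t..s}. r * stock x t q \<omega>)"
  fix \<epsilon> \<eta> :: real assume \<epsilon>: "\<epsilon> > 0" and \<eta>: "\<eta> > 0"
  define Q where "Q = exp (2 * x + (2 * r + \<sigma>\<^sup>2) * T)"
  define L where "L = 4 / \<epsilon>\<^sup>2 * (Q * step_const * T) + 2 / \<epsilon> * (r * (Q + drift_const) * T)"
  have Q: "0 < Q" by (simp add: Q_def)
  have L: "0 \<le> L" unfolding L_def using \<epsilon> Q const_nonneg r_pos T_pos
    by (intro add_nonneg_nonneg mult_nonneg_nonneg) auto
  \<comment> \<open>For mesh below \<open>e\<^sup>2 \<le> e\<close> the probability is at most \<open>L e\<close>: the martingale part is bounded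
    through the mesh, the drift part through its square root.\<close>
  define e where "e = min 1 (\<eta> / (L + 1))"
  have e: "0 < e" "e \<le> 1" "L * e < \<eta>"
  proof -
    show "0 < e" "e \<le> 1" using \<eta> L by (auto simp: e_def)
    have "L * e \<le> L * (\<eta> / (L + 1))" using L by (intro mult_left_mono) (auto simp: e_def)
    also have "\<dots> < \<eta>" using L \<eta> by (simp add: field_simps)
    finally show "L * e < \<eta>" .
  qed
  show "\<exists>\<delta>>0. \<forall>k \<tau>. is_partition t s k \<tau> \<and> (\<forall>i<k. \<tau> (Suc i) - \<tau> i < \<delta>) \<longrightarrow>
      measure M {\<omega> \<in> space M. \<bar>(\<Sum>i<k. \<sigma> * stock x t (\<tau> i) \<omega> * (W (\<tau> (Suc i)) \<omega> - W (\<tau> i) \<omega>)) - ?I \<omega>\<bar> > \<epsilon>} < \<eta>"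
  proof (intro exI[of _ "e\<^sup>2"] conjI allI impI)
    show "0 < e\<^sup>2" using e by simp
    fix k \<tau> assume "is_partition t s k \<tau> \<and> (\<forall>i<k. \<tau> (Suc i) - \<tau> i < e\<^sup>2)"
    then have part: "\<forall>i<k. \<tau> i < \<tau> (Suc i)" and ends: "\<tau> 0 = t" "\<tau> k = s"
      and mesh: "\<And>i. i < k \<Longrightarrow> \<tau> (Suc i) - \<tau> i < e\<^sup>2" by (auto simp: is_partition_def)
    let ?Y = "\<lambda>i \<omega>. step (\<tau> (Suc i) - \<tau> i) (W (\<tau> (Suc i)) \<omega> - W (\<tau> i) \<omega>)"
    let ?Z = "\<lambda>\<omega>. \<Sum>i<k. stock x t (\<tau> i) \<omega> * ?Y i \<omega>"
    let ?A = "\<lambda>i \<omega>. stock x t (\<tau> i) \<omega> * (1 - exp (r * (\<tau> (Suc i) - \<tau> i)))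
      + (LBINT q:{\<tau> i..\<tau> (Suc i)}. r * stock x t q \<omega>)"
    have range: "t \<le> \<tau> i" "\<tau> i \<le> s" "0 \<le> \<tau> i" "\<tau> i \<le> T" if "i \<le> k" for i
      using partition_mono[OF part, of 0 i] partition_mono[OF part that, of] that ends ts by auto
    have telescope: "j \<le> k \<Longrightarrow> (\<Sum>i<j. \<sigma> * stock x t (\<tau> i) \<omega> * (W (\<tau> (Suc i)) \<omega> - W (\<tau> i) \<omega>))
        - (stock x t (\<tau> j) \<omega> - stock x t t \<omega> - (LBINT q:{t..\<tau> j}. r * stock x t q \<omega>))
        = (\<Sum>i<j. stock x t (\<tau> i) \<omega> * ?Y i \<omega>) + (\<Sum>i<j. ?A i \<omega>)"
      if \<omega>: "\<omega> \<in> space M" for j \<omega>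
    proof (induction j)
      case 0 then show ?case by (simp add: ends)
    next
      case (Suc j)
      then have j: "j \<le> k" "j < k" by auto
      have "continuous_on {t..\<tau> (Suc j)} (\<lambda>q. r * stock x t q \<omega>)"
        unfolding stock_def by (intro continuous_intros continuous_X[OF \<omega>])
      from set_integral_combine[OF range(1)[OF j(1)] less_imp_le[OF part[rule_format, OF j(2)]] this]
      have c: "(LBINT q:{t..\<tau> (Suc j)}. r * stock x t q \<omega>)
        = (LBINT q:{t..\<tau> j}. r * stock x t q \<omega>) + (LBINT q:{\<tau> j..\<tau> (Suc j)}. r * stock x t q \<omega>)" .
      have st: "stock x t (\<tau> j) \<omega> * ?Y j \<omega> = \<sigma> * stock x t (\<tau> j) \<omega> * (W (\<tau> (Suc j)) \<omega> - W (\<tau> j) \<omega>)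
          - stock x t (\<tau> (Suc j)) \<omega> + stock x t (\<tau> j) \<omega> * exp (r * (\<tau> (Suc j) - \<tau> j))"
        unfolding stock_step[OF range(3)[OF j(1)] less_imp_le[OF part[rule_format, OF j(2)]], of x t \<omega>] step_def
        by (simp add: algebra_simps)
      show ?case using Suc.IH[OF j(1)] unfolding sum.lessThan_Suc st c
        by (simp only: algebra_simps mult_1_right)
    qed
    have Z: "?Z \<in> borel_measurable (F (\<tau> k)) \<and> integrable M (\<lambda>\<omega>. (?Z \<omega>)\<^sup>2) \<and>
        expectation (\<lambda>\<omega>. (?Z \<omega>)\<^sup>2) \<le> (\<Sum>i<k. Q * (step_const * (\<tau> (Suc i) - \<tau> i)\<^sup>2))"
      unfolding Q_def by (rule martingale_sum[OF ts(1) _ part]) (use ends ts in auto)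
    have len: "(\<Sum>i<k. \<tau> (Suc i) - \<tau> i) \<le> T"
      using sum_lessThan_telescope[of \<tau> k] ends ts by simp
    have len0: "0 \<le> \<tau> (Suc i) - \<tau> i" if "i < k" for i using part that by (simp add: less_imp_le)
    have "(\<Sum>i<k. Q * (step_const * (\<tau> (Suc i) - \<tau> i)\<^sup>2)) \<le> (\<Sum>i<k. Q * step_const * e * (\<tau> (Suc i) - \<tau> i))"
    proof (rule sum_mono)
      fix i assume "i \<in> {..<k}"
      then have i: "i < k" by simp
      have "\<tau> (Suc i) - \<tau> i \<le> e * e" using mesh[OF i] by (simp add: power2_eq_square)
      also have "\<dots> \<le> e * 1" using e by (intro mult_left_mono) auto
      finally have "(\<tau> (Suc i) - \<tau> i)\<^sup>2 \<le> e * (\<tau> (Suc i) - \<tau> i)"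
        unfolding power2_eq_square using len0[OF i] by (intro mult_right_mono) auto
      then have "Q * (step_const * (\<tau> (Suc i) - \<tau> i)\<^sup>2) \<le> Q * (step_const * (e * (\<tau> (Suc i) - \<tau> i)))"
        using Q const_nonneg by (intro mult_left_mono) auto
      then show "Q * (step_const * (\<tau> (Suc i) - \<tau> i)\<^sup>2) \<le> Q * step_const * e * (\<tau> (Suc i) - \<tau> i)"
        by (simp only: mult.assoc)
    qed
    also have "\<dots> \<le> Q * step_const * e * T"
      unfolding sum_distrib_left[symmetric] using Q const_nonneg e len by (intro mult_left_mono) auto
    finally have EZ: "expectation (\<lambda>\<omega>. (?Z \<omega>)\<^sup>2) \<le> Q * step_const * e * T" using Z by linarith
    have A: "integrable M (?A i) \<and> expectation (\<lambda>\<omega>. \<bar>?A i \<omega>\<bar>) \<le> r * (Q + drift_const) * e * (\<tau> (Suc i) - \<tau> i)"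
      if i: "i < k" for i
    proof -
      have ti: "t \<le> \<tau> i" "\<tau> i < \<tau> (Suc i)" "\<tau> (Suc i) \<le> T" using range[of i] range[of "Suc i"] i part by auto
      note d = drift_error[OF ts(1) ti, of x, folded Q_def]
      have "sqrt (\<tau> (Suc i) - \<tau> i) \<le> e"
        using mesh[OF i] e by (intro real_le_lsqrt) auto
      then have "r * (Q + drift_const) * sqrt (\<tau> (Suc i) - \<tau> i) * (\<tau> (Suc i) - \<tau> i)
          \<le> r * (Q + drift_const) * e * (\<tau> (Suc i) - \<tau> i)"
        using r_pos Q const_nonneg len0[OF i] by (intro mult_right_mono mult_left_mono) auto
      then show ?thesis using d by linarith
    qed
    let ?B = "\<lambda>\<omega>. \<Sum>i<k. ?A i \<omega>"
    have Bi: "integrable M ?B" using A by (intro Bochner_Integration.integrable_sum) auto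
    have "expectation (\<lambda>\<omega>. \<bar>?B \<omega>\<bar>) \<le> expectation (\<lambda>\<omega>. \<Sum>i<k. \<bar>?A i \<omega>\<bar>)"
      by (rule integral_mono) (use Bi A in \<open>auto intro!: Bochner_Integration.integrable_sum sum_abs\<close>)
    also have "\<dots> = (\<Sum>i<k. expectation (\<lambda>\<omega>. \<bar>?A i \<omega>\<bar>))"
      by (rule Bochner_Integration.integral_sum) (use A in auto)
    also have "\<dots> \<le> (\<Sum>i<k. r * (Q + drift_const) * e * (\<tau> (Suc i) - \<tau> i))"
      by (rule sum_mono) (use A in auto)
    also have "\<dots> \<le> r * (Q + drift_const) * e * T"
      unfolding sum_distrib_left[symmetric] using r_pos Q const_nonneg e len by (intro mult_left_mono) auto
    finally have EB: "expectation (\<lambda>\<omega>. \<bar>?B \<omega>\<bar>) \<le> r * (Q + drift_const) * e * T" .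
    let ?bad = "{\<omega> \<in> space M. \<bar>(\<Sum>i<k. \<sigma> * stock x t (\<tau> i) \<omega> * (W (\<tau> (Suc i)) \<omega> - W (\<tau> i) \<omega>)) - ?I \<omega>\<bar> > \<epsilon>}"
    let ?g = "\<lambda>\<omega>. 4 / \<epsilon>\<^sup>2 * (?Z \<omega>)\<^sup>2 + 2 / \<epsilon> * \<bar>?B \<omega>\<bar>"
    have "prob ?bad \<le> expectation ?g"
    proof (rule prob_le_expectation)
      show "integrable M ?g" using Z Bi by simp
      have [measurable]: "W (\<tau> i) \<in> borel_measurable M" if "i \<le> k" for i
        using W_measurable_M range(3)[OF that] by simp
      have sm: "(\<lambda>\<omega>. \<Sum>i<k. \<sigma> * stock x t (\<tau> i) \<omega> * (W (\<tau> (Suc i)) \<omega> - W (\<tau> i) \<omega>)) \<in> borel_measurable M"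
        by (intro borel_measurable_sum borel_measurable_times borel_measurable_diff) auto
      show "?bad \<in> events"
        by (rule borel_measurable_less[OF borel_measurable_const borel_measurable_abs[OF borel_measurable_diff[OF sm I_meas]]])
      show "0 \<le> ?g \<omega>" for \<omega>
        using \<epsilon> by (intro add_nonneg_nonneg mult_nonneg_nonneg zero_le_power2 abs_ge_zero) auto
      fix \<omega> assume bad: "\<omega> \<in> ?bad"
      then have "\<omega> \<in> space M" by simp
      from telescope[OF this order_refl] bad have big: "\<epsilon> < \<bar>?Z \<omega> + ?B \<omega>\<bar>"
        unfolding ends mem_Collect_eq by simp
      have "1 \<le> 4 / \<epsilon>\<^sup>2 * z\<^sup>2 + 2 / \<epsilon> * \<bar>y\<bar>" if "\<epsilon> < \<bar>z + y\<bar>" for z y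
      proof -
        from that consider "\<epsilon> / 2 \<le> \<bar>z\<bar>" | "\<epsilon> / 2 \<le> \<bar>y\<bar>" by linarith
        then show ?thesis
        proof cases
          case 1
          then have "(\<epsilon> / 2)\<^sup>2 \<le> \<bar>z\<bar>\<^sup>2" using \<epsilon> by (intro power_mono) auto
          then have "1 \<le> 4 / \<epsilon>\<^sup>2 * z\<^sup>2" using \<epsilon> by (simp add: field_simps power2_eq_square)
          moreover have "0 \<le> 2 / \<epsilon> * \<bar>y\<bar>" using \<epsilon> by simp
          ultimately show ?thesis by linarith
        next
          case 2
          then have "1 \<le> 2 / \<epsilon> * \<bar>y\<bar>" using \<epsilon> by (simp add: field_simps)
          moreover have "0 \<le> 4 / \<epsilon>\<^sup>2 * z\<^sup>2" by simp
          ultimately show ?thesis by linarith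
        qed
      qed
      from this[OF big] show "1 \<le> ?g \<omega>" .
    qed
    also have "\<dots> = 4 / \<epsilon>\<^sup>2 * expectation (\<lambda>\<omega>. (?Z \<omega>)\<^sup>2) + 2 / \<epsilon> * expectation (\<lambda>\<omega>. \<bar>?B \<omega>\<bar>)"
      using Z Bi by simp
    also have "\<dots> \<le> 4 / \<epsilon>\<^sup>2 * (Q * step_const * e * T) + 2 / \<epsilon> * (r * (Q + drift_const) * e * T)"
      using \<epsilon> by (intro add_mono mult_left_mono EZ EB) auto
    also have "\<dots> = L * e" by (simp add: L_def algebra_simps)
    also have "\<dots> < \<eta>" by (rule e(3))
    finally show "prob ?bad < \<eta>" .
  qed
qed

lemma stock_price_stock:
  assumes "0 < S0" "t \<in> {0..T}"
  shows "stock_price M F W r \<sigma> t T S0 (stock (ln S0) t)"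
  unfolding stock_price_def
proof (intro conjI ballI)
  have start: "stock (ln S0) t t \<omega> = S0" for \<omega> using assms by (simp add: stock_def)
  show "stock (ln S0) t s \<in> borel_measurable (F s)" if "s \<in> {t..T}" for s
    using stock_adapted assms that by auto
  show "stock (ln S0) t t \<omega> = S0" for \<omega> by (rule start)
  show "continuous_on {t..T} (\<lambda>s. stock (ln S0) t s \<omega>)" if "\<omega> \<in> space M" for \<omega>
    unfolding stock_def by (intro continuous_intros continuous_X[OF that])
  show "0 < stock (ln S0) t s \<omega>" for s \<omega> by (simp add: stock_def)
  show "has_ito_integral M W (\<lambda>q \<omega>. \<sigma> * stock (ln S0) t q \<omega>)
      (\<lambda>\<omega>. stock (ln S0) t s \<omega> - S0 - (LBINT q:{t..s}. r * stock (ln S0) t q \<omega>)) t s"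
    if "s \<in> {t..T}" for s
    using ito_integral_stock[of t s "ln S0"] assms that by (simp add: start)
qed

end

section \<open>Value functions and the optimal value as mild solutions\<close>

lemma log_payoff_continuous: "continuous_on A (log_payoff K)"
  unfolding log_payoff_def put_payoff_def by (intro continuous_intros)

lemma log_payoff_bounds:
  assumes "0 < K" shows "0 \<le> log_payoff K x" "log_payoff K x \<le> K"
  using assms by (auto simp: log_payoff_def put_payoff_def)

lemma hamiltonian_arg_max:
  assumes lam: "0 < lam" and m: "is_arg_max (\<lambda>q. hamiltonian K lam x q v) (\<lambda>q. 0 < q) p"
  shows "p = exp (- (v - log_payoff K x) / lam)"
proof (rule ccontr)
  define q where "q = exp (- (v - log_payoff K x) / lam)"
  assume "p \<noteq> exp (- (v - log_payoff K x) / lam)"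
  then have pq: "p \<noteq> q" by (simp add: q_def)
  have p: "0 < p" and max: "\<And>y. 0 < y \<Longrightarrow> \<not> hamiltonian K lam x p v < hamiltonian K lam x y v"
    using m by (auto simp: is_arg_max_def)
  have q: "0 < q" and hv: "log_payoff K x - v = lam * ln q" using lam by (auto simp: q_def)
  have H: "hamiltonian K lam x y v = lam * (y * ln q + y - y * ln y)" for y
    unfolding hamiltonian_def entropy_reg_def hv by (simp add: algebra_simps)
  have "ln (q / p) < q / p - 1"
    using ln_le_minus_one[of "q / p"] ln_eq_minus_one[of "q / p"] p q pq by fastforce
  then have "p * ln (q / p) < q - p" using p by (simp add: field_simps)
  then have "p * ln q + p - p * ln p < q" using p q by (simp add: ln_div algebra_simps)
  then have "lam * (p * ln q + p - p * ln p) < lam * (q * ln q + q - q * ln q)" using lam by simp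
  then show False using max[OF q] unfolding H by blast
qed

lemma power_over_fact_derivative:
  fixes a b c :: real
  shows "((\<lambda>s. - (b * (a * (c - s)) ^ Suc n / fact (Suc n))) has_real_derivative
    a * (b * (a * (c - s)) ^ n / fact n)) (at s within S)"
proof -
  have "((\<lambda>s. a * (c - s)) has_real_derivative - a) (at s within S)"
    by (auto intro!: derivative_eq_intros)
  from DERIV_minus[OF DERIV_cdivide[OF DERIV_cmult[OF DERIV_power_Suc[OF this, of n], of b], of "fact (Suc n)"]]
  show ?thesis
  proof (rule DERIV_cong)
    have "real (Suc n) \<noteq> 0" by simp
    then show "- (b * ((1 + of_nat n) * (- a * (a * (c - s)) ^ n)) / fact (Suc n)) = a * (b * (a * (c - s)) ^ n / fact n)"
      by (simp add: divide_simps)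
  qed
qed

lemma sup_norm_upper:
  assumes "bounded_on_strip T g" "t \<in> {0..T}" shows "\<bar>g x t\<bar> \<le> sup_norm T g"
proof -
  from assms(1) obtain B where "\<forall>y \<in> (\<lambda>(x, t). g x t) ` (UNIV \<times> {0..T}). norm y \<le> B"
    unfolding bounded_on_strip_def bounded_iff by blast
  then have "bdd_above ((\<lambda>(x, t). \<bar>g x t\<bar>) ` (UNIV \<times> {0..T}))"
    by (intro bdd_aboveI2[of _ _ B]) auto
  from cSUP_upper[OF _ this, of "(x, t)"] show ?thesis using assms(2) by (simp add: sup_norm_def)
qed

lemma strip_bound:
  assumes "0 < T" "\<And>x t. t \<in> {0..T} \<Longrightarrow> \<bar>g x t\<bar> \<le> B"
  shows "bounded_on_strip T g" "sup_norm T g \<le> B"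
proof -
  show "bounded_on_strip T g"
    unfolding bounded_on_strip_def bounded_iff using assms(2) by (intro exI[of _ B]) auto
  show "sup_norm T g \<le> B" unfolding sup_norm_def using assms by (intro cSUP_least) auto
qed

context gbm_claim begin

lemma mild_cong:
  assumes "\<And>y s. s \<in> {0..T} \<Longrightarrow> f y s = f' y s" "\<And>y s. s \<in> {0..T} \<Longrightarrow> v y s = v' y s"
  shows "mild f v \<longleftrightarrow> mild f' v'"
proof -
  have "pay f x t \<omega> = pay f' x t \<omega>" if "t \<in> {0..T}" for x t \<omega>
    unfolding pay_def using assms(1) that
    by (intro arg_cong2[where f="(+)"] refl set_lebesgue_integral_cong) auto
  then have "expectation (pay f x t) = expectation (pay f' x t)" if "t \<in> {0..T}" for x t
    using that by (metis ext)
  then show ?thesis using assms(2) by (simp add: mild_def)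
qed

text \<open>
  Two mild solutions with different sources are compared along one intensity \<open>k\<close>. Discount and
  survival weight are at most \<open>1\<close>, so an excess \<open>\<beta>\<close> of the first source costs at most its integral.
\<close>

lemma killed_comparison:
  assumes 1: "cbf f1" "cbf v1" "mild f1 v1" and 2: "cbf f2" "cbf v2" "mild f2 v2"
    and k: "cbf k" "\<And>x t. 0 \<le> k x t" and t: "t \<in> {0..T}"
    and \<beta>: "continuous_on {t..T} \<beta>" "\<And>s. s \<in> {t..T} \<Longrightarrow> 0 \<le> \<beta> s"
    and le: "\<And>y s. s \<in> {t..T} \<Longrightarrow> f1 y s + k y s * v1 y s \<le> f2 y s + k y s * v2 y s + \<beta> s"
  shows "v1 x t \<le> v2 x t + (LBINT s:{t..T}. \<beta> s)"
proof -
  let ?A = "\<lambda>\<omega>. exp (- r * (T - t)) * h (X x t T \<omega>) * weight k x t T \<omega>"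
  let ?e = "\<lambda>g s \<omega>. exp (- r * (s - t)) * g (X x t s \<omega>) s * weight k x t s \<omega>"
  let ?g1 = "\<lambda>y s. f1 y s + k y s * v1 y s" and ?g2 = "\<lambda>y s. f2 y s + k y s * v2 y s"
  have g: "cbf ?g1" "cbf ?g2" using 1 2 k by (auto intro!: cbf_intros)
  have w01: "0 \<le> weight k x t s \<omega>" "weight k x t s \<omega> \<le> 1" for s \<omega>
    using weight_le_one[of k, OF k(2)] less_imp_le[OF weight_pos] by auto
  have wM[measurable]: "weight k x t T \<in> borel_measurable M"
    using t by (intro measurable_F_M[OF weight_adapted[OF k(1)]]) auto
  have A_int: "integrable M ?A"
  proof (rule integrable_bounded[where B="1 * H * 1"])
    show "\<bar>?A \<omega>\<bar> \<le> 1 * H * 1" if "\<omega> \<in> space M" for \<omega>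
      unfolding abs_mult using t r_pos w01[of T \<omega>] h_bound H_nonneg
      by (intro mult_mono) auto
  qed measurable
  have e_meas: "(\<lambda>(s, \<omega>). ?e g s \<omega>) \<in> borel_measurable (borel \<Otimes>\<^sub>M M)" if "cbf g" for g
    using running_measurable[OF that, of t x] weight_measurable[OF k(1), of x t]
    unfolding case_prod_beta' by measurable
  have e_cont: "continuous_on {t..T} (\<lambda>s. ?e g s \<omega>)" if "cbf g" "\<omega> \<in> space M" for g \<omega>
    by (intro continuous_on_mult running_continuous[OF that] weight_continuous[OF k(1) that(2)])
  have e_int: "integrable M (\<lambda>\<omega>. LBINT s:{t..T}. ?e g s \<omega>)" if gc: "cbf g" for g
  proof -
    obtain C where C: "0 < C" "\<And>x t. \<bar>g x t\<bar> \<le> C" using gc by (rule cbf_obtain_bound) blast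
    show ?thesis
    proof (rule expectation_set_integral_swap(1)[OF e_meas[OF gc]])
      show "\<bar>?e g s \<omega>\<bar> \<le> C * 1" if "s \<in> {t..T}" for s \<omega>
        unfolding abs_mult[of _ "weight k x t s \<omega>"]
        by (intro mult_mono running_bound[OF C(2)]) (use that w01[of s \<omega>] C in auto)
    qed (use t in simp)
  qed
  let ?B = "LBINT s:{t..T}. \<beta> s"
  have "v1 x t = expectation (\<lambda>\<omega>. ?A \<omega> + (LBINT s:{t..T}. ?e ?g1 s \<omega>))"
    by (rule killed_representation[OF 1 k t])
  also have "\<dots> \<le> expectation (\<lambda>\<omega>. ?A \<omega> + (LBINT s:{t..T}. ?e ?g2 s \<omega>) + ?B)"
  proof (rule integral_mono)
    show "integrable M (\<lambda>\<omega>. ?A \<omega> + (LBINT s:{t..T}. ?e ?g1 s \<omega>))"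
      by (rule Bochner_Integration.integrable_add[OF A_int e_int[OF g(1)]])
    show "integrable M (\<lambda>\<omega>. ?A \<omega> + (LBINT s:{t..T}. ?e ?g2 s \<omega>) + ?B)"
      by (rule Bochner_Integration.integrable_add[OF Bochner_Integration.integrable_add[OF A_int e_int[OF g(2)]]])
        simp
    fix \<omega> assume \<omega>: "\<omega> \<in> space M"
    note i1 = borel_integrable_atLeastAtMost'[OF e_cont[OF g(1) \<omega>]]
    note i2 = borel_integrable_atLeastAtMost'[OF e_cont[OF g(2) \<omega>]]
    note i\<beta> = borel_integrable_atLeastAtMost'[OF \<beta>(1)]
    have "(LBINT s:{t..T}. ?e ?g1 s \<omega>) \<le> (LBINT s:{t..T}. ?e ?g2 s \<omega> + \<beta> s)"
    proof (rule set_integral_mono[OF i1 set_integral_add(1)[OF i2 i\<beta>]])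
      fix s assume s: "s \<in> {t..T}"
      let ?d = "exp (- r * (s - t))" and ?w = "weight k x t s \<omega>" and ?y = "X x t s \<omega>"
      have d: "0 \<le> ?d" "?d \<le> 1" using s r_pos by auto
      have "?d * ?g1 ?y s * ?w \<le> ?d * (?g2 ?y s + \<beta> s) * ?w"
        by (intro mult_right_mono mult_left_mono le s d w01)
      also have "\<dots> = ?d * ?g2 ?y s * ?w + ?d * \<beta> s * ?w" by (simp add: distrib_left distrib_right)
      also have "?d * \<beta> s * ?w \<le> 1 * \<beta> s * 1"
        by (intro mult_mono d w01) (use \<beta>(2)[OF s] d in auto)
      finally show "?d * ?g1 ?y s * ?w \<le> ?d * ?g2 ?y s * ?w + \<beta> s" by simp
    qed
    also have "\<dots> = (LBINT s:{t..T}. ?e ?g2 s \<omega>) + ?B" by (rule set_integral_add(2)[OF i2 i\<beta>])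
    finally show "?A \<omega> + (LBINT s:{t..T}. ?e ?g1 s \<omega>) \<le> ?A \<omega> + (LBINT s:{t..T}. ?e ?g2 s \<omega>) + ?B"
      by simp
  qed
  also have "\<dots> = expectation (\<lambda>\<omega>. ?A \<omega> + (LBINT s:{t..T}. ?e ?g2 s \<omega>)) + ?B"
    using Bochner_Integration.integral_add[OF Bochner_Integration.integrable_add[OF A_int e_int[OF g(2)]],
        of "\<lambda>_. ?B"] by (simp add: prob_space)
  also have "expectation (\<lambda>\<omega>. ?A \<omega> + (LBINT s:{t..T}. ?e ?g2 s \<omega>)) = v2 x t"
    by (rule killed_representation[OF 2 k t, symmetric])
  finally show ?thesis .
qed

text \<open>
  The extension of a function on \<open>\<real> \<times> [0,T]\<close> that is constant in time outside \<open>[0,T]\<close>.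
\<close>

definition clamp :: "(real \<Rightarrow> real \<Rightarrow> real) \<Rightarrow> real \<Rightarrow> real \<Rightarrow> real" where
  "clamp g x t = g x (max 0 (min T t))"

lemma clamp_strip [simp]: "t \<in> {0..T} \<Longrightarrow> clamp g x t = g x t"
  by (simp add: clamp_def)

lemma cbf_clampI:
  assumes c: "continuous_on (UNIV \<times> {0..T}) (\<lambda>z. g (fst z) (snd z))"
    and b: "\<And>x t. t \<in> {0..T} \<Longrightarrow> \<bar>g x t\<bar> \<le> B"
  shows "cbf (clamp g)"
proof -
  have r: "max 0 (min T t) \<in> {0..T}" for t using T_pos by auto
  have "continuous_on UNIV (\<lambda>z. (\<lambda>p. g (fst p) (snd p)) (fst z, max 0 (min T (snd z))))"
    by (rule continuous_on_compose2[OF c]) (use r in \<open>auto intro!: continuous_intros\<close>)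
  then show ?thesis unfolding cbf_def clamp_def using b[OF r] by auto
qed

lemma cbf_clamp:
  assumes "cbf g" shows "cbf (clamp g)"
proof -
  obtain B where B: "0 < B" "\<And>x t. \<bar>g x t\<bar> \<le> B" using assms by (rule cbf_obtain_bound) blast
  show ?thesis
    by (rule cbf_clampI[OF _ B(2)]) (use assms in \<open>auto simp: cbf_def intro: continuous_on_subset\<close>)
qed

end

text \<open>
  The put payoff with strike \<open>K\<close>, and the temperature \<open>lam\<close> of the entropy regularisation.
\<close>

locale put_option = gbm_claim M F W r \<sigma> T "log_payoff K" K
  for M :: "'a measure" and F :: "real \<Rightarrow> 'a measure" and W :: "real \<Rightarrow> 'a \<Rightarrow> real"
    and r \<sigma> T K :: real +
  fixes lam :: real
  assumes K_pos: "0 < K" and lam_pos: "0 < lam"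
begin

lemma payoff_cbf: "cbf (\<lambda>x t. log_payoff K x)"
  unfolding cbf_def using log_payoff_bounds[OF K_pos]
  by (auto intro!: continuous_on_compose2[OF log_payoff_continuous[of UNIV]] continuous_intros exI[of _ K])

lemma stopping_weight_weight:
  assumes k: "cbf k" and \<pi>: "\<And>y s. s \<in> {0..T} \<Longrightarrow> \<pi> y s = k y s" and t: "t \<in> {0..T}"
  shows "stopping_weight M \<pi> (stock x t) t T 1 (weight k x t)"
  unfolding stopping_weight_def
  using weight_derivative[OF k] \<pi> t by (auto simp: stock_def)

text \<open>
  The value function of a strategy \<open>k\<close> with running reward \<open>c\<close> is a mild solution with source
  \<open>c - k v\<close>: the solution of the Volterra equation equals the expected reward by the killed
  representation, as its source plus \<open>k v\<close> is \<open>c\<close>.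
\<close>

lemma value_function_mild:
  assumes val: "is_value_function M F W r \<sigma> K lam T \<pi> v"
    and k: "cbf k" "\<And>x t. 0 \<le> k x t" and c: "cbf c"
    and \<pi>: "\<And>y s. s \<in> {0..T} \<Longrightarrow> \<pi> y s = k y s"
    and ck: "\<And>y s. s \<in> {0..T} \<Longrightarrow> c y s = log_payoff K y * k y s + lam * entropy_reg (k y s)"
  shows "cbf (clamp v) \<and> mild (\<lambda>x t. c x t - k x t * clamp v x t) (clamp v)"
proof -
  obtain w where w: "cbf w" and mild: "mild (\<lambda>x t. c x t - k x t * w x t) w"
    using exists_mild_feedback[OF c k(1)] by blast
  have vw: "v x t = w x t" if t: "t \<in> {0..T}" for x t
  proof -
    have "stock_price M F W r \<sigma> t T (exp x) (stock x t)"
      using stock_price_stock[of "exp x", OF _ t] by simp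
    moreover have "0 < exp x" "(0::real) < 1" by simp_all
    ultimately have "1 * v (ln (exp x)) t
        = expectation (\<lambda>\<omega>. reward r K lam t T \<pi> (stock x t) (weight k x t) \<omega>)"
      using val t stopping_weight_weight[OF k(1) \<pi> t] unfolding is_value_function_def by blast
    also have "\<dots> = expectation (\<lambda>\<omega>. exp (- r * (T - t)) * log_payoff K (X x t T \<omega>) * weight k x t T \<omega>
      + (LBINT s:{t..T}. exp (- r * (s - t))
          * ((c (X x t s \<omega>) s - k (X x t s \<omega>) s * w (X x t s \<omega>) s)
            + k (X x t s \<omega>) s * w (X x t s \<omega>) s) * weight k x t s \<omega>))"
    proof (rule Bochner_Integration.integral_cong[OF refl])
      fix \<omega>
      have "(LBINT s:{t..T}. exp (- r * (s - t)) * (put_payoff K (stock x t s \<omega>) * \<pi> (ln (stock x t s \<omega>)) s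
            + lam * entropy_reg (\<pi> (ln (stock x t s \<omega>)) s)) * weight k x t s \<omega>)
          = (LBINT s:{t..T}. exp (- r * (s - t))
          * ((c (X x t s \<omega>) s - k (X x t s \<omega>) s * w (X x t s \<omega>) s)
            + k (X x t s \<omega>) s * w (X x t s \<omega>) s) * weight k x t s \<omega>)"
        by (rule set_lebesgue_integral_cong) (use t ck \<pi> in \<open>auto simp: stock_def log_payoff_def\<close>)
      then show "reward r K lam t T \<pi> (stock x t) (weight k x t) \<omega>
          = exp (- r * (T - t)) * log_payoff K (X x t T \<omega>) * weight k x t T \<omega>
      + (LBINT s:{t..T}. exp (- r * (s - t))
          * ((c (X x t s \<omega>) s - k (X x t s \<omega>) s * w (X x t s \<omega>) s)
            + k (X x t s \<omega>) s * w (X x t s \<omega>) s) * weight k x t s \<omega>)"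
        unfolding reward_def by (simp only: stock_def log_payoff_def add.commute)
    qed
    also have "\<dots> = w x t"
      by (rule killed_representation[OF _ w mild k t, symmetric]) (intro cbf_intros c k w)
    finally show ?thesis by simp
  qed
  have e: "clamp v = clamp w"
    using vw T_pos by (auto simp: clamp_def intro!: ext vw)
  have "mild (\<lambda>x t. c x t - k x t * clamp v x t) (clamp v) \<longleftrightarrow> mild (\<lambda>x t. c x t - k x t * w x t) w"
    by (rule mild_cong) (simp_all add: e)
  then show ?thesis using mild cbf_clamp[OF w] by (simp add: e)
qed

lemma optimal_value_mild:
  assumes "is_optimal_value r \<sigma> K lam T v"
  shows "cbf (clamp v)" "mild (\<lambda>x t. lam * exp (- (clamp v x t - log_payoff K x) / lam)) (clamp v)"
proof -
  obtain vt vx vxx where vt: "continuous_on (UNIV \<times> {0<..<T}) (\<lambda>(x, t). vt x t)"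
    and d: "\<And>x t. t \<in> {0<..<T} \<Longrightarrow>
           ((\<lambda>s. v x s) has_real_derivative vt x t) (at t) \<and>
           ((\<lambda>y. v y t) has_real_derivative vx x t) (at x) \<and>
           ((\<lambda>y. vx y t) has_real_derivative vxx x t) (at x) \<and>
           vt x t + (1/2 * \<sigma>\<^sup>2 * vxx x t + (r - 1/2 * \<sigma>\<^sup>2) * vx x t - r * v x t)
             + lam * exp (- (v x t - log_payoff K x) / lam) = 0"
    using assms unfolding is_optimal_value_def by blast
  have vc: "continuous_on (UNIV \<times> {0..T}) (\<lambda>(x, t). v x t)"
    and vT: "\<And>x. v x T = log_payoff K x"
    and vb: "\<And>x t. t \<in> {0..T} \<Longrightarrow> 0 \<le> v x t \<and> v x t \<le> K + lam * (T - t)"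
    using assms unfolding is_optimal_value_def by blast+
  have vb': "\<bar>v x t\<bar> \<le> K + lam * T" if "t \<in> {0..T}" for x t
  proof -
    have "lam * (T - t) \<le> lam * T" using lam_pos that by (intro mult_left_mono) auto
    then show ?thesis using vb[OF that, of x] by simp
  qed
  show vcbf: "cbf (clamp v)"
    by (rule cbf_clampI[OF _ vb']) (use vc in \<open>auto simp: case_prod_beta'\<close>)
  let ?f = "\<lambda>x t. lam * exp (- (clamp v x t - log_payoff K x) / lam)"
  have "cbf (\<lambda>x t. lam * exp ((- (clamp v x t - log_payoff K x)) * (1 / lam)))"
    by (intro cbf_intros vcbf payoff_cbf)
  then have f: "cbf ?f" by simp
  show "mild ?f (clamp v)"
    unfolding mild_def
  proof (intro allI ballI)
    fix x t assume t: "t \<in> {0..T}"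
    show "clamp v x t = expectation (pay ?f x t)"
    proof (cases "t = T")
      case True
      have "pay ?f x T = (\<lambda>\<omega>. log_payoff K x)" by (simp add: pay_def fun_eq_iff)
      then show ?thesis using True T_pos by (simp add: vT prob_space)
    next
      case False
      interpret C: classical_solution M F W r \<sigma> T "log_payoff K" K v vt vx vxx ?f "K + lam * T" x t
      proof
        show "continuous_on (UNIV \<times> {0..T}) (\<lambda>z. v (fst z) (snd z))" using vc by (simp add: case_prod_beta')
        show "continuous_on (UNIV \<times> {0<..<T}) (\<lambda>z. vt (fst z) (snd z))" using vt by (simp add: case_prod_beta')
        show "vt y s + (\<sigma>\<^sup>2 / 2 * vxx y s + (r - \<sigma>\<^sup>2 / 2) * vx y s - r * v y s) + ?f y s = 0"
          if "s \<in> {0<..<T}" for y s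
          using d[OF that, of y] that by simp
      qed (use d vb' vT f t False in auto)
      show ?thesis using C.value_eq_expectation_pay t by simp
    qed
  qed
qed

end

section \<open>Policy improvement and the error recursion\<close>

locale policy_scheme = put_option M F W r \<sigma> T K lam
  for M :: "'a measure" and F :: "real \<Rightarrow> 'a measure" and W :: "real \<Rightarrow> 'a \<Rightarrow> real"
    and r \<sigma> T K lam :: real +
  fixes u0 :: "real \<Rightarrow> real" and \<pi> u :: "nat \<Rightarrow> real \<Rightarrow> real \<Rightarrow> real" and ulam :: "real \<Rightarrow> real \<Rightarrow> real"
  assumes u0: "u0 \<in> bcontfun"
    and iter: "policy_iteration M F W r \<sigma> K lam T u0 \<pi> u"
    and opt: "is_optimal_value r \<sigma> K lam T ulam"
begin

text \<open>
  \<open>w n\<close> is the iterate \<open>u n\<close>, and \<open>k n\<close> the strategy computed from it, which is \<open>\<pi> (n + 1)\<close>. With this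
  strategy the running reward is \<open>k n (lam + w n)\<close>.
\<close>

definition w :: "nat \<Rightarrow> real \<Rightarrow> real \<Rightarrow> real" where "w n = clamp (u n)"

definition k :: "nat \<Rightarrow> real \<Rightarrow> real \<Rightarrow> real" where
  "k n x t = exp (- (w n x t - log_payoff K x) / lam)"

lemma k_pos: "0 < k n x t" by (simp add: k_def)

lemma k_cbf: assumes "cbf (w n)" shows "cbf (k n)"
proof -
  have "cbf (\<lambda>x t. exp ((- (w n x t - log_payoff K x)) * (1 / lam)))"
    by (intro cbf_intros assms payoff_cbf)
  then show ?thesis by (simp add: k_def[abs_def])
qed

lemma w_strip: "t \<in> {0..T} \<Longrightarrow> w n x t = u n x t" by (simp add: w_def)

lemma w_Suc:
  assumes "cbf (w n)"
  shows "cbf (w (Suc n)) \<and>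
    mild (\<lambda>x t. k n x t * (lam + w n x t) - k n x t * w (Suc n) x t) (w (Suc n))"
  unfolding w_def[of "Suc n"]
proof (rule value_function_mild)
  show "is_value_function M F W r \<sigma> K lam T (\<pi> (Suc n)) (u (Suc n))"
    using iter by (simp add: policy_iteration_def)
  show "cbf (k n)" by (rule k_cbf[OF assms])
  show "cbf (\<lambda>x t. k n x t * (lam + w n x t))" by (intro cbf_intros assms k_cbf)
  show "0 \<le> k n x t" for x t by (simp add: k_def)
  show "\<pi> (Suc n) y s = k n y s" if "s \<in> {0..T}" for y s
    using iter that hamiltonian_arg_max[OF lam_pos, of K y "u n y s"]
    unfolding policy_iteration_def k_def w_strip[OF that] by blast
  show "k n y s * (lam + w n y s) = log_payoff K y * k n y s + lam * entropy_reg (k n y s)" for y s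
  proof -
    have h: "log_payoff K y = w n y s + lam * ln (k n y s)" using lam_pos by (simp add: k_def)
    show ?thesis unfolding entropy_reg_def h by (simp add: algebra_simps)
  qed
qed

lemma w_cbf: "cbf (w n)"
proof (induction n)
  case 0
  obtain g :: "real \<Rightarrow>\<^sub>C real" where g: "u0 = apply_bcontfun g" using u0 by (rule bcontfunE)
  have "cbf (\<lambda>x t. u0 x)" unfolding cbf_def g
    using Bounded_Continuous_Function.norm_bounded[of g]
    by (auto intro!: continuous_on_compose2[OF continuous_on_apply_bcontfun[of UNIV g]] continuous_intros)
  moreover have "w 0 = (\<lambda>x t. u0 x)"
    using iter T_pos by (auto simp: w_def clamp_def policy_iteration_def intro!: ext)
  ultimately show ?case by simp
next
  case (Suc n) then show ?case using w_Suc by blast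
qed

lemma w_mild: "mild (\<lambda>x t. k n x t * (lam + w n x t) - k n x t * w (Suc n) x t) (w (Suc n))"
  using w_Suc[OF w_cbf] by blast

lemma w_source_cbf: "cbf (\<lambda>x t. k n x t * (lam + w n x t) - k n x t * w (Suc n) x t)"
  by (intro cbf_intros w_cbf k_cbf)

lemma exp_tangent: "1 - z \<le> exp (- z)" for z :: real
  using exp_ge_add_one_self[of "- z"] by simp

text \<open>
  Policy improvement, by comparison along the new intensity: the Hamiltonian at
  \<open>w (n + 1)\<close> is maximal for the strategy \<open>k (n + 1)\<close>, which amounts to \<open>1 - z \<le> e\<^bsup>-z\<^esup>\<close>.
\<close>

lemma w_mono_step:
  assumes t: "t \<in> {0..T}" shows "w (Suc n) x t \<le> w (Suc (Suc n)) x t"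
proof -
  have "w (Suc n) x t \<le> w (Suc (Suc n)) x t + (LBINT s:{t..T}. 0)"
  proof (rule killed_comparison[OF w_source_cbf w_cbf w_mild w_source_cbf w_cbf w_mild k_cbf[OF w_cbf, of "Suc n"] _ t])
    fix y s
    define z where "z = (w (Suc n) y s - w n y s) / lam"
    have wz: "w n y s = w (Suc n) y s - lam * z" using lam_pos by (simp add: z_def)
    have kz: "k (Suc n) y s = k n y s * exp (- z)"
      unfolding k_def z_def exp_add[symmetric] using lam_pos by (simp add: field_simps)
    have "lam * k n y s * (1 - z) \<le> lam * k n y s * exp (- z)"
      using lam_pos k_pos[of n y s] by (intro mult_left_mono exp_tangent) simp
    then show "k n y s * (lam + w n y s) - k n y s * w (Suc n) y s + k (Suc n) y s * w (Suc n) y s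
        \<le> k (Suc n) y s * (lam + w (Suc n) y s) - k (Suc n) y s * w (Suc (Suc n)) y s
          + k (Suc n) y s * w (Suc (Suc n)) y s + 0"
      unfolding wz kz by (simp add: algebra_simps)
  qed (auto simp: less_imp_le[OF k_pos])
  then show ?thesis by simp
qed

lemma w_one_le:
  assumes t: "t \<in> {0..T}" shows "w 1 x t \<le> w (Suc n) x t"
proof (induction n)
  case (Suc n) then show ?case using w_mono_step[OF t, of n x] by simp
qed simp

abbreviation v where "v \<equiv> clamp ulam"

lemmas v_cbf = optimal_value_mild(1)[OF opt] and v_mild = optimal_value_mild(2)[OF opt]

lemma v_source_cbf: "cbf (\<lambda>x t. lam * exp (- (v x t - log_payoff K x) / lam))"
proof -
  have "cbf (\<lambda>x t. lam * exp ((- (v x t - log_payoff K x)) * (1 / lam)))"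
    by (intro cbf_intros v_cbf payoff_cbf)
  then show ?thesis by simp
qed

text \<open>
  The distance between the exponential nonlinearity at \<open>v\<close> and its linearisation at the \<open>n\<close>-th
  iterate.
\<close>

lemma bregman:
  "lam * exp (- (v y s - log_payoff K y) / lam) + k n y s * v y s - k n y s * (lam + w n y s)
    = lam * k n y s * (exp (- ((v y s - w n y s) / lam)) - 1 + (v y s - w n y s) / lam)"
proof -
  define z where "z = (v y s - w n y s) / lam"
  have vz: "v y s = w n y s + lam * z" using lam_pos by (simp add: z_def)
  have kz: "exp (- (v y s - log_payoff K y) / lam) = k n y s * exp (- z)"
    unfolding k_def z_def exp_add[symmetric] using lam_pos by (simp add: field_simps)
  show ?thesis unfolding kz z_def[symmetric] unfolding vz by (simp add: algebra_simps)
qed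

lemma w_le_v:
  assumes t: "t \<in> {0..T}" shows "w (Suc n) x t \<le> v x t"
proof -
  have "w (Suc n) x t \<le> v x t + (LBINT s:{t..T}. 0)"
  proof (rule killed_comparison[OF w_source_cbf w_cbf w_mild v_source_cbf v_cbf v_mild k_cbf[OF w_cbf, of n] _ t])
    fix y s
    have "0 \<le> lam * k n y s * (exp (- ((v y s - w n y s) / lam)) - 1 + (v y s - w n y s) / lam)"
      using lam_pos k_pos[of n y s] exp_tangent[of "(v y s - w n y s) / lam"] by (intro mult_nonneg_nonneg) auto
    then show "k n y s * (lam + w n y s) - k n y s * w (Suc n) y s + k n y s * w (Suc n) y s
        \<le> lam * exp (- (v y s - log_payoff K y) / lam) + k n y s * v y s + 0"
      unfolding bregman[symmetric] by simp
  qed (auto simp: less_imp_le[OF k_pos])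
  then show ?thesis by simp
qed

abbreviation m where "m \<equiv> sup_norm T (\<lambda>x t. max (log_payoff K x - u 1 x t) 0)"

lemma m_bounded: "bounded_on_strip T (\<lambda>x t. max (log_payoff K x - u 1 x t) 0)"
proof -
  obtain B where B: "0 < B" "\<And>x t. \<bar>w 1 x t\<bar> \<le> B" using w_cbf by (rule cbf_obtain_bound) blast
  show ?thesis
  proof (rule strip_bound(1)[OF T_pos])
    show "\<bar>max (log_payoff K x - u 1 x t) 0\<bar> \<le> K + B" if "t \<in> {0..T}" for x t
      using B(2)[of x t] log_payoff_bounds[OF K_pos, of x] B(1) K_pos unfolding w_strip[OF that]
      by (auto simp: abs_le_iff)
  qed
qed

lemma m_nonneg: "0 \<le> m"
  using sup_norm_upper[OF m_bounded, of 0 0] T_pos by (simp add: order_trans[OF abs_ge_zero])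

lemma payoff_minus_w: "t \<in> {0..T} \<Longrightarrow> log_payoff K x - w (Suc n) x t \<le> m"
proof -
  assume t: "t \<in> {0..T}"
  have "log_payoff K x - u 1 x t \<le> m" using sup_norm_upper[OF m_bounded t, of x] by linarith
  then show ?thesis using w_one_le[OF t, of x n] unfolding w_strip[OF t, of 1] by linarith
qed

text \<open>
  In the induction step the linearisation error is at most \<open>k\<close> times the previous error, and
  \<open>k \<le> e\<^bsup>m/lam\<^esup>\<close> because the iterates stay above \<open>u 1\<close>. The base case uses \<open>u 1 \<ge> h - m \<ge> - m\<close>.
\<close>

lemma error_bound:
  assumes t: "t \<in> {0..T}"
  shows "v x t - w (Suc n) x t \<le> (m + K + lam * T) * (exp (m / lam) * (T - t)) ^ n / fact n"
  using t
proof (induction n arbitrary: x t)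
  case 0
  have "ulam x t \<le> K + lam * (T - t)" using opt 0 by (simp add: is_optimal_value_def)
  moreover have "lam * (T - t) \<le> lam * T" using lam_pos 0 by (intro mult_left_mono) auto
  moreover have "- m \<le> w (Suc 0) x t"
    using payoff_minus_w[OF 0, of x 0] log_payoff_bounds(1)[OF K_pos, of x] by linarith
  ultimately show ?case using 0 by simp
next
  case (Suc n)
  let ?B = "m + K + lam * T" and ?a = "exp (m / lam)"
  let ?\<beta> = "\<lambda>s. ?a * (?B * (?a * (T - s)) ^ n / fact n)"
  have B0: "0 \<le> ?B" using m_nonneg K_pos lam_pos T_pos by simp
  have "v x t \<le> w (Suc (Suc n)) x t + (LBINT s:{t..T}. ?\<beta> s)"
  proof (rule killed_comparison[OF v_source_cbf v_cbf v_mild w_source_cbf w_cbf w_mild k_cbf[OF w_cbf, of "Suc n"] _ Suc.prems])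
    show "continuous_on {t..T} ?\<beta>" by (intro continuous_intros) auto
    show "0 \<le> ?\<beta> s" if "s \<in> {t..T}" for s
      using B0 that by (intro mult_nonneg_nonneg divide_nonneg_nonneg) auto
    fix y s assume s: "s \<in> {t..T}"
    then have s': "s \<in> {0..T}" using Suc.prems by auto
    let ?k = "k (Suc n) y s" and ?z = "(v y s - w (Suc n) y s) / lam"
    have z: "0 \<le> ?z" using w_le_v[OF s'] lam_pos by simp
    have "lam * ?k * (exp (- ?z) - 1 + ?z) \<le> lam * ?k * ?z"
      using z lam_pos k_pos[of "Suc n" y s] by (intro mult_left_mono) auto
    also have "\<dots> = ?k * (v y s - w (Suc n) y s)" using lam_pos by simp
    also have "\<dots> \<le> ?\<beta> s"
    proof (rule mult_mono[OF _ Suc.IH[OF s']])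
      show "?k \<le> ?a" unfolding k_def using payoff_minus_w[OF s', of y n] lam_pos
        by (simp add: divide_right_mono)
    qed (use w_le_v[OF s'] in auto)
    finally show "lam * exp (- (v y s - log_payoff K y) / lam) + ?k * v y s
        \<le> ?k * (lam + w (Suc n) y s) - ?k * w (Suc (Suc n)) y s + ?k * w (Suc (Suc n)) y s + ?\<beta> s"
      unfolding bregman[symmetric] by simp
  qed (auto simp: less_imp_le[OF k_pos])
  moreover have "(LBINT s:{t..T}. ?\<beta> s) = ?B * (?a * (T - t)) ^ Suc n / fact (Suc n)"
  proof -
    let ?G = "\<lambda>s. - (?B * (?a * (T - s)) ^ Suc n / fact (Suc n))"
    have "(LBINT s:{t..T}. ?\<beta> s) = ?G T - ?G t"
    proof (rule set_integral_FTC)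
      show "(?G has_real_derivative ?\<beta> s) (at s within {t..T})" for s
        by (rule power_over_fact_derivative)
    qed (use Suc.prems in \<open>auto intro!: continuous_intros\<close>)
    then show ?thesis by simp
  qed
  ultimately show ?case by linarith
qed

lemma convergence_bound:
  assumes "1 \<le> n"
  shows "bounded_on_strip T (\<lambda>x t. u (n + 1) x t - ulam x t)"
    "sup_norm T (\<lambda>x t. u (n + 1) x t - ulam x t)
       \<le> 1 ^ n * (T ^ n / fact n) * exp (real n * (m / lam + r * T)) * (m + K + lam * T)"
proof -
  have b: "\<bar>u (n + 1) x t - ulam x t\<bar>
      \<le> 1 ^ n * (T ^ n / fact n) * exp (real n * (m / lam + r * T)) * (m + K + lam * T)"
    if t: "t \<in> {0..T}" for x t
  proof -
    let ?B = "m + K + lam * T"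
    have B0: "0 \<le> ?B" using m_nonneg K_pos lam_pos T_pos by simp
    have "\<bar>u (n + 1) x t - ulam x t\<bar> = v x t - w (Suc n) x t"
      using w_le_v[OF t, of n x] t by (simp add: w_strip)
    also have "\<dots> \<le> ?B * (exp (m / lam) * (T - t)) ^ n / fact n" by (rule error_bound[OF t])
    also have "\<dots> \<le> ?B * (exp (m / lam + r * T) * T) ^ n / fact n"
    proof (intro divide_right_mono mult_left_mono power_mono mult_mono B0)
      show "exp (m / lam) \<le> exp (m / lam + r * T)" using r_pos T_pos by simp
    qed (use t in auto)
    also have "\<dots> = 1 ^ n * (T ^ n / fact n) * exp (real n * (m / lam + r * T)) * ?B"
      by (simp add: power_mult_distrib exp_of_nat_mult)
    finally show ?thesis .
  qed
  show "bounded_on_strip T (\<lambda>x t. u (n + 1) x t - ulam x t)" by (rule strip_bound(1)[OF T_pos b])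
  show "sup_norm T (\<lambda>x t. u (n + 1) x t - ulam x t)
       \<le> 1 ^ n * (T ^ n / fact n) * exp (real n * (m / lam + r * T)) * (m + K + lam * T)"
    by (rule strip_bound(2)[OF T_pos b])
qed

end

theorem theorem3p4:
  fixes r \<sigma> K :: real
  assumes "0 < r" and "0 < \<sigma>" and "0 < K"
  shows "\<exists>C>0. \<forall>T>0. \<forall>lam>0.
    \<forall>(M :: 'a measure) F W u0 \<pi> u ulam.
      brownian_motion M F W \<longrightarrow>
      u0 \<in> bcontfun \<longrightarrow>
      policy_iteration M F W r \<sigma> K lam T u0 \<pi> u \<longrightarrow>
      is_optimal_value r \<sigma> K lam T ulam \<longrightarrow>
      (let m = sup_norm T (\<lambda>x t. max (log_payoff K x - u 1 x t) 0)
       in bounded_on_strip T (\<lambda>x t. max (log_payoff K x - u 1 x t) 0) \<and>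
          (\<forall>n\<ge>1.
             bounded_on_strip T (\<lambda>x t. u (n + 1) x t - ulam x t) \<and>
             sup_norm T (\<lambda>x t. u (n + 1) x t - ulam x t)
               \<le> C ^ n * (T ^ n / fact n) * exp (real n * (m / lam + r * T)) * (m + K + lam * T)))"
proof (intro exI[of _ "1::real"] conjI allI impI)
  fix T lam :: real and M :: "'a measure" and F W u0 \<pi> u ulam
  assume *: "0 < T" "0 < lam" "brownian_motion M F W" "u0 \<in> bcontfun"
    "policy_iteration M F W r \<sigma> K lam T u0 \<pi> u" "is_optimal_value r \<sigma> K lam T ulam"
  interpret brownian_motion M F W by fact
  interpret policy_scheme M F W r \<sigma> T K lam u0 \<pi> u ulam
    by unfold_locales (use * assms log_payoff_bounds[OF assms(3)] log_payoff_continuous in auto)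
  show "let m = sup_norm T (\<lambda>x t. max (log_payoff K x - u 1 x t) 0)
       in bounded_on_strip T (\<lambda>x t. max (log_payoff K x - u 1 x t) 0) \<and>
          (\<forall>n\<ge>1.
             bounded_on_strip T (\<lambda>x t. u (n + 1) x t - ulam x t) \<and>
             sup_norm T (\<lambda>x t. u (n + 1) x t - ulam x t)
               \<le> 1 ^ n * (T ^ n / fact n) * exp (real n * (m / lam + r * T)) * (m + K + lam * T))"
    unfolding Let_def using m_bounded convergence_bound by blast
qed simp

end
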